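(* Let $q$ be a prime with $q\equiv 3 \pmod 4$, let $K=\mathbb{Q}(\sqrt{-q})$ and $F=K(\sqrt[4]{-q})$, where $\sqrt[4]{-q}$ denotes a square root of $\sqrt{-q}$ (so $[F:\mathbb{Q}]=4$). Let $\mathfrak{P}$ be the unique prime of $F$ above $2$ which is ramified in $F/\mathbb{Q}$, and let $\eta$ be a fundamental unit of $F$ (when $q=3$, $\eta$ is multiplied by a third root of unity if necessary so that $\eta\equiv 1 \pmod{\mathfrak{P}}$). Then: (1) if $q\equiv 3 \pmod 8$, then $\mathrm{ord}_{\mathfrak{P}}(\log_{\mathfrak{P}}(\eta))=0$; (2) if $q\equiv 7 \pmod{16}$, then $\mathrm{ord}_{\mathfrak{P}}(\log_{\mathfrak{P}}(\eta))=2$; (3) if $q\equiv 15 \pmod{16}$, then $\mathrm{ord}_{\mathfrak{P}}(\log_{\mathfrak{P}}(\eta))\geq 4$.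
   Context: The unit group of $F$ has rank $1$; a fundamental unit is a generator of the unit group modulo its torsion. There is exactly one prime $\mathfrak{P}$ of $F$ above $2$ ramified in $F/\mathbb{Q}$, with ramification index $2$. For $q>3$ every unit $\eta$ of $F$ satisfying $N_{F/K}(\eta)=1$ (in particular the fundamental unit) satisfies $\eta\equiv 1 \pmod{\mathfrak{P}}$. $\mathrm{ord}_{\mathfrak{P}}$ is the normalized valuation of $F$ at $\mathfrak{P}$ (so $\mathrm{ord}_{\mathfrak{P}}(2)=2$), and $\log_{\mathfrak{P}}$ is the $\mathfrak{P}$-adic logarithm $\log_{\mathfrak{P}}(1+x)=\sum_{n\ge1}(-1)^{n+1}x^n/n$ on the principal units of the completion $F_{\mathfrak{P}}$. *)

theory Defs
  imports
    Complex_Main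
    "HOL-Library.Extended_Real"
    "HOL-Number_Theory.Cong"
    "HOL-Algebra.Generated_Fields"
    "HOL-Algebra.Generated_Groups"
    "HOL-Algebra.QuotRing"
    "HOL-Algebra.Ideal_Product"
    "HOL-Algebra.Algebraic_Closure_Type"
begin

text \<open>
  Number fields are subsets of the complex numbers; all their ring structures are restrictions
  of the following one.
\<close>

abbreviation complex_ring :: "complex ring" where
  "complex_ring \<equiv> ring_of_type_algebra"

definition adjoin :: "complex set \<Rightarrow> complex \<Rightarrow> complex set" where
  "adjoin K x = generate_field complex_ring (insert x K)"

definition ring_of_integers :: "complex set \<Rightarrow> complex ring" where
  "ring_of_integers F = complex_ring\<lparr>carrier := {x \<in> F. algebraic_int x}\<rparr>"

definition unit_group :: "complex set \<Rightarrow> complex monoid" where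
  "unit_group F = units_of (ring_of_integers F)"

definition torsion :: "('a, 'b) monoid_scheme \<Rightarrow> 'a set" where
  "torsion G = {u \<in> carrier G. \<exists>n::nat. n > 0 \<and> u [^]\<^bsub>G\<^esub> n = \<one>\<^bsub>G\<^esub>}"

text \<open>
  This is the notion for unit rank one: the class of \<open>\<eta>\<close> generates the unit group modulo torsion.
\<close>

definition fundamental_unit :: "complex set \<Rightarrow> complex \<Rightarrow> bool" where
  "fundamental_unit F \<eta> \<longleftrightarrow>
     (let U = unit_group F; T = torsion U in
        \<eta> \<in> carrier U \<and> generate (U Mod T) {T #>\<^bsub>U\<^esub> \<eta>} = carrier (U Mod T))"

definition prime_above :: "complex set \<Rightarrow> nat \<Rightarrow> complex set \<Rightarrow> bool" where
  "prime_above F p P \<longleftrightarrow> primeideal P (ring_of_integers F) \<and> of_nat p \<in> P"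

definition ideal_power :: "complex set \<Rightarrow> complex set \<Rightarrow> nat \<Rightarrow> complex set" where
  "ideal_power F P n = P [^]\<^bsub>ideals_set (ring_of_integers F)\<^esub> n"

text \<open>
  The normalized valuation at a nonzero prime \<open>P\<close>: on integers it is the largest \<open>n\<close> with
  \<open>x \<in> P\<^sup>n\<close> (the supremum gives \<open>\<infinity>\<close> at \<open>0\<close>), extended to the quotient field.
\<close>

definition ord_int :: "complex set \<Rightarrow> complex set \<Rightarrow> complex \<Rightarrow> ereal" where
  "ord_int F P x = (SUP n \<in> {n. x \<in> ideal_power F P n}. ereal (real n))"

definition ord_at :: "complex set \<Rightarrow> complex set \<Rightarrow> complex \<Rightarrow> ereal" where
  "ord_at F P x = (THE v. \<exists>a \<in> carrier (ring_of_integers F). \<exists>b \<in> carrier (ring_of_integers F) - {0}.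
     x = a / b \<and> v = ord_int F P a - ord_int F P b)"

definition ramification_index :: "complex set \<Rightarrow> complex set \<Rightarrow> nat \<Rightarrow> ereal" where
  "ramification_index F P p = ord_at F P (of_nat p)"

definition ramified :: "complex set \<Rightarrow> complex set \<Rightarrow> nat \<Rightarrow> bool" where
  "ramified F P p \<longleftrightarrow> ramification_index F P p > 1"

text \<open>
  The completion of \<open>F\<close> at \<open>P\<close>: Cauchy sequences for the \<open>P\<close>-adic valuation modulo null sequences.
\<close>

definition cauchy_ring :: "complex set \<Rightarrow> complex set \<Rightarrow> (nat \<Rightarrow> complex) ring" where
  "cauchy_ring F P =
     \<lparr>carrier = {x. range x \<subseteq> F \<and>
        (\<forall>M::real. \<exists>N. \<forall>m\<ge>N. \<forall>n\<ge>N. ord_at F P (x m - x n) \<ge> ereal M)},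
      mult = (\<lambda>x y n. x n * y n), one = (\<lambda>_. 1),
      zero = (\<lambda>_. 0), add = (\<lambda>x y n. x n + y n)\<rparr>"

definition null_sequences :: "complex set \<Rightarrow> complex set \<Rightarrow> (nat \<Rightarrow> complex) set" where
  "null_sequences F P = {x \<in> carrier (cauchy_ring F P). (\<lambda>n. ord_at F P (x n)) \<longlonglongrightarrow> \<infinity>}"

definition completion :: "complex set \<Rightarrow> complex set \<Rightarrow> (nat \<Rightarrow> complex) set ring" where
  "completion F P = cauchy_ring F P Quot null_sequences F P"

definition to_completion ::
    "complex set \<Rightarrow> complex set \<Rightarrow> complex \<Rightarrow> (nat \<Rightarrow> complex) set" where
  "to_completion F P a = null_sequences F P +>\<^bsub>cauchy_ring F P\<^esub> (\<lambda>_. a)"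

text \<open>The continuous extension of the valuation: the common limit along all representatives.\<close>

definition ord_completion ::
    "complex set \<Rightarrow> complex set \<Rightarrow> (nat \<Rightarrow> complex) set \<Rightarrow> ereal" where
  "ord_completion F P z = (THE v. \<forall>x\<in>z. (\<lambda>n. ord_at F P (x n)) \<longlonglongrightarrow> v)"

definition converges_to :: "complex set \<Rightarrow> complex set \<Rightarrow>
    (nat \<Rightarrow> (nat \<Rightarrow> complex) set) \<Rightarrow> (nat \<Rightarrow> complex) set \<Rightarrow> bool" where
  "converges_to F P z L \<longleftrightarrow> L \<in> carrier (completion F P) \<and>
     (\<lambda>n. ord_completion F P (z n \<ominus>\<^bsub>completion F P\<^esub> L)) \<longlonglongrightarrow> \<infinity>"

definition log_series :: "complex set \<Rightarrow> complex set \<Rightarrow>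
    (nat \<Rightarrow> complex) set \<Rightarrow> nat \<Rightarrow> (nat \<Rightarrow> complex) set" where
  "log_series F P x N = (\<Oplus>\<^bsub>completion F P\<^esub>n \<in> {1..N}.
     to_completion F P ((-1) ^ (n + 1) / of_nat n) \<otimes>\<^bsub>completion F P\<^esub> (x [^]\<^bsub>completion F P\<^esub> n))"

text \<open>Meaningful only on principal units, i.e. for \<open>u - 1\<close> of positive valuation.\<close>

definition log_completion ::
    "complex set \<Rightarrow> complex set \<Rightarrow> (nat \<Rightarrow> complex) set \<Rightarrow> (nat \<Rightarrow> complex) set" where
  "log_completion F P u =
     (THE L. converges_to F P (log_series F P (u \<ominus>\<^bsub>completion F P\<^esub> \<one>\<^bsub>completion F P\<^esub>)) L)"

end

theory Submission
  imports
    Defs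
    "HOL-Real_Asymp.Real_Asymp"
    "HOL-Computational_Algebra.Squarefree"
    "HOL-Number_Theory.Residues"
begin

text \<open>
  Write \<open>\<eta> = x + y \<alpha>\<close> with \<open>x\<close>, \<open>y\<close> in \<open>K\<close>. Since \<open>-1\<close> is not a square modulo \<open>q\<close>, the relative norm
  \<open>x\<^sup>2 - s y\<^sup>2\<close> of \<open>\<eta>\<close> is 1, so \<open>\<delta> = \<eta> - 1\<close> satisfies \<open>\<delta>\<^sup>2 = 2 (x - 1) \<eta>\<close>; with this relation the terms
  of the logarithm series that matter become polynomials in \<open>x\<close>, \<open>\<delta>\<close> and \<open>\<eta>\<close>, whose valuation is read
  off from \<open>x\<close> modulo a small power of \<open>P\<close>. When 2 is inert in \<open>K\<close>, the norm equation excludes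
  \<open>x \<equiv> 0\<close> modulo \<open>P\<close>; when 2 splits and \<open>x \<equiv> 0\<close>, it determines \<open>x\<^sup>2\<close> modulo 8 in terms of \<open>q\<close>.

  The residue \<open>x \<equiv> 1\<close> does no harm for \<open>q \<equiv> 15\<close> modulo 16, and is excluded otherwise because it makes
  \<open>\<eta>\<close> (or \<open>\<eta> ^ 3\<close>) a square up to sign: \<open>a = (x + 1) / 2\<close> and \<open>b = (x - 1) / 2\<close> are coprime integers
  of \<open>K\<close> with \<open>a b = s (y / 2)\<^sup>2\<close>, so \<open>a\<close> is, up to sign and a factor \<open>s = \<alpha>\<^sup>2\<close>, the square of an element
  of \<open>K\<close>, and \<open>\<eta> = (1 + \<eta>)\<^sup>2 / (4 a)\<close>. That coprime factors of a square are squares up to sign replaces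
  the oddness of the class number of \<open>K\<close>. A fundamental unit is not a square up to sign, as a
  Pell equation argument over \<open>\<int>[s]\<close> yields a unit of absolute value different from 1.
\<close>

section \<open>The valuation at a prime above 2\<close>

text \<open>The completion is left at once: \<open>\<eta> - 1\<close> lies in \<open>F\<close>, so
  the partial sums of its logarithm are elements of \<open>F\<close>, and the valuation of their
  class is read off from them. Valuations in \<open>F\<close> are handled without localizing, by
  allowing a multiplier outside \<open>P\<close> on the left of every identity. The modulus 16 comes
  from \<open>\<omega> = (1 + s) / 2\<close> and
  \<open>\<omega> * (1 - \<omega>) = Q = (q + 1) / 4\<close>. For odd \<open>Q\<close>, 2 is inert
  in \<open>K\<close>. For even \<open>Q\<close> it splits, the ramified prime is the one containing
  \<open>\<omega>\<close>, and there \<open>\<omega>\<close> has the valuation of \<open>Q\<close>.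
  If \<open>x \<equiv> 0\<close> in the split case, then \<open>x\<^sup>2\<close> is congruent to
  \<open>2 * \<omega>\<close> modulo 8, so \<open>x\<close> has valuation 2 for \<open>Q\<close>
  congruent to 2 modulo 4, and at least 4 if 4 divides \<open>Q\<close>. The relative norm of a unit
  is a unit of \<open>K\<close>. This leaves 1 and -1, except for \<open>q = 3\<close>, where
  \<open>\<eta> \<equiv> 1\<close> modulo \<open>P\<close> excludes the other roots of unity;
  reduction modulo \<open>s\<close> then excludes -1.\<close>

definition integers_of :: "complex set \<Rightarrow> complex set" where
  "integers_of F = {x \<in> F. algebraic_int x}"

lemma carrier_ring_of_integers [simp]: "carrier (ring_of_integers F) = integers_of F"
  and mult_ring_of_integers [simp]: "x \<otimes>\<^bsub>ring_of_integers F\<^esub> y = x * y"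
  and add_ring_of_integers [simp]: "x \<oplus>\<^bsub>ring_of_integers F\<^esub> y = x + y"
  and one_ring_of_integers [simp]: "\<one>\<^bsub>ring_of_integers F\<^esub> = 1"
  and zero_ring_of_integers [simp]: "\<zero>\<^bsub>ring_of_integers F\<^esub> = 0"
  by (simp_all add: ring_of_integers_def ring_of_type_algebra_def integers_of_def)

lemma integers_of_subset: "integers_of F \<subseteq> F"
  and algebraic_int_integers_of: "x \<in> integers_of F \<Longrightarrow> algebraic_int x"
  by (auto simp: integers_of_def)

lemma ideal_power_0: "ideal_power F P 0 = integers_of F"
  by (simp add: ideal_power_def ideals_set_def nat_pow_def)

lemma ideal_power_Suc: "ideal_power F P (Suc n) = ideal_prod (ring_of_integers F) (ideal_power F P n) P"
  by (simp add: ideal_power_def ideals_set_def nat_pow_def)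

text \<open>The closure of the algebraic integers of \<open>F\<close> under sums and products is
  taken from the structure: \<open>primeideal P (ring_of_integers F)\<close> contains the ring
  axioms, and \<open>ring_integers\<close> is discharged from it.\<close>

locale integers_ring =
  fixes F :: "complex set"
  assumes ring_integers: "ring (ring_of_integers F)"
    and uminus_closed: "x \<in> F \<Longrightarrow> - x \<in> F"
begin

abbreviation "OF \<equiv> integers_of F"

interpretation ring "ring_of_integers F" by (rule ring_integers)

lemma int_add: "x \<in> OF \<Longrightarrow> y \<in> OF \<Longrightarrow> x + y \<in> OF"
  using a_closed[of x y] by simp

lemma int_mult: "x \<in> OF \<Longrightarrow> y \<in> OF \<Longrightarrow> x * y \<in> OF"
  using m_closed[of x y] by simp

lemma int_0: "0 \<in> OF" using zero_closed by simp

lemma int_1: "1 \<in> OF" using one_closed by simp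

lemma int_minus: "x \<in> OF \<Longrightarrow> - x \<in> OF"
  using uminus_closed by (auto simp: integers_of_def)

lemma int_diff: "x \<in> OF \<Longrightarrow> y \<in> OF \<Longrightarrow> x - y \<in> OF"
  using int_add[OF _ int_minus, of x y] by simp

lemma int_power: "x \<in> OF \<Longrightarrow> x ^ n \<in> OF"
  by (induction n) (auto intro: int_1 int_mult)

lemma int_of_nat: "of_nat n \<in> OF"
  by (induction n) (auto intro: int_1 int_0 int_add)

lemma int_of_int: "of_int n \<in> OF"
  by (cases n rule: int_cases2) (auto intro: int_of_nat int_minus)

lemma int_numeral: "numeral n \<in> OF"
  using int_of_nat[of "numeral n"] by simp

lemma int_poly: "z \<in> OF \<Longrightarrow> poly (map_poly of_int p) z \<in> OF"
  by (induction p) (auto simp: map_poly_pCons int_0 intro!: int_add int_mult int_of_int)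

lemmas int_intros = int_add int_mult int_0 int_1 int_minus int_diff int_power int_of_nat int_of_int
  int_numeral

text \<open>Strip factors of \<open>z\<close> from a monic integer polynomial vanishing at
  \<open>z\<close> until the constant coefficient is nonzero; \<open>w\<close> is the value at
  \<open>z\<close> of what follows it. The integer \<open>N\<close> later bounds the powers of
  \<open>\<pi>\<close> dividing \<open>z\<close>.\<close>

lemma dvd_integer:
  assumes "z \<in> OF" "z \<noteq> 0"
  shows "\<exists>w\<in>OF. \<exists>N::int. N \<noteq> 0 \<and> z * w = of_int N"
proof -
  have "\<exists>w\<in>OF. \<exists>N::int. N \<noteq> 0 \<and> z * w = of_int N"
    if "poly (map_poly of_int p) z = 0" "p \<noteq> 0" for p
    using that
  proof (induction p)
    case (pCons c p)
    have eq: "z * poly (map_poly of_int p) z = - of_int c"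
      using pCons.prems(1) by (simp add: map_poly_pCons add_eq_0_iff)
    show ?case
    proof (cases "c = 0")
      case True
      with eq assms pCons show ?thesis by auto
    next
      case False
      with eq assms show ?thesis
        by (intro bexI[of _ "poly (map_poly of_int p) z"] exI[of _ "- c"]) (auto intro: int_poly)
    qed
  qed auto
  moreover from algebraic_int_integers_of[OF assms(1)] obtain p where
    "poly (map_poly of_int p) z = 0" "lead_coeff p = 1" 
    by (auto simp: algebraic_int_altdef_ipoly)
  ultimately show ?thesis by (metis leading_coeff_0_iff zero_neq_one)
qed

end

section \<open>Prime ideals containing 2\<close>

locale integers_prime = integers_ring +
  fixes P :: "complex set"
  assumes primeideal: "primeideal P (ring_of_integers F)" and two_in: "2 \<in> P"
begin

interpretation P: primeideal P "ring_of_integers F" by (rule primeideal)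

lemma P_subset: "x \<in> P \<Longrightarrow> x \<in> OF" using P.a_subset by auto

lemma P_add: "x \<in> P \<Longrightarrow> y \<in> P \<Longrightarrow> x + y \<in> P"
  using additive_subgroup.a_closed[OF P.additive_subgroup_axioms, of x y] by simp

lemma P_multl: "x \<in> OF \<Longrightarrow> y \<in> P \<Longrightarrow> x * y \<in> P"
  using P.I_l_closed[of y x] by simp

lemma P_multr: "x \<in> P \<Longrightarrow> y \<in> OF \<Longrightarrow> x * y \<in> P"
  using P_multl[of y x] by (simp add: mult.commute)

lemma P_minus: "x \<in> P \<Longrightarrow> - x \<in> P"
  using P_multl[of "-1" x] int_minus[OF int_1] by simp

lemma P_diff: "x \<in> P \<Longrightarrow> y \<in> P \<Longrightarrow> x - y \<in> P"
  using P_add[OF _ P_minus, of x y] by simp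

lemma P_0: "0 \<in> P" using P_multl[OF int_0 two_in] by simp

lemma P_prime: "x \<in> OF \<Longrightarrow> y \<in> OF \<Longrightarrow> x * y \<in> P \<Longrightarrow> x \<in> P \<or> y \<in> P"
  using P.I_prime[of x y] by simp

lemma one_notin_P: "1 \<notin> P"
proof
  assume "1 \<in> P"
  then have "P = OF" using P_multl[of _ 1] P_subset by auto
  then show False using P.I_notcarr by simp
qed

abbreviation "U \<equiv> OF - P"

lemma U_mult: "x \<in> U \<Longrightarrow> y \<in> U \<Longrightarrow> x * y \<in> U"
  using P_prime[of x y] by (auto intro: int_mult)

lemma U_1: "1 \<in> U" using one_notin_P int_1 by auto

lemma U_power: "x \<in> U \<Longrightarrow> x ^ n \<in> U"
  by (induction n) (simp_all del: Diff_iff add: U_1 U_mult)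

lemma U_nonzero: "x \<in> U \<Longrightarrow> x \<noteq> 0"
  using P_0 by auto

lemma P_power: "x \<in> P \<Longrightarrow> n > 0 \<Longrightarrow> x ^ n \<in> P"
  by (induction n) (auto intro: P_multr int_power P_subset)

lemma P_power_iff: "x \<in> OF \<Longrightarrow> n > 0 \<Longrightarrow> x ^ n \<in> P \<longleftrightarrow> x \<in> P"
  using U_power[of x n] P_power[of x n] by auto

lemma P_even: "of_int n \<in> P \<longleftrightarrow> even n"
proof
  have *: "of_int n \<in> P" if "even n" for n
    using that P_multr[OF two_in int_of_int] by (auto elim!: evenE)
  then show "even n \<Longrightarrow> of_int n \<in> P" .
  assume "of_int n \<in> P"
  show "even n"
  proof (rule ccontr)
    assume "odd n"
    then have "of_int (n - 1) \<in> P" by (intro *) auto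
    from P_diff[OF \<open>of_int n \<in> P\<close> this] show False using one_notin_P by simp
  qed
qed

lemma P_even_nat: "of_nat n \<in> P \<longleftrightarrow> even n"
  using P_even[of "int n"] by simp

text \<open>
  Primes above 2 are maximal: cancel the factors \<open>z\<close> of a polynomial with integer coefficients
  that has an odd coefficient and whose value at \<open>z\<close> is in \<open>P\<close>.
\<close>

lemma inverse_mod:
  assumes "z \<in> U"
  shows "\<exists>e\<in>OF. 1 - z * e \<in> P"
proof -
  have z: "z \<in> OF" "z \<notin> P" using assms by auto
  have "\<exists>e\<in>OF. 1 - z * e \<in> P"
    if "poly (map_poly of_int p) z \<in> P" "\<exists>i. odd (coeff p i)" for p
    using that
  proof (induction p)
    case 0
    then show ?case by simp
  next
    case (pCons c p)
    let ?v = "poly (map_poly of_int p) z"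
    have v: "?v \<in> OF" by (rule int_poly[OF z(1)])
    have mem: "of_int c + z * ?v \<in> P"
      using pCons.prems(1) by (simp add: map_poly_pCons)
    show ?case
    proof (cases "even c")
      case True
      then have "z * ?v \<in> P" using P_diff[OF mem, of "of_int c"] P_even by simp
      then have "?v \<in> P" using P_prime z v by blast
      moreover have "\<exists>i. odd (coeff p i)"
      proof -
        obtain i where i: "odd (coeff (pCons c p) i)" using pCons.prems(2) by blast
        with True show ?thesis by (cases i) auto
      qed
      ultimately show ?thesis by (rule pCons.IH)
    next
      case False
      then have "of_int (1 - c) \<in> P" using P_even[of "1 - c"] by simp
      from P_add[OF this mem] have "1 - z * (- ?v) \<in> P" by simp
      with v show ?thesis by (intro bexI[of _ "- ?v"]) (auto intro: int_minus)
    qed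
  qed
  moreover from algebraic_int_integers_of[OF z(1)] obtain p where
    "poly (map_poly of_int p) z = 0" "lead_coeff p = 1" 
    by (auto simp: algebraic_int_altdef_ipoly)
  moreover from this(2) have "\<exists>i. odd (coeff p i)" by (metis odd_one)
  ultimately show ?thesis using P_0 by (metis (no_types))
qed

lemma ideal_power_multl: "x \<in> ideal_power F P n \<Longrightarrow> r \<in> OF \<Longrightarrow> r * x \<in> ideal_power F P n"
proof -
  have "ideal (ideal_power F P n) (ring_of_integers F)"
    by (induction n) (auto simp: ideal_power_0 ideal_power_Suc
        intro!: P.ideal_prod_is_ideal P.is_ideal P.oneideal[simplified])
  then interpret I: ideal "ideal_power F P n" "ring_of_integers F" .
  show "x \<in> ideal_power F P n \<Longrightarrow> r \<in> OF \<Longrightarrow> r * x \<in> ideal_power F P n"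
    using I.I_l_closed[of x r] by simp
qed

lemma ideal_power_add:
  "x \<in> ideal_power F P n \<Longrightarrow> y \<in> ideal_power F P n \<Longrightarrow> x + y \<in> ideal_power F P n"
  using ideal_prod.sum[of x "ring_of_integers F" _ P y]
  by (cases n) (auto simp: ideal_power_0 ideal_power_Suc intro: int_add)

lemma ideal_power_mult:
  "x \<in> ideal_power F P n \<Longrightarrow> y \<in> P \<Longrightarrow> x * y \<in> ideal_power F P (Suc n)"
  using ideal_prod.prod[of x "ideal_power F P n" y P "ring_of_integers F"]
  by (simp add: ideal_power_Suc)

lemma power_in_ideal_power: "x \<in> P \<Longrightarrow> x ^ n \<in> ideal_power F P n"
proof (induction n)
  case (Suc n)
  then show ?case using ideal_power_mult[of "x ^ n" n x] by (simp add: mult.commute)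
qed (auto simp: ideal_power_0 int_1)

end

text \<open>
  \<open>P\<close> is locally generated by \<open>\<pi>\<close>, which makes the localization at \<open>P\<close> a discrete valuation ring.
\<close>

locale principal_prime = integers_prime +
  fixes \<pi> :: complex and e :: nat
  assumes uniformizer: "\<pi> \<in> P"
    and locally_principal: "z \<in> P \<Longrightarrow> \<exists>d\<in>U. \<exists>r\<in>OF. d * z = \<pi> * r"
    and ram_two: "\<exists>u\<in>U. \<exists>w\<in>U. u * 2 = \<pi> ^ e * w"
    and fraction: "x \<in> F \<Longrightarrow> \<exists>N::int. N \<noteq> 0 \<and> of_int N * x \<in> OF"
    and add_closed: "x \<in> F \<Longrightarrow> y \<in> F \<Longrightarrow> x + y \<in> F"
    and mult_closed: "x \<in> F \<Longrightarrow> y \<in> F \<Longrightarrow> x * y \<in> F"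
    and inverse_closed: "x \<in> F \<Longrightarrow> inverse x \<in> F"
begin

lemma pi_int: "\<pi> \<in> OF" by (rule P_subset[OF uniformizer])

lemma e_pos: "e > 0"
proof (rule ccontr)
  assume "\<not> e > 0"
  then obtain u w where "u \<in> U" "w \<in> U" "u * 2 = w" using ram_two by auto
  then show False using P_multl[OF _ two_in, of u] by auto
qed

lemma pi_nonzero: "\<pi> \<noteq> 0"
proof
  assume "\<pi> = 0"
  obtain u w where "u \<in> U" "u * 2 = \<pi> ^ e * w" using ram_two by blast
  then show False using U_nonzero[of u] e_pos \<open>\<pi> = 0\<close> by (simp add: power_0_left)
qed

lemma ideal_power_locally_principal:
  "x \<in> ideal_power F P n \<Longrightarrow> \<exists>d\<in>U. \<exists>r\<in>OF. d * x = \<pi> ^ n * r"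
proof (induction n arbitrary: x)
  case 0
  then show ?case using U_1 by (auto simp: ideal_power_0 intro!: bexI[of _ 1])
next
  case (Suc n)
  from Suc.prems show ?case unfolding ideal_power_Suc
  proof (induction rule: ideal_prod.induct)
    case (prod i j)
    from Suc.IH[OF prod(1)] obtain d r where 1: "d \<in> U" "r \<in> OF" "d * i = \<pi> ^ n * r" by blast
    from locally_principal[OF prod(2)] obtain d' r' where
      2: "d' \<in> U" "r' \<in> OF" "d' * j = \<pi> * r'" by blast
    have "(d * d') * (i * j) = (d * i) * (d' * j)" by simp
    also have "\<dots> = \<pi> ^ Suc n * (r * r')" unfolding 1 2 by simp
    finally show ?case using U_mult[OF 1(1) 2(1)] int_mult[OF 1(2) 2(2)] by auto
  next
    case (sum x y)
    then obtain d r d' r' where 1: "d \<in> U" "r \<in> OF" "d * x = \<pi> ^ Suc n * r"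
      "d' \<in> U" "r' \<in> OF" "d' * y = \<pi> ^ Suc n * r'" by blast
    have "(d * d') * (x + y) = d' * (d * x) + d * (d' * y)" by (simp add: algebra_simps)
    also have "\<dots> = \<pi> ^ Suc n * (d' * r + d * r')" unfolding 1 by (simp add: algebra_simps)
    finally show ?case using U_mult[OF 1(1) 1(4)] 1 int_add[OF int_mult int_mult, of d' r d r']
      unfolding add_ring_of_integers by blast
  qed
qed

text \<open>Powers of \<open>P\<close> are primary: an inverse \<open>f\<close> of \<open>d\<close>
  modulo \<open>P\<close> puts \<open>(1 - d * f) ^ n\<close> into the \<open>n\<close>-th power,
  and this has the form \<open>1 - d * g\<close>, so \<open>g\<close> inverts \<open>d\<close>
  modulo that power.\<close>

lemma ideal_power_unit_cancel:
  assumes "d \<in> U" "x \<in> OF" "d * x \<in> ideal_power F P n"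
  shows "x \<in> ideal_power F P n"
proof -
  from inverse_mod[OF assms(1)] obtain f where f: "f \<in> OF" "1 - d * f \<in> P" by blast
  define p where "p = (1 - d * f) ^ n"
  have p: "p \<in> ideal_power F P n" unfolding p_def by (rule power_in_ideal_power[OF f(2)])
  have "\<exists>g\<in>OF. (1 - d * f) ^ n = 1 - d * g"
  proof (induction n)
    case (Suc n)
    then obtain g where g: "g \<in> OF" "(1 - d * f) ^ n = 1 - d * g" by blast
    have "(1 - d * f) ^ Suc n = 1 - d * (g + f - d * f * g)"
      unfolding power_Suc g by (simp add: algebra_simps)
    moreover have "g + f - d * f * g \<in> OF" using g f assms(1) by (auto intro!: int_intros)
    ultimately show ?case by blast
  qed (auto intro: int_0 bexI[of _ 0])
  then obtain g where g: "g \<in> OF" "p = 1 - d * g" by (auto simp: p_def)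
  have "x = g * (d * x) + x * p" unfolding g(2) by (simp add: algebra_simps)
  moreover have "g * (d * x) \<in> ideal_power F P n" by (rule ideal_power_multl[OF assms(3) g(1)])
  moreover have "x * p \<in> ideal_power F P n" by (rule ideal_power_multl[OF p assms(2)])
  ultimately show ?thesis using ideal_power_add by metis
qed

lemma pi_power_notin: "w \<in> U \<Longrightarrow> u \<in> U \<Longrightarrow> r \<in> OF \<Longrightarrow> k < n \<Longrightarrow> u * \<pi> ^ k * w \<noteq> \<pi> ^ n * r"
proof
  assume *: "w \<in> U" "u \<in> U" "r \<in> OF" "k < n" "u * \<pi> ^ k * w = \<pi> ^ n * r"
  then have "\<pi> ^ n = \<pi> ^ k * \<pi> ^ (n - k)" by (simp flip: power_add)
  then have "u * w = \<pi> ^ (n - k) * r" using *(5) pi_nonzero by simp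
  moreover have "\<pi> ^ (n - k) * r \<in> P" using P_power[OF uniformizer] * by (auto intro: P_multr)
  ultimately show False using U_mult[OF *(2,1)] by auto
qed

lemma ord_int_eq:
  assumes "x \<in> OF" "u \<in> U" "w \<in> U" "u * x = \<pi> ^ k * w"
  shows "ord_int F P x = ereal (real k)"
proof -
  have "\<pi> ^ k * w \<in> ideal_power F P k"
    using ideal_power_multl[OF power_in_ideal_power[OF uniformizer], of w k] assms
    by (simp add: mult.commute)
  then have k: "x \<in> ideal_power F P k"
    using ideal_power_unit_cancel[of u x k] assms by simp
  have "n \<le> k" if n: "x \<in> ideal_power F P n" for n
  proof (rule ccontr)
    assume "\<not> n \<le> k"
    from ideal_power_locally_principal[OF n] obtain d r where
      d: "d \<in> U" "r \<in> OF" "d * x = \<pi> ^ n * r" by blast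
    have "u * (d * x) = d * (u * x)" by simp
    then have "d * \<pi> ^ k * w = \<pi> ^ n * (u * r)"
      unfolding d(3) assms(4) by (simp add: algebra_simps)
    moreover have "u * r \<in> OF" using assms d by (auto intro: int_mult)
    ultimately show False using pi_power_notin[of w d "u * r" k n] assms d \<open>\<not> n \<le> k\<close> by auto
  qed
  then have "ord_int F P x \<le> ereal (real k)"
    unfolding ord_int_def by (intro SUP_least) auto
  moreover have "ereal (real k) \<le> ord_int F P x"
    unfolding ord_int_def using k by (intro SUP_upper) auto
  ultimately show ?thesis by (rule antisym)
qed

lemma zero_in_ideal_power: "0 \<in> ideal_power F P n"
  using ideal_power_multl[OF power_in_ideal_power[OF P_0] int_0] by simp

lemma ord_int_zero: "ord_int F P 0 = \<infinity>"
proof -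
  have "{n. 0 \<in> ideal_power F P n} = UNIV" using zero_in_ideal_power by auto
  then show ?thesis unfolding ord_int_def by (simp add: SUP_nat_Infty)
qed

text \<open>\<open>x\<close> divides an integer \<open>2 ^ j * M\<close> with \<open>M\<close> odd,
  so locally no power of \<open>\<pi>\<close> beyond \<open>e * j\<close> divides \<open>x\<close>.
  For the largest exponent that does, the cofactor is outside \<open>P\<close> by
  \<open>locally_principal\<close>.\<close>

lemma int_representation:
  assumes "x \<in> OF" "x \<noteq> 0"
  shows "\<exists>k. \<exists>u\<in>U. \<exists>w\<in>U. u * x = \<pi> ^ k * w"
proof -
  from dvd_integer[OF assms] obtain y N where y: "y \<in> OF" "N \<noteq> 0" "x * y = of_int N" by blast
  define j where "j = multiplicity 2 N"
  obtain M where M: "N = 2 ^ j * M" "odd M"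
    using multiplicity_decompose'[of N 2] y unfolding j_def by auto
  obtain u w where uw: "u \<in> U" "w \<in> U" "u * 2 = \<pi> ^ e * w" using ram_two by blast
  have MU: "of_int M \<in> U" using M P_even int_of_int by auto
  have eqN: "u ^ j * (x * y) = \<pi> ^ (e * j) * (w ^ j * of_int M)"
  proof -
    have "u ^ j * (x * y) = (u * 2) ^ j * of_int M"
      unfolding y M by (simp add: power_mult_distrib)
    then show ?thesis unfolding uw by (simp add: power_mult_distrib power_mult)
  qed
  have W: "w ^ j * of_int M \<in> U" "u ^ j \<in> U" using U_mult[OF U_power[OF uw(2)] MU] U_power uw by auto
  define A where "A = {n. \<exists>d\<in>U. \<exists>r\<in>OF. d * x = \<pi> ^ n * r}"
  have bound: "n \<le> e * j" if "n \<in> A" for n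
  proof (rule ccontr)
    assume n: "\<not> n \<le> e * j"
    from that obtain d r where d: "d \<in> U" "r \<in> OF" "d * x = \<pi> ^ n * r" by (auto simp: A_def)
    have "d * \<pi> ^ (e * j) * (w ^ j * of_int M) = d * (u ^ j * (x * y))" 
      unfolding eqN by (simp add: mult.assoc)
    also have "\<dots> = u ^ j * y * (d * x)" by simp
    also have "\<dots> = \<pi> ^ n * (u ^ j * y * r)" unfolding d by simp
    finally show False
      using pi_power_notin[OF W(1) d(1), of "u ^ j * y * r" "e * j" n] n W d y by (auto intro: int_mult)
  qed
  have "0 \<in> A" using assms U_1 by (auto simp: A_def intro!: bexI[of _ 1])
  define k where "k = Max A"
  have fin: "finite A" using bound by (meson finite_nat_set_iff_bounded_le)
  then have "k \<in> A" unfolding k_def using \<open>0 \<in> A\<close> by (intro Max_in) auto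
  then obtain d r where d: "d \<in> U" "r \<in> OF" "d * x = \<pi> ^ k * r" by (auto simp: A_def)
  have "r \<notin> P"
  proof
    assume "r \<in> P"
    from locally_principal[OF this] obtain d' r' where d': "d' \<in> U" "r' \<in> OF" "d' * r = \<pi> * r'" by blast
    have "(d' * d) * x = d' * (d * x)" by simp
    also have "\<dots> = \<pi> ^ k * (d' * r)" unfolding d by simp
    also have "\<dots> = \<pi> ^ Suc k * r'" unfolding d' by simp
    finally have "Suc k \<in> A" unfolding A_def using U_mult[OF d'(1) d(1)] d' by blast
    then show False using Max_ge[OF fin, of "Suc k"] unfolding k_def by simp
  qed
  with d show ?thesis by blast
qed

text \<open>For \<open>x\<close> in \<open>F\<close>, these express that the normalized valuation of \<open>x\<close> is \<open>k\<close>, or at least \<open>k\<close>.\<close>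

definition hasval :: "int \<Rightarrow> complex \<Rightarrow> bool" where
  "hasval k x \<longleftrightarrow> (\<exists>u\<in>U. \<exists>w\<in>U. u * x = \<pi> powi k * w)"

definition vge :: "int \<Rightarrow> complex \<Rightarrow> bool" where
  "vge k x \<longleftrightarrow> (\<exists>u\<in>U. \<exists>r\<in>OF. u * x = \<pi> powi k * r)"

lemma vge_mult: "vge k x \<Longrightarrow> vge l y \<Longrightarrow> vge (k + l) (x * y)"
proof -
  assume "vge k x" "vge l y"
  then obtain u r u' r' where 1: "u \<in> U" "r \<in> OF" "u * x = \<pi> powi k * r"
    "u' \<in> U" "r' \<in> OF" "u' * y = \<pi> powi l * r'" by (auto simp: vge_def)
  have "(u * u') * (x * y) = (u * x) * (u' * y)" by simp
  also have "\<dots> = \<pi> powi (k + l) * (r * r')"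
    unfolding 1 using pi_nonzero by (simp add: power_int_add)
  finally show ?thesis unfolding vge_def using U_mult[OF 1(1,4)] int_mult[OF 1(2,5)] by blast
qed

lemma hasval_mult: "hasval k x \<Longrightarrow> hasval l y \<Longrightarrow> hasval (k + l) (x * y)"
proof -
  assume "hasval k x" "hasval l y"
  then obtain u r u' r' where 1: "u \<in> U" "r \<in> U" "u * x = \<pi> powi k * r"
    "u' \<in> U" "r' \<in> U" "u' * y = \<pi> powi l * r'" by (auto simp: hasval_def)
  have "(u * u') * (x * y) = (u * x) * (u' * y)" by simp
  also have "\<dots> = \<pi> powi (k + l) * (r * r')"
    unfolding 1 using pi_nonzero by (simp add: power_int_add)
  finally show ?thesis unfolding hasval_def using U_mult[OF 1(1,4)] U_mult[OF 1(2,5)] by blast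
qed

lemma hasval_imp_vge: "hasval k x \<Longrightarrow> vge k x"
  unfolding hasval_def vge_def by blast

lemma vge_mono: "vge k x \<Longrightarrow> l \<le> k \<Longrightarrow> vge l x"
proof -
  assume "vge k x" and l: "l \<le> k"
  then obtain u r where 1: "u \<in> U" "r \<in> OF" "u * x = \<pi> powi k * r" by (auto simp: vge_def)
  have "\<pi> powi k = \<pi> powi l * \<pi> ^ nat (k - l)"
  proof -
    have "\<pi> powi (l + int (nat (k - l))) = \<pi> powi l * \<pi> ^ nat (k - l)"
      using power_int_add[of \<pi> l "int (nat (k - l))"] pi_nonzero by (simp del: int_nat_eq)
    then show ?thesis using l by simp
  qed
  then have "u * x = \<pi> powi l * (\<pi> ^ nat (k - l) * r)" using 1 by simp
  then show ?thesis unfolding vge_def using 1 pi_int by (blast intro: int_intros)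
qed

lemma vge_add: "vge k x \<Longrightarrow> vge k y \<Longrightarrow> vge k (x + y)"
proof -
  assume "vge k x" "vge k y"
  then obtain u r u' r' where 1: "u \<in> U" "r \<in> OF" "u * x = \<pi> powi k * r"
    "u' \<in> U" "r' \<in> OF" "u' * y = \<pi> powi k * r'" by (auto simp: vge_def)
  have "(u * u') * (x + y) = u' * (u * x) + u * (u' * y)" by (simp add: algebra_simps)
  also have "\<dots> = \<pi> powi k * (u' * r + u * r')" unfolding 1 by (simp add: algebra_simps)
  finally show ?thesis unfolding vge_def
    using U_mult[OF 1(1,4)] 1 int_add[OF int_mult int_mult, of u' r u r'] by blast
qed

lemma vge_zero: "vge k 0"
  unfolding vge_def using U_1 int_0 by (auto intro!: bexI[of _ 1] bexI[of _ 0])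

lemma vge_int: "x \<in> OF \<Longrightarrow> vge 0 x"
  unfolding vge_def using U_1 by (auto intro!: bexI[of _ 1])

lemma hasval_unit: "x \<in> U \<Longrightarrow> hasval 0 x"
  unfolding hasval_def using U_1 by (auto intro!: bexI[of _ 1])

lemma vge_minus: "vge k x \<Longrightarrow> vge k (- x)"
  using vge_mult[OF vge_int[OF int_minus[OF int_1]], of k x] by simp

lemma vge_diff: "vge k x \<Longrightarrow> vge k y \<Longrightarrow> vge k (x - y)"
  using vge_add[OF _ vge_minus, of k x y] by simp

lemma hasval_two: "hasval (int e) 2"
  using ram_two unfolding hasval_def by simp

lemma hasval_vge_iff: "hasval k x \<Longrightarrow> vge l x \<longleftrightarrow> l \<le> k"
proof
  assume hv: "hasval k x"
  then show "vge l x" if "l \<le> k" using that hasval_imp_vge vge_mono by blast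
  assume "vge l x"
  with hv obtain u w u' r' where 1: "u \<in> U" "w \<in> U" "u * x = \<pi> powi k * w"
    "u' \<in> U" "r' \<in> OF" "u' * x = \<pi> powi l * r'" by (auto simp: vge_def hasval_def)
  show "l \<le> k"
  proof (rule ccontr)
    assume "\<not> l \<le> k"
    define n where "n = nat (l - k)"
    have l: "l = k + int n" "n > 0" using \<open>\<not> l \<le> k\<close> by (auto simp: n_def)
    have "\<pi> powi k * (u' * w) = u' * (u * x)" unfolding 1(3) by simp
    also have "\<dots> = u * (u' * x)" by simp
    also have "\<dots> = \<pi> powi k * (\<pi> ^ n * (u * r'))"
      unfolding 1(6) l using pi_nonzero by (simp add: power_int_add)
    finally have "u' * w = \<pi> ^ n * (u * r')" using pi_nonzero by simp
    moreover have "\<pi> ^ n * (u * r') \<in> P"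
      using P_power[OF uniformizer] l 1 by (auto intro!: P_multr int_mult)
    ultimately show False using U_mult[OF 1(4,2)] by auto
  qed
qed

lemma hasval_unique: "hasval k x \<Longrightarrow> hasval l x \<Longrightarrow> k = l"
  using hasval_vge_iff hasval_imp_vge by (metis antisym)

lemma hasval_nonzero: "hasval k x \<Longrightarrow> x \<noteq> 0"
  using hasval_vge_iff[of k x "k + 1"] vge_zero by auto

lemma hasval_inverse: "hasval k x \<Longrightarrow> hasval (- k) (inverse x)"
proof -
  assume hv: "hasval k x"
  then obtain u w where 1: "u \<in> U" "w \<in> U" "u * x = \<pi> powi k * w" by (auto simp: hasval_def)
  have nz: "x \<noteq> 0" by (rule hasval_nonzero[OF hv])
  have "w * inverse x = \<pi> powi (- k) * (\<pi> powi k * w) * inverse x"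
    using pi_nonzero by (simp add: power_int_minus)
  also have "\<dots> = \<pi> powi (- k) * u" unfolding 1(3)[symmetric] using nz by simp
  finally show ?thesis unfolding hasval_def using 1 by blast
qed

lemma hasval_divide: "hasval k x \<Longrightarrow> hasval l y \<Longrightarrow> hasval (k - l) (x / y)"
  using hasval_mult[OF _ hasval_inverse, of k x l y] by (simp add: field_simps)

lemma hasval_ex_int: "x \<in> OF \<Longrightarrow> x \<noteq> 0 \<Longrightarrow> \<exists>k\<ge>0. hasval k x"
  using int_representation[of x] unfolding hasval_def
  by (metis of_nat_0_le_iff power_int_of_nat)

lemma hasval_ex:
  assumes "x \<in> F" "x \<noteq> 0"
  shows "\<exists>k. hasval k x"
proof -
  from fraction[OF assms(1)] obtain N :: int where N: "N \<noteq> 0" "of_int N * x \<in> OF" by blast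
  obtain k where "hasval k (of_int N * x)" using hasval_ex_int[OF N(2)] N assms by auto
  moreover obtain l where "hasval l (of_int N)" using hasval_ex_int[OF int_of_int] N by fastforce
  ultimately have "hasval (k - l) (of_int N * x / of_int N)" by (rule hasval_divide)
  then show ?thesis using N by auto
qed

lemma ord_int_hasval:
  assumes "x \<in> OF" "hasval k x"
  shows "ord_int F P x = ereal (of_int k)"
proof -
  obtain l u w where l: "u \<in> U" "w \<in> U" "u * x = \<pi> ^ l * w"
    using int_representation[OF assms(1) hasval_nonzero[OF assms(2)]] by blast
  then have "hasval (int l) x" by (auto simp: hasval_def)
  then have "k = int l" using assms(2) hasval_unique by blast
  with ord_int_eq[OF assms(1) l] show ?thesis by simp
qed

text \<open>Additivity of \<open>hasval\<close> makes the difference of valuations the same for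
  every way of writing \<open>x\<close> as a fraction.\<close>

lemma ord_at_hasval:
  assumes "x \<in> F" "hasval k x"
  shows "ord_at F P x = ereal (of_int k)"
  unfolding ord_at_def
proof (rule the_equality, goal_cases)
  case 1
  obtain N :: int where N: "N \<noteq> 0" "of_int N * x \<in> OF" using fraction[OF assms(1)] by blast
  obtain l where l: "hasval l (of_int N)" using hasval_ex_int[OF int_of_int] N by fastforce
  have "hasval (l + k) (of_int N * x)" by (rule hasval_mult[OF l assms(2)])
  then have "ord_int F P (of_int N * x) = ereal (of_int (l + k))" "ord_int F P (of_int N) = ereal (of_int l)"
    using ord_int_hasval N l int_of_int by blast+
  then show ?case using N int_of_int[of N]
    by (intro bexI[of _ "of_int N * x"] bexI[of _ "of_int N"]) auto
next
  case (2 v)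
  then obtain a b where ab: "a \<in> OF" "b \<in> OF" "b \<noteq> 0" "x = a / b" 
    "v = ord_int F P a - ord_int F P b" by auto
  obtain l where l: "hasval l b" using hasval_ex_int[OF ab(2,3)] by blast
  have "hasval (k + l) (x * b)" by (rule hasval_mult[OF assms(2) l])
  then have "hasval (k + l) a" using ab by simp
  then show ?case using ord_int_hasval ab l by simp
qed

lemma zero_in_F: "0 \<in> F" and one_in_F: "1 \<in> F"
  using int_0 int_1 by (auto simp: integers_of_def)

lemma ord_at_zero: "ord_at F P 0 = \<infinity>"
  unfolding ord_at_def
proof (rule the_equality, goal_cases)
  case 1
  have "ord_int F P 1 = 0" using ord_int_hasval[OF int_1 hasval_unit[OF U_1]] by (simp add: zero_ereal_def)
  then show ?case using ord_int_zero int_0 int_1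
    by (intro bexI[of _ 0] bexI[of _ 1]) auto
next
  case (2 v)
  then obtain b where b: "b \<in> OF" "b \<noteq> 0" 
    "v = ord_int F P 0 - ord_int F P b" by auto
  obtain l where l: "hasval l b" using hasval_ex_int[OF b(1,2)] by blast
  then show ?case using ord_int_hasval[OF b(1) l] b ord_int_zero by simp
qed

lemma ord_at_ge_iff:
  assumes "x \<in> F"
  shows "ord_at F P x \<ge> ereal (of_int k) \<longleftrightarrow> vge k x"
proof (cases "x = 0")
  case False
  then obtain l where "hasval l x" using hasval_ex[OF assms] by blast
  then show ?thesis using ord_at_hasval[OF assms, of l] hasval_vge_iff by simp
qed (auto simp: ord_at_zero vge_zero)

lemma hasval_iff: "x \<in> F \<Longrightarrow> hasval k x \<longleftrightarrow> vge k x \<and> \<not> vge (k + 1) x"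
proof
  assume "x \<in> F" and *: "vge k x \<and> \<not> vge (k + 1) x"
  then have "x \<noteq> 0" using vge_zero by auto
  then obtain l where l: "hasval l x" using hasval_ex[OF \<open>x \<in> F\<close>] by blast
  with * have "l = k" using hasval_vge_iff[OF l] by auto
  with l show "hasval k x" by simp
qed (use hasval_vge_iff in auto)

lemma vge_cancel: "hasval k x \<Longrightarrow> vge (k + l) (x * y) \<Longrightarrow> vge l y"
  using vge_mult[OF hasval_imp_vge[OF hasval_inverse], of k x "k + l" "x * y"] hasval_nonzero[of k x]
  by (simp flip: mult.assoc)

lemma hasval_add:
  assumes "hasval k x" "vge (k + 1) y" "x \<in> F" "y \<in> F"
  shows "hasval k (x + y)"
proof -
  have "\<not> vge (k + 1) (x + y)"
    using vge_diff[of "k + 1" "x + y" y] assms hasval_vge_iff[OF assms(1)] by auto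
  moreover have "vge k (x + y)"
    using assms hasval_imp_vge vge_mono by (intro vge_add) auto
  ultimately show ?thesis using hasval_iff assms add_closed by blast
qed

lemma hasval_square:
  assumes "hasval (2 * k) (x\<^sup>2)" "x \<in> F"
  shows "hasval k x"
proof -
  obtain l where l: "hasval l x" using hasval_ex[OF assms(2)] hasval_nonzero[OF assms(1)] by auto
  then have "hasval (l + l) (x\<^sup>2)" unfolding power2_eq_square by (rule hasval_mult[OF _ l])
  then have "l = k" using hasval_unique[OF assms(1)] by fastforce
  with l show ?thesis by simp
qed

text \<open>The bound is \<open>2 * k - 1\<close> and not \<open>2 * k\<close> because a nonzero
  square has even valuation.\<close>

lemma vge_square:
  assumes "vge (2 * k - 1) (x\<^sup>2)" "x \<in> F"
  shows "vge k x"
proof (cases "x = 0")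
  case False
  obtain l where l: "hasval l x" using hasval_ex[OF assms(2)] False by auto
  then have "hasval (l + l) (x\<^sup>2)" unfolding power2_eq_square by (rule hasval_mult[OF _ l])
  then have "2 * k - 1 \<le> l + l" using hasval_vge_iff assms by blast
  then show ?thesis using hasval_vge_iff[OF l] by simp
qed (simp add: vge_zero)

lemma P_iff_vge: "x \<in> OF \<Longrightarrow> x \<in> P \<longleftrightarrow> vge 1 x"
proof
  assume "x \<in> P"
  from locally_principal[OF this] show "vge 1 x" by (simp add: vge_def)
next
  assume "x \<in> OF" "vge 1 x"
  then show "x \<in> P" using hasval_vge_iff[OF hasval_unit, of x 1] by auto
qed

end

section \<open>The completion and the logarithm\<close>

context principal_prime
begin

abbreviation "CR \<equiv> cauchy_ring F P"
abbreviation "NS \<equiv> null_sequences F P"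
abbreviation "FP \<equiv> completion F P"

lemma cauchy_simps:
  "mult CR = (\<lambda>x y n. x n * y n)" "one CR = (\<lambda>_. 1)" "zero CR = (\<lambda>_. 0)" "add CR = (\<lambda>x y n. x n + y n)"
  by (simp_all add: cauchy_ring_def)

lemma minus_closed: "x \<in> F \<Longrightarrow> y \<in> F \<Longrightarrow> x - y \<in> F"
  using add_closed[OF _ uminus_closed, of x y] by simp

lemma power_closed: "x \<in> F \<Longrightarrow> x ^ n \<in> F"
  by (induction n) (auto intro: one_in_F mult_closed)

lemma sum_closed: "(\<And>n. n \<in> A \<Longrightarrow> f n \<in> F) \<Longrightarrow> sum f A \<in> F"
  by (induction A rule: infinite_finite_induct) (auto intro: zero_in_F add_closed)

text \<open>\<open>cauchy_ring\<close> quantifies over real bounds while \<open>vge\<close> takes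
  integers; rounding up connects the two.\<close>

lemma ord_ge_real_iff:
  "(\<forall>M::real. \<exists>N. \<forall>m\<ge>N. \<forall>n\<ge>N. f m n \<ge> ereal M) \<longleftrightarrow>
   (\<forall>k::int. \<exists>N::nat. \<forall>m\<ge>N. \<forall>n\<ge>N. f m n \<ge> ereal (of_int k))" (is "?L \<longleftrightarrow> ?R")
proof
  assume R: ?R
  show ?L
  proof
    fix M :: real
    from R obtain N where N: "\<forall>m\<ge>N. \<forall>n\<ge>N. f m n \<ge> ereal (of_int \<lceil>M\<rceil>)" by blast
    have "ereal M \<le> ereal (of_int \<lceil>M\<rceil>)" by simp
    with N show "\<exists>N. \<forall>m\<ge>N. \<forall>n\<ge>N. f m n \<ge> ereal M" by (meson order_trans)
  qed
qed blast

lemma cauchy_iff: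
  "x \<in> carrier CR \<longleftrightarrow> range x \<subseteq> F \<and> (\<forall>k. \<exists>N. \<forall>m\<ge>N. \<forall>n\<ge>N. vge k (x m - x n))"
proof -
  have "ord_at F P (x m - x n) \<ge> ereal (of_int k) \<longleftrightarrow> vge k (x m - x n)"
    if "range x \<subseteq> F" for m n k
    using that by (intro ord_at_ge_iff minus_closed) auto
  then show ?thesis
    unfolding cauchy_ring_def by (simp add: ord_ge_real_iff cong: conj_cong)
qed

lemma cauchyD:
  assumes "x \<in> carrier CR"
  shows "x n \<in> F" "\<exists>N. \<forall>m\<ge>N. \<forall>n\<ge>N. vge k (x m - x n)"
  using assms by (auto simp: cauchy_iff)

lemma tendsto_infinity_iff:
  assumes "range x \<subseteq> F"
  shows "(\<lambda>n. ord_at F P (x n)) \<longlonglongrightarrow> \<infinity> \<longleftrightarrow> (\<forall>k. \<exists>N. \<forall>n\<ge>N. vge k (x n))"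
proof -
  have iff: "ord_at F P (x n) \<ge> ereal (of_int k) \<longleftrightarrow> vge k (x n)" for n k
    using assms by (intro ord_at_ge_iff) auto
  show ?thesis
  proof
    assume L: "(\<lambda>n. ord_at F P (x n)) \<longlonglongrightarrow> \<infinity>"
    show "\<forall>k. \<exists>N. \<forall>n\<ge>N. vge k (x n)"
    proof
      fix k
      have "\<forall>\<^sub>F n in sequentially. ereal (of_int k) < ord_at F P (x n)"
        using L by (simp add: tendsto_PInfty)
      then show "\<exists>N. \<forall>n\<ge>N. vge k (x n)"
        unfolding eventually_sequentially iff[symmetric] by (meson less_imp_le)
    qed
  next
    assume R: "\<forall>k. \<exists>N. \<forall>n\<ge>N. vge k (x n)"
    show "(\<lambda>n. ord_at F P (x n)) \<longlonglongrightarrow> \<infinity>"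
      unfolding tendsto_PInfty eventually_sequentially
    proof
      fix r :: real
      from R obtain N where N: "\<And>n. n \<ge> N \<Longrightarrow> vge (\<lfloor>r\<rfloor> + 1) (x n)" by blast
      have "ereal r < ereal (of_int (\<lfloor>r\<rfloor> + 1))" by simp
      then show "\<exists>N. \<forall>n\<ge>N. ereal r < ord_at F P (x n)"
        using N unfolding iff[symmetric] by (meson less_le_trans)
    qed
  qed
qed

lemma null_iff: "x \<in> NS \<longleftrightarrow> range x \<subseteq> F \<and> (\<forall>k. \<exists>N. \<forall>n\<ge>N. vge k (x n))"
proof -
  have "x \<in> carrier CR" if "range x \<subseteq> F" "\<forall>k. \<exists>N. \<forall>n\<ge>N. vge k (x n)"
    unfolding cauchy_iff using that by (meson vge_diff)
  then show ?thesis
    unfolding null_sequences_def using cauchyD tendsto_infinity_iff by blast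
qed

lemma null_cauchy: "x \<in> NS \<Longrightarrow> x \<in> carrier CR"
  by (simp add: null_sequences_def)

lemma nullD:
  assumes "x \<in> NS"
  shows "x n \<in> F" "\<exists>N. \<forall>n\<ge>N. vge k (x n)"
  using assms by (auto simp: null_iff)

lemma const_cauchy: "a \<in> F \<Longrightarrow> (\<lambda>_. a) \<in> carrier CR"
  unfolding cauchy_iff using vge_zero by auto

lemma cauchy_add: "x \<in> carrier CR \<Longrightarrow> y \<in> carrier CR \<Longrightarrow> (\<lambda>n. x n + y n) \<in> carrier CR"
  unfolding cauchy_iff
proof (intro conjI allI; elim conjE)
  fix k assume *: "\<forall>k. \<exists>N. \<forall>m\<ge>N. \<forall>n\<ge>N. vge k (x m - x n)" "\<forall>k. \<exists>N. \<forall>m\<ge>N. \<forall>n\<ge>N. vge k (y m - y n)"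
  obtain N where N: "\<forall>m\<ge>N. \<forall>n\<ge>N. vge k (x m - x n)" using * by blast
  obtain N' where N': "\<forall>m\<ge>N'. \<forall>n\<ge>N'. vge k (y m - y n)" using * by blast
  have eq: "x m + y m - (x n + y n) = (x m - x n) + (y m - y n)" for m n by simp
  have "\<forall>m\<ge>max N N'. \<forall>n\<ge>max N N'. vge k (x m + y m - (x n + y n))"
    unfolding eq using N N' by (auto intro: vge_add)
  then show "\<exists>N. \<forall>m\<ge>N. \<forall>n\<ge>N. vge k (x m + y m - (x n + y n))" by blast
qed (auto simp: image_subset_iff intro: add_closed)

lemma vge_ex: "x \<in> F \<Longrightarrow> \<exists>k. vge k x"
  using hasval_ex hasval_imp_vge vge_zero by metis

lemma cauchy_bounded: "x \<in> carrier CR \<Longrightarrow> \<exists>b\<le>0. \<exists>N. \<forall>n\<ge>N. vge b (x n)"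
proof -
  assume x: "x \<in> carrier CR"
  obtain N where N: "\<forall>m\<ge>N. \<forall>n\<ge>N. vge 0 (x m - x n)" using cauchyD(2)[OF x] by blast
  obtain k where k: "vge k (x N)" using vge_ex cauchyD(1)[OF x] by blast
  have "vge (min 0 k) (x n)" if "n \<ge> N" for n
  proof -
    have "vge 0 (x n - x N)" using N that by blast
    then have "vge (min 0 k) (x n - x N)" by (rule vge_mono) simp
    from vge_add[OF this vge_mono[OF k, of "min 0 k"]] show ?thesis by simp
  qed
  then show ?thesis by (intro exI[of _ "min 0 k"]) auto
qed

lemma cauchy_mult: "x \<in> carrier CR \<Longrightarrow> y \<in> carrier CR \<Longrightarrow> (\<lambda>n. x n * y n) \<in> carrier CR"
proof -
  assume x: "x \<in> carrier CR" and y: "y \<in> carrier CR"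
  obtain b N where b: "b \<le> 0" "\<And>n. n \<ge> N \<Longrightarrow> vge b (x n)" using cauchy_bounded[OF x] by blast
  obtain c M where c: "c \<le> 0" "\<And>n. n \<ge> M \<Longrightarrow> vge c (y n)" using cauchy_bounded[OF y] by blast
  have "\<exists>N. \<forall>m\<ge>N. \<forall>n\<ge>N. vge k (x m * y m - x n * y n)" for k
  proof -
    obtain N' where N': "\<forall>m\<ge>N'. \<forall>n\<ge>N'. vge (k - c) (x m - x n)" using cauchyD(2)[OF x] by blast
    obtain M' where M': "\<forall>m\<ge>M'. \<forall>n\<ge>M'. vge (k - b) (y m - y n)" using cauchyD(2)[OF y] by blast
    define L where "L = max (max N M) (max N' M')"
    have "vge k (x m * y m - x n * y n)" if mn: "m \<ge> L" "n \<ge> L" for m n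
    proof -
      have "vge b (x m)" "vge (k - b) (y m - y n)" "vge c (y n)" "vge (k - c) (x m - x n)"
        using mn N' M' b c by (auto simp: L_def)
      then have "vge k (x m * (y m - y n) + y n * (x m - x n))"
        using vge_mult[of b "x m" "k - b" "y m - y n"] vge_mult[of c "y n" "k - c" "x m - x n"]
        by (intro vge_add) simp_all
      then show ?thesis by (simp add: algebra_simps)
    qed
    then show ?thesis by blast
  qed
  then show ?thesis using cauchyD(1)[OF x] cauchyD(1)[OF y] 
    by (auto simp: cauchy_iff intro: mult_closed)
qed

lemma cauchy_minus: "x \<in> carrier CR \<Longrightarrow> (\<lambda>n. - x n) \<in> carrier CR"
  using cauchy_mult[OF const_cauchy, of "-1" x] uminus_closed[OF one_in_F] by simp

sublocale CR: cring "cauchy_ring F P"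
proof (rule cringI)
  show "abelian_group CR"
    by (rule abelian_groupI)
       (auto simp: cauchy_simps cauchy_add const_cauchy zero_in_F add_ac
             intro!: bexI[OF _ cauchy_minus])
  show "comm_monoid CR"
    by (rule comm_monoidI)
       (auto simp: cauchy_simps cauchy_mult const_cauchy one_in_F mult_ac)
qed (auto simp: cauchy_simps algebra_simps)

lemma cauchy_a_inv: "x \<in> carrier CR \<Longrightarrow> \<ominus>\<^bsub>CR\<^esub> x = (\<lambda>n. - x n)"
  by (rule CR.minus_equality) (auto simp: cauchy_simps cauchy_minus)

lemma cauchy_a_minus: "x \<in> carrier CR \<Longrightarrow> y \<in> carrier CR \<Longrightarrow> x \<ominus>\<^bsub>CR\<^esub> y = (\<lambda>n. x n - y n)"
  by (simp add: a_minus_def cauchy_a_inv cauchy_simps)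

lemma null_add: "x \<in> NS \<Longrightarrow> y \<in> NS \<Longrightarrow> (\<lambda>n. x n + y n) \<in> NS"
  unfolding null_iff
proof (intro conjI allI; elim conjE)
  fix k assume *: "\<forall>k. \<exists>N. \<forall>n\<ge>N. vge k (x n)" "\<forall>k. \<exists>N. \<forall>n\<ge>N. vge k (y n)"
  obtain N where N: "\<forall>n\<ge>N. vge k (x n)" using * by blast
  obtain N' where N': "\<forall>n\<ge>N'. vge k (y n)" using * by blast
  have "\<forall>n\<ge>max N N'. vge k (x n + y n)" using N N' by (auto intro: vge_add)
  then show "\<exists>N. \<forall>n\<ge>N. vge k (x n + y n)" by blast
qed (auto simp: image_subset_iff intro: add_closed)

lemma null_mult: "x \<in> carrier CR \<Longrightarrow> y \<in> NS \<Longrightarrow> (\<lambda>n. x n * y n) \<in> NS"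
proof -
  assume x: "x \<in> carrier CR" and y: "y \<in> NS"
  obtain b N where b: "b \<le> 0" "\<And>n. n \<ge> N \<Longrightarrow> vge b (x n)" using cauchy_bounded[OF x] by blast
  have "\<exists>N. \<forall>n\<ge>N. vge k (x n * y n)" for k
  proof -
    obtain M where M: "\<And>n. n \<ge> M \<Longrightarrow> vge (k - b) (y n)" using nullD(2)[OF y] by blast
    have "vge k (x n * y n)" if "n \<ge> max N M" for n
      using vge_mult[OF b(2)[of n] M[of n]] that by simp
    then show ?thesis by blast
  qed
  then show ?thesis using cauchyD(1)[OF x] nullD(1)[OF y] 
    by (auto simp: null_iff intro: mult_closed)
qed

sublocale NS: ideal "null_sequences F P" "cauchy_ring F P"
proof (rule idealI)
  show "ring CR" by (rule CR.ring_axioms)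
  show "subgroup NS (add_monoid CR)"
  proof (rule group.subgroupI)
    show "group (add_monoid CR)" by (rule CR.a_group)
    have "(\<lambda>_. 0) \<in> NS" using vge_zero zero_in_F by (auto simp: null_iff)
    then show "NS \<noteq> {}" by blast
    show "inv\<^bsub>add_monoid CR\<^esub> a \<in> NS" if "a \<in> NS" for a
      using that null_mult[OF const_cauchy[of "-1"], of a] uminus_closed[OF one_in_F]
      unfolding a_inv_def[symmetric] by (simp add: cauchy_a_inv null_cauchy)
  qed (use null_add in \<open>auto simp: null_cauchy cauchy_simps\<close>)
  show "x \<otimes>\<^bsub>CR\<^esub> a \<in> NS" if "a \<in> NS" "x \<in> carrier CR" for a x
    using null_mult[OF that(2,1)] by (simp add: cauchy_simps)
  show "a \<otimes>\<^bsub>CR\<^esub> x \<in> NS" if "a \<in> NS" "x \<in> carrier CR" for a x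
    using null_mult[OF that(2,1)] by (simp add: cauchy_simps mult.commute)
qed

definition cls :: "(nat \<Rightarrow> complex) \<Rightarrow> (nat \<Rightarrow> complex) set" where
  "cls x = NS +>\<^bsub>CR\<^esub> x"

sublocale cls: ring_hom_cring "cauchy_ring F P" "completion F P" cls
  using NS.rcos_ring_hom_cring[OF CR.is_cring] unfolding completion_def cls_def[abs_def] .

lemma completion_carrier: "z \<in> carrier FP \<longleftrightarrow> (\<exists>x\<in>carrier CR. z = cls x)"
  by (auto simp: completion_def FactRing_def A_RCOSETS_def' a_r_coset_def' cls_def)

lemma cls_eq_iff:
  assumes "x \<in> carrier CR" "y \<in> carrier CR"
  shows "cls x = cls y \<longleftrightarrow> (\<lambda>n. x n - y n) \<in> NS"
  using CR.quotient_eq_iff_same_a_r_cos[OF NS.ideal_axioms assms] assms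
  by (simp add: cls_def cauchy_a_minus)

lemma cls_diff:
  "x \<in> carrier CR \<Longrightarrow> y \<in> carrier CR \<Longrightarrow> cls x \<ominus>\<^bsub>FP\<^esub> cls y = cls (\<lambda>n. x n - y n)"
  using cls.hom_add[of x "\<ominus>\<^bsub>CR\<^esub> y"] cls.hom_a_inv[of y]
  by (simp add: a_minus_def cauchy_a_inv cauchy_simps cauchy_minus)

lemma to_completion_cls: "to_completion F P a = cls (\<lambda>_. a)"
  by (simp add: to_completion_def cls_def)

lemma mem_cls: "y \<in> cls x \<longleftrightarrow> (\<exists>h\<in>NS. y = (\<lambda>n. h n + x n))"
  by (auto simp: cls_def a_r_coset_def' cauchy_simps)

text \<open>Some \<open>k\<close> is missed by infinitely many terms. Once all differences have
  valuation at least \<open>k\<close>, one such term fixes the valuation of all later ones, by the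
  ultrametric inequality.\<close>

lemma eventually_hasval:
  assumes "x \<in> carrier CR" "x \<notin> NS"
  shows "\<exists>k. \<exists>N. \<forall>n\<ge>N. hasval k (x n)"
proof -
  obtain k where k: "\<And>N. \<exists>n\<ge>N. \<not> vge k (x n)" using assms by (auto simp: null_iff cauchy_iff)
  obtain N where N: "\<forall>m\<ge>N. \<forall>n\<ge>N. vge k (x m - x n)" using cauchyD(2)[OF assms(1)] by blast
  obtain n0 where n0: "n0 \<ge> N" "\<not> vge k (x n0)" using k by blast
  obtain l where l: "hasval l (x n0)" using hasval_ex[of "x n0"] cauchyD(1)[OF assms(1)] n0 vge_zero by metis
  then have "l < k" using hasval_vge_iff[OF l] n0 by auto
  have "hasval l (x n)" if "n \<ge> N" for n
  proof -
    have "vge k (x n - x n0)" using N n0 that by blast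
    then have "vge (l + 1) (x n - x n0)" using \<open>l < k\<close> by (auto elim: vge_mono)
    then have "hasval l (x n0 + (x n - x n0))"
      using l cauchyD(1)[OF assms(1)] by (intro hasval_add minus_closed)
    then show ?thesis by simp
  qed
  then show ?thesis by blast
qed

lemma ord_completion_eqI:
  assumes "\<And>y. y \<in> cls x \<Longrightarrow> (\<lambda>n. ord_at F P (y n)) \<longlonglongrightarrow> v"
  shows "ord_completion F P (cls x) = v"
  unfolding ord_completion_def
proof (rule the_equality)
  show "\<forall>y\<in>cls x. (\<lambda>n. ord_at F P (y n)) \<longlonglongrightarrow> v" using assms by blast
  fix w assume *: "\<forall>y\<in>cls x. (\<lambda>n. ord_at F P (y n)) \<longlonglongrightarrow> w"
  \<comment> \<open>A coset has a representative, so the common limit along all of them is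
    unique.\<close>
  have "x \<in> cls x" using vge_zero zero_in_F unfolding mem_cls
    by (intro bexI[of _ "\<lambda>_. 0"]) (auto simp: null_iff)
  with * assms show "w = v" by (auto intro: LIMSEQ_unique)
qed

lemma ord_completion_null: "x \<in> NS \<Longrightarrow> ord_completion F P (cls x) = \<infinity>"
proof (rule ord_completion_eqI)
  fix y assume "x \<in> NS" "y \<in> cls x"
  then obtain h where h: "h \<in> NS" "y = (\<lambda>n. h n + x n)" unfolding mem_cls by blast
  have "y \<in> NS" unfolding h(2) by (rule null_add[OF h(1) \<open>x \<in> NS\<close>])
  then show "(\<lambda>n. ord_at F P (y n)) \<longlonglongrightarrow> \<infinity>" unfolding null_sequences_def by blast
qed

lemma ord_completion_hasval:
  assumes "x \<in> carrier CR" "\<forall>n\<ge>N. hasval k (x n)"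
  shows "ord_completion F P (cls x) = ereal (of_int k)"
proof (rule ord_completion_eqI)
  fix y assume "y \<in> cls x"
  then obtain h where h: "h \<in> NS" "y = (\<lambda>n. h n + x n)" by (auto simp: mem_cls)
  obtain M where M: "\<forall>n\<ge>M. vge (k + 1) (h n)" using nullD(2)[OF h(1)] by blast
  have "ord_at F P (y n) = ereal (of_int k)" if "n \<ge> max N M" for n
  proof (rule ord_at_hasval)
    show "y n \<in> F" using h nullD(1)[OF h(1)] cauchyD(1)[OF assms(1)] by (auto intro: add_closed)
    have "hasval k (x n + h n)"
      using that assms M nullD(1)[OF h(1)] cauchyD(1)[OF assms(1)] by (intro hasval_add) auto
    then show "hasval k (y n)" by (simp add: h add.commute)
  qed
  then show "(\<lambda>n. ord_at F P (y n)) \<longlonglongrightarrow> ereal (of_int k)"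
    unfolding eventually_sequentially by (intro tendsto_eventually) (auto simp only: eventually_sequentially)
qed

lemma ord_completion_ge_iff:
  assumes "x \<in> carrier CR"
  shows "ord_completion F P (cls x) \<ge> ereal (of_int k) \<longleftrightarrow> (\<exists>N. \<forall>n\<ge>N. vge k (x n))"
proof (cases "x \<in> NS")
  case True
  then show ?thesis using ord_completion_null nullD(2) by auto
next
  case False
  obtain l N where l: "\<And>n. n \<ge> N \<Longrightarrow> hasval l (x n)" using eventually_hasval[OF assms False] by blast
  have "(\<exists>N. \<forall>n\<ge>N. vge k (x n)) \<longleftrightarrow> k \<le> l"
  proof
    assume "\<exists>N. \<forall>n\<ge>N. vge k (x n)"
    then obtain M where "\<forall>n\<ge>M. vge k (x n)" by blast
    then have "vge k (x (max N M))" by simp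
    then show "k \<le> l" using hasval_vge_iff[OF l, of "max N M"] by simp
  qed (use l hasval_vge_iff in blast)
  then show ?thesis using ord_completion_hasval[OF assms, of N l] l by simp
qed

text \<open>Limits are needed only for sequences of images of elements of \<open>F\<close>, such as
  the partial sums of the logarithm; a single \<open>z n\<close> close to both limits then suffices
  for each \<open>k\<close>.\<close>

lemma limit_unique:
  assumes z: "\<And>n. z n \<in> F" and "converges_to F P (\<lambda>n. to_completion F P (z n)) L"
    and "converges_to F P (\<lambda>n. to_completion F P (z n)) L'"
  shows "L = L'"
proof -
  obtain x y where xy: "x \<in> carrier CR" "y \<in> carrier CR" "L = cls x" "L' = cls y"
    using assms by (auto simp: converges_to_def completion_carrier)
  have lim: "\<exists>n. \<exists>N. \<forall>m\<ge>N. vge k (z n - x m) \<and> vge k (z n - y m)" for k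
  proof -
    have *: "\<forall>\<^sub>F n in sequentially. \<exists>N. \<forall>m\<ge>N. vge k (z n - x m)"
      if "x \<in> carrier CR" "converges_to F P (\<lambda>n. to_completion F P (z n)) (cls x)" for x
    proof -
      have "\<forall>\<^sub>F n in sequentially. ereal (of_int k) < ord_completion F P (cls (\<lambda>m. z n - x m))"
        using that(2) z cls_diff[OF const_cauchy that(1)]
        by (simp add: converges_to_def tendsto_PInfty to_completion_cls)
      then show ?thesis
      proof (rule eventually_mono)
        fix n assume "ereal (of_int k) < ord_completion F P (cls (\<lambda>m. z n - x m))"
        moreover have "(\<lambda>m. z n - x m) \<in> carrier CR"
          using CR.minus_closed[OF const_cauchy[OF z] that(1)]
          by (simp add: cauchy_a_minus const_cauchy z that(1))
        ultimately show "\<exists>N. \<forall>m\<ge>N. vge k (z n - x m)"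
          using ord_completion_ge_iff[of "\<lambda>m. z n - x m" k] less_imp_le by blast
      qed
    qed
    have "\<forall>\<^sub>F n in sequentially. (\<exists>N. \<forall>m\<ge>N. vge k (z n - x m)) \<and> (\<exists>N. \<forall>m\<ge>N. vge k (z n - y m))"
      using assms xy by (intro eventually_conj *) auto
    then obtain n N M where "\<forall>m\<ge>N. vge k (z n - x m)" "\<forall>m\<ge>M. vge k (z n - y m)"
      by (auto simp: eventually_sequentially)
    then show ?thesis by (intro exI[of _ n] exI[of _ "max N M"]) auto
  qed
  have "(\<lambda>m. x m - y m) \<in> NS"
    unfolding null_iff
  proof (intro conjI allI)
    show "range (\<lambda>m. x m - y m) \<subseteq> F" using xy cauchyD(1) minus_closed by auto
    fix k
    obtain n N where n: "\<forall>m\<ge>N. vge k (z n - x m) \<and> vge k (z n - y m)" using lim by blast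
    have "vge k (x m - y m)" if "m \<ge> N" for m
    proof -
      have "vge k ((z n - y m) - (z n - x m))"
        using n that vge_diff[of k "z n - y m" "z n - x m"] by blast
      then show ?thesis by simp
    qed
    then show "\<exists>N. \<forall>m\<ge>N. vge k (x m - y m)" by blast
  qed
  then show ?thesis using cls_eq_iff xy by simp
qed

lemma converges_to_cls:
  assumes "x \<in> carrier CR"
  shows "converges_to F P (\<lambda>n. to_completion F P (x n)) (cls x)"
proof -
  have xF: "x n \<in> F" for n by (rule cauchyD(1)[OF assms])
  have car: "(\<lambda>m. x n - x m) \<in> carrier CR" for n
    using CR.minus_closed[OF const_cauchy[OF xF] assms]
    by (simp add: cauchy_a_minus const_cauchy xF assms)
  have "(\<lambda>n. ord_completion F P (cls (\<lambda>m. x n - x m))) \<longlonglongrightarrow> \<infinity>"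
    unfolding tendsto_PInfty eventually_sequentially
  proof
    fix r :: real
    obtain N where N: "\<forall>m\<ge>N. \<forall>n\<ge>N. vge (\<lfloor>r\<rfloor> + 1) (x m - x n)" using cauchyD(2)[OF assms] by blast
    have "ereal r < ord_completion F P (cls (\<lambda>m. x n - x m))" if "n \<ge> N" for n
    proof -
      have "ereal r < ereal (of_int (\<lfloor>r\<rfloor> + 1))" by simp
      also have "\<dots> \<le> ord_completion F P (cls (\<lambda>m. x n - x m))"
        using ord_completion_ge_iff[OF car, of "\<lfloor>r\<rfloor> + 1" n] N that by auto
      finally show ?thesis .
    qed
    then show "\<exists>N. \<forall>n\<ge>N. ereal r < ord_completion F P (cls (\<lambda>m. x n - x m))" by blast
  qed
  then show ?thesis using assms
    by (simp add: converges_to_def to_completion_cls cls_diff const_cauchy xF)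
qed

section \<open>Partial sums of the logarithm series in \<open>F\<close>\<close>

definition log_partial :: "complex \<Rightarrow> nat \<Rightarrow> complex" where
  "log_partial z N = (\<Sum>n\<in>{1..N}. (-1) ^ (n + 1) / of_nat n * z ^ n)"

lemma of_nat_in_F: "of_nat n \<in> F"
  using int_of_nat integers_of_subset by blast

lemma log_coeff_in_F: "(-1) ^ (n + 1) / of_nat n \<in> F"
  unfolding divide_inverse
  by (intro mult_closed inverse_closed of_nat_in_F power_closed uminus_closed one_in_F)

lemma log_term_in_F: "z \<in> F \<Longrightarrow> (-1) ^ (n + 1) / of_nat n * z ^ n \<in> F"
  by (intro mult_closed log_coeff_in_F power_closed)

lemma log_series_eq:
  assumes "z \<in> F"
  shows "log_series F P (cls (\<lambda>_. z)) N = to_completion F P (log_partial z N)"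
proof (induction N)
  case 0
  then show ?case using cls.hom_zero
    by (simp add: log_series_def log_partial_def to_completion_cls cauchy_simps)
next
  case (Suc N)
  have pow: "cls (\<lambda>_. z) [^]\<^bsub>FP\<^esub> n = cls (\<lambda>_. z ^ n)" for n :: nat
  proof (induction n)
    case 0
    show ?case using cls.hom_one by (simp add: cauchy_simps)
  next
    case (Suc n)
    then show ?case using cls.hom_mult[of "\<lambda>_. z ^ n" "\<lambda>_. z"] assms
      by (simp add: const_cauchy power_closed cauchy_simps mult.commute)
  qed
  have trm: "to_completion F P ((-1) ^ (n + 1) / of_nat n) \<otimes>\<^bsub>FP\<^esub> (cls (\<lambda>_. z) [^]\<^bsub>FP\<^esub> n) =
        cls (\<lambda>_. (-1) ^ (n + 1) / of_nat n * z ^ n)" for n :: nat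
    using cls.hom_mult[of "\<lambda>_. (-1) ^ (n + 1) / of_nat n" "\<lambda>_. z ^ n"] assms
    unfolding pow to_completion_cls
    by (simp only: const_cauchy power_closed cauchy_simps log_coeff_in_F)
  have tF: "(\<lambda>_. (-1) ^ (n + 1) / of_nat n * z ^ n) \<in> carrier CR" for n :: nat
    by (rule const_cauchy[OF log_term_in_F[OF assms]])
  have pF: "log_partial z N \<in> F"
    unfolding log_partial_def by (rule sum_closed) (rule log_term_in_F[OF assms])
  have set_eq: "{1..Suc N} = insert (Suc N) {1..N}" by auto
  define T where "T n = cls (\<lambda>_. (-1) ^ (n + 1) / of_nat n * z ^ n)" for n :: nat
  have T: "T n \<in> carrier FP" for n unfolding T_def by (rule cls.hom_closed[OF tF])
  have "log_series F P (cls (\<lambda>_. z)) (Suc N) =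
      cls (\<lambda>_. (-1) ^ (Suc N + 1) / of_nat (Suc N) * z ^ Suc N) \<oplus>\<^bsub>FP\<^esub> log_series F P (cls (\<lambda>_. z)) N"
    unfolding log_series_def trm T_def[symmetric] set_eq
    by (rule cls.S.finsum_insert) (use T in auto)
  also have "\<dots> = cls (\<lambda>_. (-1) ^ (Suc N + 1) / of_nat (Suc N) * z ^ Suc N + log_partial z N)"
    unfolding Suc to_completion_cls
    using cls.hom_add[OF tF[of "Suc N"], of "\<lambda>_. log_partial z N"] const_cauchy[OF pF]
    by (simp only: cauchy_simps)
  also have "(-1) ^ (Suc N + 1) / of_nat (Suc N) * z ^ Suc N + log_partial z N = log_partial z (Suc N)"
    using set_eq by (simp add: log_partial_def)
  finally show ?case by (simp add: to_completion_cls)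
qed

lemma hasval_of_nat: "n > 0 \<Longrightarrow> hasval (int e * int (multiplicity 2 n)) (of_nat n)"
proof -
  assume n: "n > 0"
  define j where "j = multiplicity 2 n"
  obtain M where M: "n = 2 ^ j * M" "odd M"
    using multiplicity_decompose'[of n 2] n unfolding j_def by auto
  have pow: "hasval (int e * int j) (2 ^ j)" for j :: nat
  proof (induction j)
    case (Suc j)
    then show ?case using hasval_mult[OF hasval_two Suc] by (simp add: algebra_simps)
  qed (use hasval_unit[OF U_1] in simp)
  have "hasval 0 (of_nat M)" using M P_even_nat int_of_nat by (intro hasval_unit) auto
  from hasval_mult[OF pow[of j] this] show ?thesis unfolding j_def[symmetric] by (subst M(1)) simp
qed

lemma hasval_neg_one_power: "hasval 0 ((-1) ^ n)"
  using hasval_unit[OF U_power, of "-1" n] P_minus[of "-1"] one_notin_P int_minus[OF int_1] by auto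

lemma vge_power: "vge 1 z \<Longrightarrow> vge (int n) (z ^ n)"
proof (induction n)
  case (Suc n)
  then show ?case using vge_mult[of 1 z "int n" "z ^ n"] by simp
qed (simp add: vge_int int_1)

lemma vge_log_term:
  assumes "vge 1 z" "n > 0"
  shows "vge (int n - int e * int (multiplicity 2 n)) ((-1) ^ (n + 1) / of_nat n * z ^ n)"
  using vge_mult[OF hasval_imp_vge[OF hasval_divide[OF hasval_neg_one_power hasval_of_nat[OF assms(2)]]]
      vge_power[OF assms(1)], of n "n + 1"] by (simp del: power_Suc)

lemma vge_sum: "(\<And>n. n \<in> A \<Longrightarrow> vge k (f n)) \<Longrightarrow> vge k (sum f A)"
  by (induction A rule: infinite_finite_induct) (auto intro: vge_add vge_zero)

text \<open>The \<open>n\<close>-th term has valuation at least \<open>n - e * log 2 n\<close>,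
  which tends to infinity, and a block of terms is no worse than its worst term.\<close>

lemma log_partial_cauchy:
  assumes "z \<in> F" "vge 1 z"
  shows "log_partial z \<in> carrier CR"
proof -
  have "\<exists>N. \<forall>m\<ge>N. \<forall>n\<ge>N. vge k (log_partial z m - log_partial z n)" for k
  proof -
    have "filterlim (\<lambda>n. real n - real e * log 2 (real n)) at_top sequentially" by real_asymp
    then have "\<forall>\<^sub>F n in sequentially. real n - real e * log 2 (real n) \<ge> of_int k"
      by (simp add: filterlim_at_top)
    then obtain N where N: "\<And>n. n \<ge> N \<Longrightarrow> real n - real e * log 2 (real n) \<ge> of_int k"
      by (auto simp: eventually_sequentially)
    have trm: "vge k ((-1) ^ (n + 1) / of_nat n * z ^ n)" if n: "n \<ge> max N 1" for n
    proof (rule vge_mono[OF vge_log_term[OF assms(2)]])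
      show "n > 0" using n by simp
      have "2 ^ multiplicity 2 n \<le> n" using n by (intro dvd_imp_le multiplicity_dvd) auto
      then have "2 ^ multiplicity 2 n \<le> real n"
        by (metis of_nat_le_iff of_nat_numeral of_nat_power)
      then have "real (multiplicity 2 n) \<le> log 2 (real n)" using n
        by (subst le_log_iff) (auto simp: powr_realpow)
      then have "real e * real (multiplicity 2 n) \<le> real e * log 2 (real n)"
        by (intro mult_left_mono) auto
      with N[of n] n have "real_of_int k \<le> real n - real e * real (multiplicity 2 n)" by linarith
      also have "\<dots> = real_of_int (int n - int e * int (multiplicity 2 n))" by simp
      finally show "k \<le> int n - int e * int (multiplicity 2 n)" by linarith
    qed
    have le: "vge k (log_partial z m - log_partial z n)" if "n \<ge> max N 1" "m \<ge> n" for m n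
    proof -
      have "{1..m} = {1..n} \<union> {n<..m}" using that by auto
      moreover have "{1..n} \<inter> {n<..m} = {}" by auto
      ultimately have "log_partial z m =
          log_partial z n + (\<Sum>n\<in>{n<..m}. (-1) ^ (n + 1) / of_nat n * z ^ n)"
        unfolding log_partial_def by (simp add: sum.union_disjoint)
      then have "log_partial z m - log_partial z n = (\<Sum>n\<in>{n<..m}. (-1) ^ (n + 1) / of_nat n * z ^ n)"
        by simp
      then show ?thesis by (simp only:) (rule vge_sum, rule trm, use that in simp)
    qed
    have "vge k (log_partial z m - log_partial z n)" if "n \<ge> max N 1" "m \<ge> max N 1" for m n
    proof (cases "m \<ge> n")
      case False
      then have "vge k (- (log_partial z n - log_partial z m))" using that by (intro vge_minus le) auto
      then show ?thesis by simp
    qed (use le that in auto)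
    then show ?thesis by blast
  qed
  then show ?thesis using sum_closed[OF log_term_in_F[OF assms(1)]]
    by (auto simp: cauchy_iff log_partial_def)
qed

text \<open>This is the passage back to \<open>F\<close>: the logarithm is the class of an explicit
  Cauchy sequence, whose valuation can be estimated term by term.\<close>

lemma log_completion_eq:
  assumes "\<eta> \<in> F" "vge 1 (\<eta> - 1)"
  shows "log_completion F P (to_completion F P \<eta>) = cls (log_partial (\<eta> - 1))"
proof -
  have zF: "\<eta> - 1 \<in> F" using assms one_in_F by (intro minus_closed)
  have "to_completion F P \<eta> \<ominus>\<^bsub>FP\<^esub> \<one>\<^bsub>FP\<^esub> = cls (\<lambda>_. \<eta> - 1)"
    using cls.hom_one cls_diff[of "\<lambda>_. \<eta>" "\<lambda>_. 1"] assms(1) one_in_F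
    by (simp add: to_completion_cls const_cauchy cauchy_simps)
  then have eq: "log_series F P (to_completion F P \<eta> \<ominus>\<^bsub>FP\<^esub> \<one>\<^bsub>FP\<^esub>) =
      (\<lambda>N. to_completion F P (log_partial (\<eta> - 1) N))"
    using log_series_eq[OF zF] by auto
  have car: "log_partial (\<eta> - 1) \<in> carrier CR" by (rule log_partial_cauchy[OF zF assms(2)])
  show ?thesis
    unfolding log_completion_def eq
  proof (rule the_equality)
    show *: "converges_to F P (\<lambda>N. to_completion F P (log_partial (\<eta> - 1) N)) (cls (log_partial (\<eta> - 1)))"
      by (rule converges_to_cls[OF car])
    fix L assume "converges_to F P (\<lambda>N. to_completion F P (log_partial (\<eta> - 1) N)) L"
    then show "L = cls (log_partial (\<eta> - 1))" using limit_unique[OF cauchyD(1)[OF car] _ *] by blast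
  qed
qed

end

section \<open>Coprime factors of squares in the imaginary quadratic field\<close>

definition field_closed :: "complex set \<Rightarrow> bool" where
  "field_closed E \<longleftrightarrow> 1 \<in> E \<and> (\<forall>x\<in>E. \<forall>y\<in>E. x + y \<in> E \<and> x * y \<in> E) \<and> (\<forall>x\<in>E. - x \<in> E \<and> inverse x \<in> E)"

lemma field_closedD:
  assumes "field_closed E"
  shows "1 \<in> E" "0 \<in> E" "x \<in> E \<Longrightarrow> y \<in> E \<Longrightarrow> x + y \<in> E" "x \<in> E \<Longrightarrow> y \<in> E \<Longrightarrow> x * y \<in> E"
    "x \<in> E \<Longrightarrow> - x \<in> E" "x \<in> E \<Longrightarrow> inverse x \<in> E" "x \<in> E \<Longrightarrow> y \<in> E \<Longrightarrow> x - y \<in> E"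
    "x \<in> E \<Longrightarrow> y \<in> E \<Longrightarrow> x / y \<in> E" "of_nat n \<in> E" "of_int k \<in> E" "x \<in> E \<Longrightarrow> x ^ n \<in> E"
    "numeral m \<in> E"
proof -
  have *: "1 \<in> E" "x \<in> E \<Longrightarrow> y \<in> E \<Longrightarrow> x + y \<in> E" "x \<in> E \<Longrightarrow> y \<in> E \<Longrightarrow> x * y \<in> E"
    "x \<in> E \<Longrightarrow> - x \<in> E" "x \<in> E \<Longrightarrow> inverse x \<in> E" for x y
    using assms by (auto simp: field_closed_def)
  have 0: "0 \<in> E" using *(2)[OF *(1) *(4)[OF *(1)]] by simp
  have n: "of_nat n \<in> E" for n by (induction n) (auto intro: 0 *)
  have k: "of_int k \<in> E" for k by (cases k rule: int_cases2) (auto intro: n *(4))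
  have e: "x ^ n \<in> E" if "x \<in> E" for x n using that by (induction n) (auto intro: *)
  show "1 \<in> E" by (fact *)
  show "0 \<in> E" by (fact 0)
  show "x \<in> E \<Longrightarrow> y \<in> E \<Longrightarrow> x + y \<in> E" by (fact *)
  show "x \<in> E \<Longrightarrow> y \<in> E \<Longrightarrow> x * y \<in> E" by (fact *)
  show "x \<in> E \<Longrightarrow> - x \<in> E" by (fact *)
  show "x \<in> E \<Longrightarrow> inverse x \<in> E" by (fact *)
  show "of_nat n \<in> E" by (fact n)
  show "of_int k \<in> E" by (fact k)
  show "x \<in> E \<Longrightarrow> x ^ n \<in> E" by (fact e)
  show "x \<in> E \<Longrightarrow> y \<in> E \<Longrightarrow> x - y \<in> E" using *(2)[OF _ *(4), of x y] by simp
  show "x \<in> E \<Longrightarrow> y \<in> E \<Longrightarrow> x / y \<in> E" using *(3)[OF _ *(5), of x y] by (simp add: divide_inverse)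
  show "numeral m \<in> E" using n[of "numeral m"] by simp
qed

lemma field_closed_Rats: "field_closed \<rat>"
  by (auto simp: field_closed_def)

lemma complex_ring_ops:
  "\<one>\<^bsub>complex_ring\<^esub> = 1" "\<zero>\<^bsub>complex_ring\<^esub> = 0" "x \<oplus>\<^bsub>complex_ring\<^esub> y = x + y" "x \<otimes>\<^bsub>complex_ring\<^esub> y = x * y"
  "\<ominus>\<^bsub>complex_ring\<^esub> x = - x" "x \<noteq> 0 \<Longrightarrow> inv\<^bsub>complex_ring\<^esub> x = inverse x"
proof -
  interpret C: field complex_ring by (rule field_from_type_algebra)
  show "\<one>\<^bsub>complex_ring\<^esub> = 1" "\<zero>\<^bsub>complex_ring\<^esub> = 0" "x \<oplus>\<^bsub>complex_ring\<^esub> y = x + y" "x \<otimes>\<^bsub>complex_ring\<^esub> y = x * y"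
    by (simp_all add: ring_of_type_algebra_def)
  show "\<ominus>\<^bsub>complex_ring\<^esub> x = - x"
    by (rule C.minus_equality) (simp_all add: ring_of_type_algebra_def)
  show "x \<noteq> 0 \<Longrightarrow> inv\<^bsub>complex_ring\<^esub> x = inverse x"
    by (rule C.comm_inv_char) (simp_all add: ring_of_type_algebra_def)
qed

lemma field_closed_adjoin: "field_closed (adjoin E z)"
proof -
  have "inverse x \<in> generate_field complex_ring (insert z E)"
    if "x \<in> generate_field complex_ring (insert z E)" for x
    using generate_field.m_inv[OF that] that
    by (cases "x = 0") (simp_all add: complex_ring_ops)
  then show ?thesis
    unfolding field_closed_def adjoin_def
    using generate_field.one[of complex_ring] generate_field.eng_add[of _ complex_ring]
      generate_field.eng_mult[of _ complex_ring] generate_field.a_inv[of _ complex_ring]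
    by (simp add: complex_ring_ops)
qed

lemma adjoin_quadratic:
  assumes "field_closed E" "z\<^sup>2 \<in> E"
  shows "adjoin E z = {x + y * z |x y. x \<in> E \<and> y \<in> E}"
proof
  note E = field_closedD[OF assms(1)]
  have inE: "x \<in> adjoin E z" if "x \<in> insert z E" for x
    unfolding adjoin_def by (rule generate_field.incl[OF that])
  show "{x + y * z |x y. x \<in> E \<and> y \<in> E} \<subseteq> adjoin E z"
    using field_closedD(3,4)[OF field_closed_adjoin] inE by auto
  show "adjoin E z \<subseteq> {x + y * z |x y. x \<in> E \<and> y \<in> E}"
  proof
    fix h assume "h \<in> adjoin E z"
    then have "h \<in> generate_field complex_ring (insert z E)" by (simp add: adjoin_def)
    then show "h \<in> {x + y * z |x y. x \<in> E \<and> y \<in> E}"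
    proof induction
      case one
      have "1 = 1 + 0 * z" by simp
      then show ?case unfolding complex_ring_ops using E(1,2) by blast
    next
      case (incl h)
      have "z = 0 + 1 * z" "h = h + 0 * z" by simp_all
      then show ?case using E(1,2) incl by blast
    next
      case (a_inv h)
      then obtain x y where xy: "h = x + y * z" "x \<in> E" "y \<in> E" by auto
      have "- h = (-x) + (-y) * z" by (simp add: xy)
      then show ?case using xy E(5) unfolding complex_ring_ops by blast
    next
      case (m_inv h)
      then obtain x y where xy: "h = x + y * z" "x \<in> E" "y \<in> E" by auto
      have h: "h \<noteq> 0" using m_inv by (simp add: complex_ring_ops)
      have "\<exists>x y. inverse h = x + y * z \<and> x \<in> E \<and> y \<in> E"
      \<comment> \<open>\<open>z\<close> may lie in \<open>E\<close>, and then the conjugate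
        \<open>x - y * z\<close> can vanish although \<open>h\<close> does not.\<close>
      proof (cases "x - y * z = 0")
        case True
        then have "h = 2 * x" using xy by simp
        then have "inverse h \<in> E" using E xy by simp
        then show ?thesis using E(2) by (intro exI[of _ "inverse h"] exI[of _ 0]) auto
      next
        case False
        define n where "n = x\<^sup>2 - y\<^sup>2 * z\<^sup>2"
        have n: "n = h * (x - y * z)" by (simp add: n_def xy power2_eq_square algebra_simps)
        have "n \<noteq> 0" unfolding n using h False by simp
        have "n \<in> E" unfolding n_def by (intro E assms(2) xy)
        have "inverse h = (x - y * z) / n" unfolding n using h False by (simp add: inverse_eq_divide)
        also have "\<dots> = x / n + (- y / n) * z" using \<open>n \<noteq> 0\<close> by (simp add: field_simps)
        finally show ?thesis using E(8)[OF xy(2) \<open>n \<in> E\<close>] E(8)[OF E(5)[OF xy(3)] \<open>n \<in> E\<close>] by blast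
      qed
      then show ?case by (simp add: complex_ring_ops h)
    next
      case (eng_add h1 h2)
      then obtain x y x' y' where xy: "h1 = x + y * z" "x \<in> E" "y \<in> E" "h2 = x' + y' * z" "x' \<in> E" "y' \<in> E"
        by auto
      have "h1 + h2 = (x + x') + (y + y') * z" by (simp add: xy algebra_simps)
      then show ?case using xy E(3) unfolding complex_ring_ops by blast
    next
      case (eng_mult h1 h2)
      then obtain x y x' y' where xy: "h1 = x + y * z" "x \<in> E" "y \<in> E" "h2 = x' + y' * z" "x' \<in> E" "y' \<in> E"
        by auto
      have "h1 * h2 = (x * x' + y * y' * z\<^sup>2) + (x * y' + y * x') * z"
        by (simp add: xy algebra_simps power2_eq_square)
      moreover have "x * x' + y * y' * z\<^sup>2 \<in> E" "x * y' + y * x' \<in> E" by (intro E xy assms(2))+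
      ultimately show ?case unfolding complex_ring_ops by blast
    qed
  qed
qed

section \<open>Squares and primes in the integers\<close>

lemma prime_not_square_int: "Factorial_Ring.prime (q :: nat) \<Longrightarrow> (n :: int)\<^sup>2 \<noteq> int q"
proof
  assume q: "Factorial_Ring.prime q" and n: "n\<^sup>2 = int q"
  then have "n\<^sup>2 dvd int q" by simp
  then have "n dvd 1" using squarefree_prime[of "int q"] q by (auto simp: squarefree_def)
  then have "n\<^sup>2 = 1" by (metis power2_abs one_power2 zdvd1_eq)
  then show False using n q by simp
qed

text \<open>In lowest terms the square of the denominator divides \<open>q\<close>, which is
  squarefree.\<close>

lemma rat_square_times_prime:
  assumes "Factorial_Ring.prime q" "y \<in> \<rat>" "of_nat q * y\<^sup>2 = (of_int m :: complex)"
  shows "y \<in> \<int>"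
proof -
  from assms(2) obtain a b where ab: "b > 0" "Rings.coprime a b" "y = of_int a / of_int b"
    by (auto elim: Rats_cases')
  have "complex_of_int (int q * a\<^sup>2) = of_int (m * b\<^sup>2)"
    using assms(3) ab by (simp add: field_simps)
  then have eq: "int q * a\<^sup>2 = m * b\<^sup>2" unfolding of_int_eq_iff .
  then have "b\<^sup>2 dvd int q * a\<^sup>2" by simp
  moreover have "Rings.coprime (b\<^sup>2) (a\<^sup>2)" using ab by (simp add: coprime_commute)
  ultimately have "b\<^sup>2 dvd int q" using coprime_dvd_mult_left_iff by blast
  then have "b dvd 1" using squarefree_prime[of "int q"] assms(1) by (auto simp: squarefree_def)
  then have "b = 1" using ab by simp
  then show ?thesis using ab by simp
qed

lemma square_or_prime_times_square:
  fixes m p :: int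
  assumes "m > 0" "Factorial_Ring.prime p"
    and "\<And>l. Factorial_Ring.prime l \<Longrightarrow> l \<noteq> p \<Longrightarrow> even (multiplicity l m)"
  shows "\<exists>k. m = k\<^sup>2 \<or> m = p * k\<^sup>2"
proof -
  define f where "f = squarefree_part m"
  have m: "m = f * (square_part m)\<^sup>2" unfolding f_def by (rule squarefree_decompose)
  have sq: "squarefree f" unfolding f_def by (rule squarefree_squarefree_part)
  have f: "f > 0" using m assms(1) 
    by (metis not_less_iff_gr_or_eq power2_less_0 zero_less_mult_iff)
  have only: "l = p" if "Factorial_Ring.prime l" "l dvd f" for l
  proof (rule ccontr)
    assume "l \<noteq> p"
    then have "multiplicity l f = 0"
      using assms(3)[OF that(1)] that by (simp add: f_def prime_multiplicity_squarefree_part)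
    moreover have "multiplicity l f > 0" 
      using prime_multiplicity_gt_zero_iff[OF prime_imp_prime_elem[OF that(1)], of f] that(2) f by simp
    ultimately show False by simp
  qed
  have "f = 1 \<or> f = p"
  proof (cases "f = 1")
    case False
    then obtain l where "Factorial_Ring.prime l" "l dvd f" using prime_factor_int[of f] f by auto
    then have "p dvd f" using only by blast
    then obtain g where g: "f = p * g" by auto
    have g0: "g > 0" using g f prime_gt_0_int[OF assms(2)] by (simp add: zero_less_mult_iff)
    have "g = 1"
    proof (rule ccontr)
      assume "g \<noteq> 1"
      then obtain l where "Factorial_Ring.prime l" "l dvd g" using prime_factor_int[of g] g0 by auto
      then have "p dvd g" using only[of l] g by auto
      then have "p\<^sup>2 dvd f" unfolding g power2_eq_square by (rule mult_dvd_mono[OF dvd_refl])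
      then show False using sq assms(2) by (auto simp: squarefree_def)
    qed
    then show ?thesis using g by simp
  qed simp
  then show ?thesis using m by auto
qed

section \<open>The field \<open>K\<close> and its ring of integers\<close>

locale quadratic =
  fixes q :: nat and s :: complex
  assumes prime_q: "Factorial_Ring.prime q" and q_mod_4: "q mod 4 = 3" and s_square: "s\<^sup>2 = - of_nat q"
begin

definition K :: "complex set" where "K = adjoin \<rat> s"

definition Q :: int where "Q = (int q + 1) div 4"

lemma q_eq: "int q = 4 * Q - 1"
  using q_mod_4 unfolding Q_def by presburger

lemma q_pos: "q > 0" using prime_q by (rule prime_gt_0_nat)

lemma Re_s: "Re s = 0" and Im_s: "Im s \<noteq> 0"
proof -
  have "Re (s\<^sup>2) = - real q" "Im (s\<^sup>2) = 0" using s_square by simp_all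
  then have 1: "Re s * Re s - Im s * Im s = - real q" "Re s = 0 \<or> Im s = 0"
    by (auto simp: power2_eq_square)
  show "Im s \<noteq> 0"
  proof
    assume "Im s = 0"
    then have "Re s * Re s = - real q" using 1 by simp
    moreover have "Re s * Re s \<ge> 0" by simp
    ultimately show False using q_pos by linarith
  qed
  then show "Re s = 0" using 1 by simp
qed

lemma cnj_s [simp]: "cnj s = - s"
  by (simp add: complex_eq_iff Re_s)

lemma s_nonzero: "s \<noteq> 0" using Im_s by auto

lemma s_mult_s: "s * s = - of_nat q" "s * (s * x) = - of_nat q * x"
  using s_square by (simp_all add: power2_eq_square flip: mult.assoc)

lemma K_eq: "K = {u + v * s |u v. u \<in> \<rat> \<and> v \<in> \<rat>}"
  unfolding K_def by (rule adjoin_quadratic[OF field_closed_Rats]) (simp add: s_square)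

lemma field_K: "field_closed K"
  unfolding K_def by (rule field_closed_adjoin)

lemmas K_intros = field_closedD[OF field_K]

lemma s_in_K: "s \<in> K"
  unfolding K_eq by (rule CollectI, rule exI[of _ 0], rule exI[of _ 1]) auto

lemma cnj_Rats: "u \<in> \<rat> \<Longrightarrow> cnj u = u"
  by (auto elim!: Rats_cases')

lemma cnj_in_K: "x \<in> K \<Longrightarrow> cnj x \<in> K"
  unfolding K_eq using cnj_Rats Rats_minus_iff by (force simp flip: mult_minus_left)

lemma linear_unique:
  assumes "of_int U + of_int V * s = of_int U' + of_int V' * s"
  shows "U = U'" "V = V'"
proof -
  have "Im (of_int U + of_int V * s) = Im (of_int U' + of_int V' * s)" using assms by simp
  then have "of_int V * Im s = of_int V' * Im s" by simp
  then show "V = V'" using Im_s by simp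
  then show "U = U'" using assms by simp
qed

text \<open>
  The ring of integers of \<open>K\<close>, in the coordinates \<open>z = (U + V s) / 2\<close> with trace \<open>U\<close>.
\<close>

definition OK :: "complex set" where
  "OK = {z. \<exists>U V::int. even (U - V) \<and> 2 * z = of_int U + of_int V * s}"

lemma OK_I: "even (U - V) \<Longrightarrow> 2 * z = of_int U + of_int V * s \<Longrightarrow> z \<in> OK"
  unfolding OK_def by blast

lemma OK_E:
  assumes "z \<in> OK"
  obtains U V n :: int where "even (U - V)" "2 * z = of_int U + of_int V * s" "z + cnj z = of_int U"
    "z * cnj z = of_int n" "U\<^sup>2 + int q * V\<^sup>2 = 4 * n" "n \<ge> 0" "z\<^sup>2 = of_int U * z - of_int n"
proof -
  from assms obtain U V where UV: "even (U - V)" "2 * z = of_int U + of_int V * s" by (auto simp: OK_def)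
  obtain k where k: "U = V + 2 * k" using UV(1) by (elim evenE) (metis diff_add_cancel add.commute)
  \<comment> \<open>This is the norm form of \<open>k + V * (1 + s) / 2\<close>, the same element in
    an integral basis.\<close>
  define n where "n = V\<^sup>2 * Q + V * k + k\<^sup>2"
  have n: "U\<^sup>2 + int q * V\<^sup>2 = 4 * n"
    unfolding k n_def q_eq by (simp add: power2_eq_square algebra_simps)
  have z: "z = (of_int U + of_int V * s) / 2" unfolding UV(2)[symmetric] by simp
  have tr: "z + cnj z = of_int U" unfolding z by (simp add: field_simps)
  have "4 * (z * cnj z) = of_int (U\<^sup>2 + int q * V\<^sup>2)"
    unfolding z by (simp add: algebra_simps s_mult_s power2_eq_square)
  then have nm: "z * cnj z = of_int n" unfolding n by simp
  have "z\<^sup>2 = (z + cnj z) * z - z * cnj z" by (simp add: algebra_simps power2_eq_square)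
  then have z2: "z\<^sup>2 = of_int U * z - of_int n" unfolding tr nm .
  have nn: "n \<ge> 0" using n by (smt (verit) mult_nonneg_nonneg of_nat_0_le_iff zero_le_power2)
  show ?thesis by (rule that[OF UV tr nm n nn z2])
qed

lemma OK_int: "of_int a \<in> OK"
  by (rule OK_I[of "2 * a" 0]) auto

lemma OK_s: "s \<in> OK"
  by (rule OK_I[of 0 2]) auto

lemma OK_subset: "z \<in> OK \<Longrightarrow> z \<in> K"
proof -
  assume "z \<in> OK"
  then obtain U V :: int where "2 * z = of_int U + of_int V * s" by (auto simp: OK_def)
  then have "z = of_int U / 2 + (of_int V / 2) * s" by (simp add: field_simps)
  then show "z \<in> K" using s_in_K by (simp only:) (intro K_intros)
qed

lemma OK_add: "x \<in> OK \<Longrightarrow> y \<in> OK \<Longrightarrow> x + y \<in> OK"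
proof -
  assume "x \<in> OK" "y \<in> OK"
  then obtain U V U' V' :: int where 1: "even (U - V)" "2 * x = of_int U + of_int V * s"
    "even (U' - V')" "2 * y = of_int U' + of_int V' * s" by (auto simp: OK_def)
  show ?thesis
  proof (rule OK_I)
    show "even ((U + U') - (V + V'))" using 1 by presburger
    have "2 * (x + y) = 2 * x + 2 * y" by simp
    then show "2 * (x + y) = of_int (U + U') + of_int (V + V') * s" unfolding 1 by (simp add: algebra_simps)
  qed
qed

lemma OK_mult: "x \<in> OK \<Longrightarrow> y \<in> OK \<Longrightarrow> x * y \<in> OK"
proof -
  assume "x \<in> OK" "y \<in> OK"
  then obtain U V U' V' :: int where 1: "even (U - V)" "2 * x = of_int U + of_int V * s"
    "even (U' - V')" "2 * y = of_int U' + of_int V' * s" by (auto simp: OK_def)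
  obtain k where k: "U = V + 2 * k" using 1(1) by (elim evenE) (metis diff_add_cancel add.commute)
  obtain k' where k': "U' = V' + 2 * k'" using 1(3) by (elim evenE) (metis diff_add_cancel add.commute)
  define A where "A = V * V' + V * k' + V' * k + 2 * k * k' - 2 * Q * V * V'"
  define B where "B = V * V' + k * V' + k' * V"
  have "4 * (x * y) = (2 * x) * (2 * y)" by simp
  also have "\<dots> = of_int (U * U' - int q * V * V') + of_int (U * V' + U' * V) * s"
    unfolding 1 by (simp add: algebra_simps s_mult_s)
  also have "U * U' - int q * V * V' = 2 * (V * V' + V * k' + V' * k + 2 * k * k' - 2 * Q * V * V')"
    unfolding q_eq k k' by (simp add: algebra_simps)
  also have "U * V' + U' * V = 2 * (V * V' + k * V' + k' * V)"
    unfolding k k' by (simp add: algebra_simps)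
  finally have "4 * (x * y) = of_int (2 * A) + of_int (2 * B) * s" unfolding A_def B_def .
  then have "2 * (2 * (x * y)) = 2 * (of_int A + of_int B * s)" by (simp add: algebra_simps)
  then have "2 * (x * y) = of_int A + of_int B * s" by (subst (asm) mult_left_cancel) simp_all
  moreover have "even (A - B)" unfolding A_def B_def by (simp add: algebra_simps)
  ultimately show ?thesis by (rule OK_I[rotated])
qed

lemma OK_minus: "x \<in> OK \<Longrightarrow> - x \<in> OK"
  using OK_mult[OF OK_int[of "-1"]] by simp

lemma OK_diff: "x \<in> OK \<Longrightarrow> y \<in> OK \<Longrightarrow> x - y \<in> OK"
  using OK_add[OF _ OK_minus] by fastforce

lemma OK_power: "x \<in> OK \<Longrightarrow> x ^ n \<in> OK"
  by (induction n) (use OK_int[of 1] OK_mult in auto)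

lemma OK_simple: "0 \<in> OK" "1 \<in> OK" "numeral m \<in> OK"
  using OK_int[of 0] OK_int[of 1] OK_int[of "numeral m"] by simp_all

lemma OK_cnj: "x \<in> OK \<Longrightarrow> cnj x \<in> OK"
proof -
  assume "x \<in> OK"
  then obtain U V :: int where 1: "even (U - V)" "2 * x = of_int U + of_int V * s" by (auto simp: OK_def)
  have "2 * cnj x = cnj (2 * x)" by simp
  also have "\<dots> = of_int U + of_int (- V) * s" unfolding 1 by simp
  finally show ?thesis using 1(1) by (intro OK_I[of U "- V"]) auto
qed

lemmas OK_intros = OK_simple OK_int OK_s OK_add OK_mult OK_minus OK_diff OK_power OK_cnj

lemma OK_trace_norm:
  assumes "z \<in> K" "z + cnj z = of_int t" "z * cnj z = of_int n"
  shows "z \<in> OK"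
proof -
  obtain u v where uv: "z = u + v * s" "u \<in> \<rat>" "v \<in> \<rat>" using assms(1) by (auto simp: K_eq)
  have c: "cnj z = u - v * s" using uv cnj_Rats by simp
  have t: "2 * u = of_int t" using assms(2) uv(1) c by simp
  have "of_nat q * (2 * v)\<^sup>2 = 4 * (z * cnj z) - (2 * u)\<^sup>2"
    unfolding c unfolding uv(1) by (simp add: algebra_simps power2_eq_square s_mult_s)
  also have "\<dots> = of_int (4 * n - t\<^sup>2)" using assms t by simp
  finally have *: "of_nat q * (2 * v)\<^sup>2 = of_int (4 * n - t\<^sup>2)" .
  have "2 * v \<in> \<int>" using rat_square_times_prime[OF prime_q _ *] uv by auto
  then obtain V where V: "2 * v = of_int V" by (auto elim: Ints_cases)
  have "complex_of_int (int q * V\<^sup>2) = of_int (4 * n - t\<^sup>2)" using * V by simp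
  then have "int q * V\<^sup>2 = 4 * n - t\<^sup>2" unfolding of_int_eq_iff .
  then have "even (int q * V\<^sup>2 + t\<^sup>2)" by simp
  moreover have "odd (int q)" using q_eq by simp
  ultimately have "even (t - V)" by auto
  moreover have "2 * z = of_int t + of_int V * s" unfolding uv(1) t[symmetric] V[symmetric] by (simp add: algebra_simps)
  ultimately show ?thesis by (rule OK_I)
qed

lemma OK_rational:
  assumes "z \<in> OK" "cnj z = z"
  shows "\<exists>m. z = of_int m"
proof -
  from assms(1) obtain U V n where 1: "even (U - V)" "2 * z = of_int U + of_int V * s" "z + cnj z = of_int U"
    by (rule OK_E)
  have "V = 0" using linear_unique(2)[of U V U 0] 1 assms(2) by simp
  then have "even U" using 1 by simp
  then obtain m where "U = 2 * m" by auto
  then show ?thesis using 1 \<open>V = 0\<close> by (intro exI[of _ m]) simp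
qed

text \<open>
  With \<open>I = (a, c)\<close> the hypotheses give \<open>I\<^sup>2 = (a)\<close>, and \<open>I\<close> times its conjugate is generated by
  \<open>gcd (N a, Tr (a c'), N c)\<close>.
\<close>

lemma norm_is_square:
  assumes "a \<in> OK" "b \<in> OK" "c \<in> OK" "e \<in> OK" "f \<in> OK" "e * a + f * b = 1" "a * b = c\<^sup>2"
  shows "\<exists>n. a * cnj a = of_int (n\<^sup>2)"
proof -
  obtain A where A: "a * cnj a = of_int A" "A \<ge> 0" using assms(1) by (rule OK_E)
  obtain C where C: "c * cnj c = of_int C" using assms(3) by (rule OK_E)
  define Z where "Z = a * cnj c"
  have ZO: "Z \<in> OK" unfolding Z_def by (intro OK_intros assms)
  then obtain B where B: "Z + cnj Z = of_int B" by (rule OK_E)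
  have cZ: "cnj Z = cnj a * c" by (simp add: Z_def)
  define n where "n = gcd A (gcd B C)"
  show ?thesis
  proof (cases "n = 0")
    case True
    then show ?thesis using A by (auto simp: n_def intro: exI[of _ 0])
  next
    case False
    obtain A' where A': "A = n * A'" unfolding n_def by (metis dvdE gcd_dvd1)
    obtain B' where B': "B = n * B'" unfolding n_def by (metis dvdE gcd_dvd1 gcd_dvd2 dvd_trans)
    obtain C' where C': "C = n * C'" unfolding n_def by (metis dvdE gcd_dvd2 dvd_trans)
    obtain i j' where ij: "n = i * A + j' * gcd B C" unfolding n_def by (metis bezout_int)
    obtain j k where jk: "gcd B C = j * B + k * C" by (metis bezout_int)
    have nc: "complex_of_int n \<noteq> 0" using False by simp
    \<comment> \<open>Integrality of \<open>Z / n\<close> is seen from its trace \<open>B'\<close>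
      and norm \<open>A' * C'\<close>.\<close>
    define \<zeta> where "\<zeta> = Z / of_int n"
    have Zz: "Z = of_int n * \<zeta>" "cnj Z = of_int n * cnj \<zeta>" using nc by (simp_all add: \<zeta>_def)
    have z: "\<zeta> \<in> OK"
    proof (rule OK_trace_norm)
      show "\<zeta> \<in> K" unfolding \<zeta>_def by (intro K_intros OK_subset[OF ZO])
      have "\<zeta> + cnj \<zeta> = (Z + cnj Z) / of_int n" by (simp add: \<zeta>_def add_divide_distrib)
      then show "\<zeta> + cnj \<zeta> = of_int B'" unfolding B B' using nc by simp
      have "\<zeta> * cnj \<zeta> = (a * cnj a) * (c * cnj c) / (of_int n * of_int n)"
        by (simp add: \<zeta>_def Z_def field_simps)
      then show "\<zeta> * cnj \<zeta> = of_int (A' * C')" unfolding A C A' C' using nc by simp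
    qed
    have ab': "cnj a * cnj b = (cnj c)\<^sup>2" using arg_cong[OF assms(7), of cnj] by simp
    have one: "(e * a + f * b) * (cnj e * cnj a + cnj f * cnj b) = 1"
    proof -
      have "cnj e * cnj a + cnj f * cnj b = cnj (e * a + f * b)" by simp
      then show ?thesis unfolding assms(6) by simp
    qed
    \<comment> \<open>\<open>g\<close> will be \<open>A / n\<^sup>2\<close>: multiply
      \<open>A\<close> by the Bezout relation times its conjugate; each of the four resulting terms
      is divisible by \<open>n\<^sup>2\<close>.\<close>
    define g where "g = e * cnj e * of_int (A'\<^sup>2) + e * cnj f * \<zeta>\<^sup>2 + f * cnj e * (cnj \<zeta>)\<^sup>2 + f * cnj f * of_int (C'\<^sup>2)"
    have gO: "g \<in> OK" unfolding g_def by (intro OK_intros z assms)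
    have Zsq: "of_int A * (a * cnj b) = Z\<^sup>2" "of_int A * (b * cnj a) = (cnj Z)\<^sup>2" "of_int A * (b * cnj b) = of_int (C\<^sup>2)"
      using assms(7) ab' A(1)[symmetric] C(1)[symmetric] unfolding Z_def cZ
      by (auto simp: power2_eq_square algebra_simps)
    have "of_int A = of_int A * ((e * a + f * b) * (cnj e * cnj a + cnj f * cnj b))" using one by simp
    also have "\<dots> = e * cnj e * (of_int A * (a * cnj a)) + e * cnj f * (of_int A * (a * cnj b)) +
        f * cnj e * (of_int A * (b * cnj a)) + f * cnj f * (of_int A * (b * cnj b))"
      by (simp add: algebra_simps)
    also have "\<dots> = e * cnj e * (of_int A * of_int A) + e * cnj f * Z\<^sup>2 +
        f * cnj e * (cnj Z)\<^sup>2 + f * cnj f * of_int (C\<^sup>2)"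
      unfolding Zsq A(1) by (rule refl)
    also have "\<dots> = of_int (n\<^sup>2) * g"
      unfolding Zz A' C' g_def by (simp add: algebra_simps power2_eq_square)
    finally have Ag: "of_int A = of_int (n\<^sup>2) * g" .
    define J L where "J = j' * j" and "L = j' * k"
    have nABC: "n = i * A + J * B + L * C" unfolding ij jk J_def L_def by (simp add: algebra_simps)
    \<comment> \<open>\<open>h\<close> will be \<open>n\<^sup>2 / A\<close>: in the square of the
      Bezout expression of \<open>n\<close>, every product of two of \<open>A\<close>,
      \<open>B\<close>, \<open>C\<close> is \<open>A\<close> times an element of \<open>OK\<close>,
      by \<open>a * b = c\<^sup>2\<close>. Thus \<open>g\<close> and \<open>h\<close> are rational,
      integral and inverse to each other.\<close>
    define h where "h = of_int (i\<^sup>2 * A + 2 * i * J * B + 2 * i * L * C) +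
      of_int (J\<^sup>2) * (a * cnj b + 2 * of_int C + b * cnj a) +
      of_int (2 * J * L) * (c * cnj b + cnj c * b) + of_int (L\<^sup>2) * (b * cnj b)"
    have hO: "h \<in> OK" unfolding h_def by (intro OK_intros assms)
    have BZ: "complex_of_int B = Z + cnj Z" using B by simp
    have ZZ: "Z * cnj Z = of_int A * of_int C"
      unfolding A(1)[symmetric] C(1)[symmetric] Z_def cZ by simp
    have "Z * of_int C = (a * c) * (cnj c)\<^sup>2" "cnj Z * of_int C = (cnj a * cnj c) * c\<^sup>2"
      unfolding C[symmetric] Z_def cZ by (simp_all add: power2_eq_square)
    then have ZC: "Z * of_int C = of_int A * (c * cnj b)" "cnj Z * of_int C = of_int A * (cnj c * b)"
      unfolding ab'[symmetric] assms(7)[symmetric] A(1)[symmetric] by simp_all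
    have "complex_of_int (B\<^sup>2) = Z\<^sup>2 + 2 * (Z * cnj Z) + (cnj Z)\<^sup>2"
      by (simp add: BZ power2_eq_square algebra_simps)
    then have B2: "complex_of_int (B\<^sup>2) = of_int A * (a * cnj b + 2 * of_int C + b * cnj a)"
      unfolding ZZ Zsq[symmetric] by (simp add: algebra_simps)
    have BC: "complex_of_int (B * C) = of_int A * (c * cnj b + cnj c * b)"
      by (simp add: BZ ZC distrib_left distrib_right)
    have "n\<^sup>2 = A * (i\<^sup>2 * A + 2 * i * J * B + 2 * i * L * C) + J\<^sup>2 * B\<^sup>2 + (2 * J * L) * (B * C) + L\<^sup>2 * C\<^sup>2"
      unfolding nABC by (simp add: power2_eq_square algebra_simps)
    then have "complex_of_int (n\<^sup>2) = of_int A * of_int (i\<^sup>2 * A + 2 * i * J * B + 2 * i * L * C) +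
        of_int (J\<^sup>2) * of_int (B\<^sup>2) + of_int (2 * J * L) * of_int (B * C) + of_int (L\<^sup>2) * of_int (C\<^sup>2)"
      by (simp only: of_int_mult of_int_add)
    also have "\<dots> = of_int A * h"
      unfolding B2 BC Zsq(3)[symmetric] h_def by (simp only: distrib_left mult_ac)
    finally have nh: "complex_of_int (n\<^sup>2) = of_int A * h" .
    have A0: "complex_of_int A \<noteq> 0" using nh nc by auto
    have gh: "g = of_int A / of_int (n\<^sup>2)" "h = of_int (n\<^sup>2) / of_int A"
      using Ag nh nc A0 by (auto simp: field_simps)
    obtain m where m: "g = of_int m" using OK_rational[OF gO] by (auto simp: gh)
    obtain m' where m': "h = of_int m'" using OK_rational[OF hO] by (auto simp: gh)
    have Am: "A = n\<^sup>2 * m" using Ag unfolding m by (metis of_int_eq_iff of_int_mult)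
    have "n\<^sup>2 = A * m'" using nh unfolding m' by (metis of_int_eq_iff of_int_mult)
    then have "n\<^sup>2 * (m * m') = n\<^sup>2 * 1" using Am by (simp add: mult.assoc)
    then have "m * m' = 1" using False by (metis mult_cancel_left zero_eq_power2)
    then have "m = 1 \<or> m = -1" using zmult_eq_1_iff[of m m'] by blast
    moreover have "m \<noteq> -1" using Am A(2) False by auto
    ultimately show ?thesis using A(1) Am by (intro exI[of _ n]) simp
  qed
qed

lemma OK_divide_int:
  "even (U - V) \<Longrightarrow> 2 * z = of_int (m * U) + of_int (m * V) * s \<Longrightarrow> m \<noteq> 0 \<Longrightarrow> z / of_int m \<in> OK"
  by (rule OK_I[of U V]) (simp_all add: field_simps)

lemma odd_q: "odd (int q)" using q_eq by simp

text \<open>For odd \<open>l\<close> equal parity survives the division; for \<open>l = 2\<close>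
  the halved coordinates have to agree in parity again, hence the last premise.\<close>

lemma OK_divide_prime:
  fixes l :: int
  assumes l: "Factorial_Ring.prime l" and UV: "even (U - V)" "2 * z = of_int U + of_int V * s" "l dvd U" "l dvd V"
    and two: "l = 2 \<Longrightarrow> even ((U - V) div 2)"
  shows "z / of_int l \<in> OK"
proof -
  from UV obtain U' V' where UV': "U = l * U'" "V = l * V'" by (auto elim!: dvdE)
  have "even (U' - V')"
  proof (cases "l = 2")
    case True
    then have "(U - V) div 2 = U' - V'" using UV' by simp
    then show ?thesis using two[OF True] by simp
  next
    case False
    then have "odd l" using l prime_odd_int[of l] prime_gt_1_int[OF l] by linarith
    moreover have "even (l * (U' - V'))" using UV(1) UV' by (simp add: algebra_simps)
    ultimately show ?thesis by simp
  qed
  then show ?thesis using UV(2) UV' prime_gt_0_int[OF l]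
    by (intro OK_divide_int[of U' V']) auto
qed

lemma prime_not_dvd_q: "Factorial_Ring.prime (l :: int) \<Longrightarrow> l \<noteq> int q \<Longrightarrow> \<not> l dvd int q"
  using primes_dvd_imp_eq[of l "int q"] prime_q by auto

text \<open>Primes other than \<open>q\<close> are unramified in \<open>K\<close>, so their ideals
  are radical. Concretely, \<open>l\<close> divides the norm of \<open>z\<close>, then the trace by
  \<open>z\<^sup>2 = U * z - n\<close>, and then \<open>V\<close>.\<close>

lemma prime_dvd_square_imp_dvd:
  fixes l :: int
  assumes l: "Factorial_Ring.prime l" "l \<noteq> int q" and z: "z \<in> OK" "z\<^sup>2 / of_int l \<in> OK"
  shows "z / of_int l \<in> OK"
proof -
  obtain U V n where UV: "even (U - V)" "2 * z = of_int U + of_int V * s"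
    "z * cnj z = of_int n" "U\<^sup>2 + int q * V\<^sup>2 = 4 * n" "z\<^sup>2 = of_int U * z - of_int n"
    using z(1) by (rule OK_E)
  have l0: "complex_of_int l \<noteq> 0" using l by auto
  obtain m where m: "(z\<^sup>2 / of_int l) * cnj (z\<^sup>2 / of_int l) = of_int m" using z(2) by (rule OK_E)
  have "(z\<^sup>2 / of_int l) * cnj (z\<^sup>2 / of_int l) = (z * cnj z)\<^sup>2 / (of_int l)\<^sup>2"
    by (simp add: power2_eq_square)
  then have "complex_of_int (n\<^sup>2) = of_int (l\<^sup>2 * m)" unfolding m UV(3) using l0 by (simp add: field_simps)
  then have "n\<^sup>2 = l\<^sup>2 * m" unfolding of_int_eq_iff .
  then have "l\<^sup>2 dvd n\<^sup>2" by simp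
  then have ln: "l dvd n" by simp
  then obtain n' where n': "n = l * n'" by auto
  have "z\<^sup>2 / of_int l + of_int n' \<in> OK" by (intro OK_intros z)
  also have "z\<^sup>2 / of_int l + of_int n' = of_int U * z / of_int l"
    unfolding UV(5) n' using l0 by (simp add: field_simps)
  finally obtain A B where AB: "2 * (of_int U * z / of_int l) = of_int A + of_int B * s" by (rule OK_E)
  have "of_int (U * U) + of_int (U * V) * s = of_int U * (2 * z)" unfolding UV(2) by (simp add: algebra_simps)
  also have "\<dots> = of_int l * (2 * (of_int U * z / of_int l))" using l0 by simp
  also have "\<dots> = of_int (l * A) + of_int (l * B) * s" unfolding AB by (simp add: algebra_simps)
  finally have "U * U = l * A" by (rule linear_unique)
  then have "l dvd U * U" by simp
  then have lU: "l dvd U" using l by (simp add: prime_dvd_mult_iff)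
  have "int q * V\<^sup>2 = 4 * n - U * U" using UV(4) by (simp add: power2_eq_square)
  moreover have "l dvd 4 * n - U * U" using ln lU by (intro dvd_diff dvd_mult) auto
  ultimately have "l dvd int q * V\<^sup>2" by simp
  then have "l dvd V\<^sup>2" using prime_not_dvd_q[OF l] l by (simp add: prime_dvd_mult_iff)
  then have lV: "l dvd V" using l prime_dvd_power by blast
  show ?thesis
  proof (rule OK_divide_prime[OF l(1) UV(1,2) lU lV])
    assume "l = 2"
    then obtain U1 V1 where 1: "U = 2 * U1" "V = 2 * V1" using lU lV by (auto elim!: dvdE)
    have "U1\<^sup>2 + int q * V1\<^sup>2 = n" using UV(4) unfolding 1 by (simp add: power2_eq_square)
    then have "even (U1\<^sup>2 + int q * V1\<^sup>2)" using ln \<open>l = 2\<close> by simp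
    then have "even (U1 - V1)" using odd_q by auto
    then show "even ((U - V) div 2)" unfolding 1 by simp
  qed
qed

text \<open>
  If \<open>a\<close> has norm \<open>n\<^sup>2\<close> and trace \<open>U\<close>, then \<open>a (U + 2 n) = (a + n)\<^sup>2\<close>, so up to squares \<open>a\<close> is rational.
\<close>

lemma square_if_norm_square:
  assumes a: "a \<in> OK" "a \<noteq> 0" "a * cnj a = of_int (n\<^sup>2)"
    and no_prime: "\<And>l::int. Factorial_Ring.prime l \<Longrightarrow> l \<noteq> int q \<Longrightarrow> a / of_int l \<notin> OK"
  shows "\<exists>g\<in>K. a = g\<^sup>2 \<or> a = - g\<^sup>2"
proof -
  define N where "N = \<bar>n\<bar>"
  obtain U V m where UV: "even (U - V)" "2 * a = of_int U + of_int V * s"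
    "a * cnj a = of_int m" "U\<^sup>2 + int q * V\<^sup>2 = 4 * m" "a\<^sup>2 = of_int U * a - of_int m"
    using a(1) by (rule OK_E)
  have "m = n\<^sup>2" using UV(3) a(3) by (metis of_int_eq_iff)
  then have m: "m = N\<^sup>2" by (simp add: N_def)
  have "N \<noteq> 0" using a m UV(3) by auto
  then have N: "N > 0" unfolding N_def by simp
  have norm: "U\<^sup>2 + int q * V\<^sup>2 = 4 * N\<^sup>2" using UV(4) m by simp
  have "U\<^sup>2 \<le> (2 * N)\<^sup>2" using norm by (simp add: power_mult_distrib) (smt (verit) of_nat_0_le_iff zero_le_mult_iff zero_le_power2)
  then have absU: "\<bar>U\<bar> \<le> 2 * N" using N abs_le_square_iff[of U "2 * N"] by simp
  have sq_case: "\<exists>g\<in>K. of_int k = g\<^sup>2 \<or> of_int k = - g\<^sup>2"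
    if k: "k > 0" "\<And>l. Factorial_Ring.prime l \<Longrightarrow> l \<noteq> int q \<Longrightarrow> even (multiplicity l k)" for k :: int
  proof -
    obtain j where "k = j\<^sup>2 \<or> k = int q * j\<^sup>2"
      using square_or_prime_times_square[OF k(1), of "int q"] k(2) prime_q by auto
    then have "complex_of_int k = (of_int j)\<^sup>2 \<or> complex_of_int k = - (of_int j * s)\<^sup>2"
      by (auto simp: power_mult_distrib s_square)
    moreover have "of_int j \<in> K" "of_int j * s \<in> K" by (intro K_intros s_in_K)+
    ultimately show ?thesis by blast
  qed
  define r where "r = U + 2 * N"
  have r0: "r \<ge> 0" using absU by (simp add: r_def)
  show ?thesis
  proof (cases "r = 0")
    case True
    then have U: "U = - 2 * N" by (simp add: r_def)
    then have "V = 0" using norm q_pos by (simp add: power2_eq_square)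
    then have aN: "a = - of_int N" using UV(2) U by simp
    have "\<exists>g\<in>K. of_int N = g\<^sup>2 \<or> of_int N = - g\<^sup>2"
    proof (rule sq_case[OF N])
      fix l :: int assume l: "Factorial_Ring.prime l" "l \<noteq> int q"
      have "\<not> l dvd N"
      proof
        assume "l dvd N"
        then obtain k where "N = l * k" by auto
        then have "a / of_int l = of_int (- k)" using l by (auto simp: aN)
        then show False using no_prime[OF l] OK_int by metis
      qed
      then show "even (multiplicity l N)" by (simp add: not_dvd_imp_multiplicity_0)
    qed
    then show ?thesis unfolding aN by (metis minus_minus)
  next
    case False
    then have r: "r > 0" using r0 by simp
    have ar: "a * of_int r = (a + of_int N)\<^sup>2"
      using UV(5) by (simp add: r_def m power2_eq_square algebra_simps)
    \<comment> \<open>The norm equation is \<open>r * w = q * V\<^sup>2\<close>. For nonzero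
      \<open>V\<close>, a prime \<open>l\<close> other than \<open>q\<close> with odd exponent in
      \<open>r\<close> has odd exponent in \<open>w\<close> as well; it then divides
      \<open>U\<close> and \<open>V\<close>, and \<open>a / l\<close> would be integral.\<close>
    define w where "w = 2 * N - U"
    have rw: "r * w = int q * V\<^sup>2" using norm by (simp add: r_def w_def power2_eq_square algebra_simps)
    have "\<exists>g\<in>K. of_int r = g\<^sup>2 \<or> of_int r = - g\<^sup>2"
    proof (rule sq_case[OF r], rule ccontr)
      fix l :: int assume l: "Factorial_Ring.prime l" "l \<noteq> int q" and odd_r: "odd (multiplicity l r)"
      have lr: "l dvd r" using odd_r by (metis even_zero not_dvd_imp_multiplicity_0)
      note pe = l(1)[THEN prime_imp_prime_elem]
      show False
      proof (cases "V = 0")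
        case True
        then have "w = 0" using rw r by simp
        then have U: "U = 2 * N" and r4: "r = 4 * N" by (simp_all add: w_def r_def)
        then have aN: "a = of_int N" using UV(2) True by simp
        have "l dvd N"
        proof (cases "l = 2")
          case True
          have "multiplicity 2 r = multiplicity 2 (4 :: int) + multiplicity 2 N"
            unfolding r4 using N by (intro prime_elem_multiplicity_mult_distrib) auto
          also have "multiplicity 2 (4 :: int) = 2"
            using multiplicity_same_power[of "2 :: int" 2] by simp
          finally have "multiplicity 2 N \<noteq> 0" using odd_r True by (metis even_add even_numeral even_zero)
          then show ?thesis using True by (metis not_dvd_imp_multiplicity_0)
        next
          case False
          then have "\<not> l dvd 2" using l primes_dvd_imp_eq[of l 2] by auto
          then have "\<not> l dvd 2 * 2" using l by (subst prime_dvd_mult_iff) auto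
          then show ?thesis using lr l unfolding r4 by (simp add: prime_dvd_mult_iff)
        qed
        then obtain k where "N = l * k" by auto
        then have "a / of_int l = of_int k" using l by (auto simp: aN)
        then show False using no_prime[OF l] OK_int by metis
      next
        case False
        then have w0: "w \<noteq> 0" using rw q_pos by auto
        have "multiplicity l r + multiplicity l w = multiplicity l (int q * V\<^sup>2)"
          unfolding rw[symmetric] using r w0 pe by (intro prime_elem_multiplicity_mult_distrib[symmetric]) auto
        also have "\<dots> = multiplicity l (int q) + multiplicity l (V\<^sup>2)"
          using False q_pos pe by (intro prime_elem_multiplicity_mult_distrib) auto
        also have "\<dots> = 2 * multiplicity l V"
          using False pe prime_not_dvd_q[OF l]
          by (simp add: prime_elem_multiplicity_power_distrib not_dvd_imp_multiplicity_0)
        finally have odd_w: "odd (multiplicity l w)" using odd_r by (metis even_add dvd_triv_left)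
        have lw: "l dvd w" using odd_w by (metis even_zero not_dvd_imp_multiplicity_0)
        have UVdvd: "l dvd U \<and> l dvd V \<and> (l = 2 \<longrightarrow> even ((U - V) div 2))"
        proof (cases "l = 2")
          case False
          then have n2: "\<not> l dvd 2" using l primes_dvd_imp_eq[of l 2] by auto
          have "l dvd r - w" using lr lw by simp
          then have "l dvd 2 * U" by (simp add: r_def w_def)
          then have "l dvd U" using n2 l by (simp add: prime_dvd_mult_iff)
          moreover have "l dvd int q * V\<^sup>2" using rw lr by (metis dvd_mult2)
          then have "l dvd V\<^sup>2" using prime_not_dvd_q[OF l] l by (simp add: prime_dvd_mult_iff)
          then have "l dvd V" using l prime_dvd_power by blast
          ultimately show ?thesis using False by simp
        next
          case True
          then have "even U" using lr by (simp add: r_def)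
          then have "even V" using UV(1) by simp
          obtain U1 where U1: "U = 2 * U1" using \<open>even U\<close> by blast
          obtain V1 where V1: "V = 2 * V1" using \<open>even V\<close> by blast
          define r1 w1 where "r1 = U1 + N" and "w1 = N - U1"
          have r1: "r = 2 * r1" and w1: "w = 2 * w1" unfolding r_def w_def r1_def w1_def U1 by simp_all
          have rw1: "r1 * w1 = int q * V1\<^sup>2" using rw unfolding r1 w1 V1 by (simp add: power2_eq_square)
          have mult2: "even (multiplicity 2 k)" if "odd (multiplicity 2 (2 * k))" "k \<noteq> 0" for k :: int
            using that multiplicity_times_same[of k 2] by simp
          have mr: "even (multiplicity 2 r1)" using odd_r r True unfolding r1 by (intro mult2) auto
          have mw: "even (multiplicity 2 w1)" using odd_w w0 True unfolding w1 by (intro mult2) auto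
          have four: "4 dvd k" if "even (multiplicity 2 k)" "even k" "k \<noteq> 0" for k :: int
          proof -
            have "multiplicity 2 k \<noteq> 0" using that by (simp add: multiplicity_eq_zero_iff)
            then have "2 \<le> multiplicity 2 k" using that(1) by (cases "multiplicity 2 k = 1") auto
            then have "2\<^sup>2 dvd k" by (rule multiplicity_dvd')
            then show ?thesis by simp
          qed
          \<comment> \<open>Even \<open>U\<close> and \<open>V\<close> are not enough for
            \<open>a / 2\<close> to be integral: their halves must have equal parity, and this uses
            the even exponent of 2 in \<open>r1\<close> and \<open>w1\<close>.\<close>
          have "even (U1 - V1)"
          proof (cases "even r1")
            case True
            then have "even w1" unfolding r1_def w1_def by simp
            have "4 dvd r1" by (rule four[OF mr True]) (use r r1 in auto)
            moreover have "4 dvd w1" by (rule four[OF mw \<open>even w1\<close>]) (use w0 w1 in auto)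
            ultimately obtain r2 w2 where 2: "r1 = 4 * r2" "w1 = 4 * w2" by (auto elim!: dvdE)
            have "2 * U1 = r1 - w1" by (simp add: r1_def w1_def)
            then have "U1 = 2 * (r2 - w2)" using 2 by simp
            moreover have "even V1"
            proof -
              have "even (int q * V1\<^sup>2)" unfolding rw1[symmetric] 2 by simp
              then show ?thesis using odd_q by simp
            qed
            ultimately show ?thesis by simp
          next
            case False
            then have "odd w1" unfolding r1_def w1_def by simp
            then have "odd (int q * V1\<^sup>2)" unfolding rw1[symmetric] using False by simp
            then have "odd V1" by simp
            have "odd U1"
            proof (rule ccontr)
              assume "\<not> odd U1"
              then have "odd N" using False by (simp add: r1_def)
              obtain i where i: "V1 = 2 * i + 1" using \<open>odd V1\<close> by (elim oddE)
              obtain j where j: "N = 2 * j + 1" using \<open>odd N\<close> by (elim oddE)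
              obtain k where k: "U1 = 2 * k" using \<open>\<not> odd U1\<close> by auto
              \<comment> \<open>The left side is an odd square minus an even one, so 1 modulo 4; the
                right side is \<open>q\<close> times an odd square, so 3 modulo 4.\<close>
              have "(N + U1) * (N - U1) = int q * V1\<^sup>2" using rw1 by (simp add: r1_def w1_def add.commute)
              then have "2 * (2 * (j\<^sup>2 + j - k\<^sup>2) + 1) = 4 * (4 * Q * (i\<^sup>2 + i) + Q - i\<^sup>2 - i)"
                unfolding i j k q_eq by (simp add: power2_eq_square algebra_simps)
              then have "2 * (j\<^sup>2 + j - k\<^sup>2) + 1 = 2 * (4 * Q * (i\<^sup>2 + i) + Q - i\<^sup>2 - i)" by simp
              then show False by presburger
            qed
            then show ?thesis using \<open>odd V1\<close> by simp
          qed
          then show ?thesis unfolding U1 V1 using True by simp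
        qed
        then have "a / of_int l \<in> OK" using OK_divide_prime[OF l(1) UV(1,2)] by blast
        then show False using no_prime[OF l] by blast
      qed
    qed
    then obtain g where g: "g \<in> K" "of_int r = g\<^sup>2 \<or> of_int r = - g\<^sup>2" by blast
    have "g \<noteq> 0" using g r by auto
    have "a = ((a + of_int N) / g)\<^sup>2 \<or> a = - ((a + of_int N) / g)\<^sup>2"
      using g(2)
    proof
      assume "of_int r = g\<^sup>2"
      with ar have "a * g\<^sup>2 = (a + of_int N)\<^sup>2" by simp
      then show ?thesis using \<open>g \<noteq> 0\<close> by (simp add: power_divide field_simps)
    next
      assume "of_int r = - g\<^sup>2"
      with ar have "- (a * g\<^sup>2) = (a + of_int N)\<^sup>2" by simp
      then show ?thesis using \<open>g \<noteq> 0\<close> by (simp add: power_divide flip: \<open>- (a * g\<^sup>2) = (a + of_int N)\<^sup>2\<close>)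
    qed
    moreover have "(a + of_int N) / g \<in> K" by (intro K_intros g OK_subset[OF a(1)])
    ultimately show ?thesis by blast
  qed
qed

text \<open>Descent on the absolute value of \<open>a\<close>. A rational prime \<open>l\<close>
  other than \<open>q\<close> that divides \<open>a\<close> also divides \<open>c\<close>, being
  unramified, and the Bezout relation then makes \<open>l\<^sup>2\<close> divide \<open>a\<close>.
  Without such a prime, the norm of \<open>a\<close> is a square and
  \<open>square_if_norm_square\<close> applies.\<close>

theorem square_if_coprime_product_square:
  assumes "a \<in> OK" "b \<in> OK" "c \<in> OK" "e \<in> OK" "f \<in> OK" "e * a + f * b = 1" "a * b = c\<^sup>2" "a \<noteq> 0"
  shows "\<exists>g\<in>K. a = g\<^sup>2 \<or> a = - g\<^sup>2"
  using assms
proof (induction "nat \<lfloor>norm a\<rfloor>" arbitrary: a b c e f rule: less_induct)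
  case less
  show ?case
  proof (cases "\<exists>l::int. Factorial_Ring.prime l \<and> l \<noteq> int q \<and> a / of_int l \<in> OK")
    case False
    obtain n where "a * cnj a = of_int (n\<^sup>2)"
      using norm_is_square[OF less.prems(1-7)] by blast
    with False less.prems show ?thesis by (intro square_if_norm_square) auto
  next
    case True
    then obtain l :: int where l: "Factorial_Ring.prime l" "l \<noteq> int q" "a / of_int l \<in> OK" by blast
    have l0: "complex_of_int l \<noteq> 0" using l by auto
    define a1 where "a1 = a / of_int l"
    have a1: "a = of_int l * a1" using l0 by (simp add: a1_def)
    have "c\<^sup>2 / of_int l = a1 * b" using less.prems(7) l0 by (simp add: a1 field_simps)
    moreover have "a1 * b \<in> OK" using l(3) less.prems unfolding a1_def[symmetric] by (intro OK_mult)
    ultimately have "c / of_int l \<in> OK"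
      using prime_dvd_square_imp_dvd[OF l(1,2) less.prems(3)] by simp
    then obtain c1 where c1: "c1 \<in> OK" "c = of_int l * c1" using l0 by (metis nonzero_mult_div_cancel_left times_divide_eq_right)
    have ab: "a1 * b = of_int l * c1\<^sup>2"
      using less.prems(7) l0 by (simp add: a1 c1 power2_eq_square)
    \<comment> \<open>Multiplying the Bezout relation by \<open>a1\<close> and using
      \<open>a1 * b = l * c1\<^sup>2\<close> produces \<open>a1 = l * a2\<close>.\<close>
    define a2 where "a2 = e * a1\<^sup>2 + f * c1\<^sup>2"
    have "a1 = (e * a + f * b) * a1" using less.prems(6) by simp
    also have "\<dots> = of_int l * a2"
      using ab unfolding a2_def a1 by (simp add: algebra_simps power2_eq_square)
    finally have a12: "a1 = of_int l * a2" .
    have a2O: "a2 \<in> OK" unfolding a2_def using l(3) c1 less.prems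
      unfolding a1_def[symmetric] by (intro OK_intros)
    have a2: "a = (of_int l)\<^sup>2 * a2" by (simp add: a1 a12 power2_eq_square)
    have "\<exists>g\<in>K. a2 = g\<^sup>2 \<or> a2 = - g\<^sup>2"
    proof (rule less.hyps)
      show "a2 * b = c1\<^sup>2" using ab l0 by (simp add: a12)
      show "(e * (of_int l)\<^sup>2) * a2 + f * b = 1" using less.prems(6) by (simp add: a2 mult.assoc)
      show "e * (of_int l)\<^sup>2 \<in> OK" using less.prems by (intro OK_intros)
      show "a2 \<noteq> 0" using less.prems(8) by (auto simp: a2)
      have l2: "l \<ge> 2" using prime_ge_2_int[OF l(1)] .
      have "norm a = (of_int l)\<^sup>2 * norm a2" by (simp add: a2 norm_mult norm_power)
      \<comment> \<open>A nonzero element of \<open>OK\<close> has squared absolute value a positive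
        integer, so dividing by \<open>l\<^sup>2\<close>, at least 4, lowers the floor.\<close>
      obtain m where m: "a2 * cnj a2 = of_int m" "m \<ge> 0" using a2O by (rule OK_E)
      have "(norm a2)\<^sup>2 = of_int m"
        using m(1) by (metis complex_norm_square of_real_eq_iff of_real_of_int_eq)
      then have "m \<noteq> 0" using \<open>a2 \<noteq> 0\<close> by auto
      then have "(norm a2)\<^sup>2 \<ge> 1" using m \<open>(norm a2)\<^sup>2 = of_int m\<close> by simp
      then have n1: "norm a2 \<ge> 1" by (smt (verit) norm_ge_zero power2_eq_square mult_le_one mult_left_le power_le_one_iff)
      have "norm a \<ge> norm a2 + 1"
      proof -
        have "(of_int l :: real) \<ge> 2" using l2 by simp
        then have "(of_int l :: real)\<^sup>2 \<ge> 2\<^sup>2" by (intro power_mono) auto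
        then have "(of_int l :: real)\<^sup>2 * norm a2 \<ge> 4 * norm a2" by (intro mult_right_mono) auto
        then show ?thesis unfolding \<open>norm a = (of_int l)\<^sup>2 * norm a2\<close> using n1 by linarith
      qed
      then have "\<lfloor>norm a2\<rfloor> + 1 \<le> \<lfloor>norm a\<rfloor>" by linarith
      moreover have "\<lfloor>norm a2\<rfloor> \<ge> 0" by simp
      ultimately show "nat \<lfloor>norm a2\<rfloor> < nat \<lfloor>norm a\<rfloor>" by linarith
    qed (use less.prems c1 a2O in auto)
    then obtain g where g: "g \<in> K" "a2 = g\<^sup>2 \<or> a2 = - g\<^sup>2" by blast
    then have "a = (of_int l * g)\<^sup>2 \<or> a = - (of_int l * g)\<^sup>2" by (auto simp: a2 power_mult_distrib)
    moreover have "of_int l * g \<in> K" by (intro K_intros g)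
    ultimately show ?thesis by blast
  qed
qed

end

section \<open>Integers and units of the quartic field\<close>

locale quartic = quadratic +
  fixes \<alpha> :: complex
  assumes alpha_square: "\<alpha>\<^sup>2 = s"
begin

definition F :: "complex set" where "F = adjoin K \<alpha>"

lemma F_eq: "F = {x + y * \<alpha> |x y. x \<in> K \<and> y \<in> K}"
  unfolding F_def by (rule adjoin_quadratic[OF field_K]) (simp add: alpha_square s_in_K)

lemma field_F: "field_closed F"
  unfolding F_def by (rule field_closed_adjoin)

lemmas F_intros = field_closedD[OF field_F]

lemma K_subset_F: "x \<in> K \<Longrightarrow> x \<in> F"
  unfolding F_eq by (rule CollectI, rule exI[of _ x], rule exI[of _ 0]) (simp add: K_intros(2))

lemma alpha_in_F: "\<alpha> \<in> F"
  unfolding F_eq by (rule CollectI, rule exI[of _ 0], rule exI[of _ 1]) (simp add: K_intros(1,2))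

lemma alpha_mult_alpha: "\<alpha> * \<alpha> = s" "\<alpha> * (\<alpha> * x) = s * x"
  using alpha_square by (simp_all add: power2_eq_square flip: mult.assoc)

text \<open>If \<open>\<alpha> = u + v * s\<close>, comparing coordinates of
  \<open>\<alpha>\<^sup>2 = s\<close> gives \<open>u\<^sup>2 = q * v\<^sup>2\<close> and
  \<open>2 * u * v = 1\<close>, so \<open>q\<close> would be the square of the rational number
  \<open>2 * u\<^sup>2\<close>.\<close>

lemma alpha_notin_K: "\<alpha> \<notin> K"
proof
  assume "\<alpha> \<in> K"
  then obtain u v where uv: "\<alpha> = u + v * s" "u \<in> \<rat>" "v \<in> \<rat>" by (auto simp: K_eq)
  have c: "cnj u = u" "cnj v = v" using uv cnj_Rats by auto
  have eq: "(u\<^sup>2 - of_nat q * v\<^sup>2) + (2 * u * v) * s = s"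
    using alpha_square unfolding uv(1) by (simp add: power2_eq_square algebra_simps s_mult_s)
  from arg_cong[OF this, of cnj] have "(u\<^sup>2 - of_nat q * v\<^sup>2) - (2 * u * v) * s = - s" by (simp add: c)
  moreover define D E where "D = u\<^sup>2 - of_nat q * v\<^sup>2" and "E = 2 * u * v"
  ultimately have 2: "D + E * s = s" "D - E * s = - s" using eq by simp_all
  have "2 * D = (D + E * s) + (D - E * s)" "2 * (E * s) = (D + E * s) - (D - E * s)" by simp_all
  then have "D = 0" "E = 1" unfolding 2 using s_nonzero by simp_all
  then have 1: "u\<^sup>2 = of_nat q * v\<^sup>2" "2 * u * v = 1" by (simp_all add: D_def E_def)
  then have sq: "(2 * u\<^sup>2)\<^sup>2 = of_nat q" by Groebner_Basis.algebra
  have "algebraic_int (2 * u\<^sup>2)"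
    by (rule algebraic_int_root[of "of_nat q" "monom 1 2"])
       (use sq in \<open>auto simp: poly_monom degree_monom_eq simp del: power_mult_distrib
         intro!: int_imp_algebraic_int\<close>)
  moreover have "2 * u\<^sup>2 \<in> \<rat>" using uv by auto
  ultimately have "2 * u\<^sup>2 \<in> \<int>" by (rule rational_algebraic_int_is_int)
  then obtain m where "2 * u\<^sup>2 = of_int m" by (auto elim: Ints_cases)
  then have "complex_of_int (m\<^sup>2) = of_int (int q)" using sq by simp
  then have "m\<^sup>2 = int q" unfolding of_int_eq_iff .
  then show False using prime_not_square_int[OF prime_q] by blast
qed

lemma zero_unique:
  assumes "x \<in> K" "y \<in> K" "x + y * \<alpha> = 0"
  shows "x = 0" "y = 0"
proof -
  show "y = 0"
  proof (rule ccontr)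
    assume "y \<noteq> 0"
    then have "\<alpha> = - x / y" using assms(3) by (simp add: field_simps add_eq_0_iff2)
    then show False using alpha_notin_K K_intros(5,8) assms by metis
  qed
  with assms show "x = 0" by simp
qed

lemma eq_unique:
  assumes "x \<in> K" "y \<in> K" "x' \<in> K" "y' \<in> K" "x + y * \<alpha> = x' + y' * \<alpha>"
  shows "x = x'" "y = y'"
proof -
  have "(x - x') + (y - y') * \<alpha> = 0" using assms(5) by (simp add: algebra_simps)
  from zero_unique[OF K_intros(7)[OF assms(1,3)] K_intros(7)[OF assms(2,4)] this]
  show "x = x'" "y = y'" by simp_all
qed

text \<open>The nontrivial automorphism of \<open>F\<close> over \<open>K\<close> is needed only on
  values of integer polynomials; it carries roots to roots, so conjugates of integers are
  integers.\<close>

lemma poly_conj: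
  assumes "x \<in> K" "y \<in> K"
  shows "\<exists>A\<in>K. \<exists>B\<in>K. poly (map_poly of_int p) (x + y * \<alpha>) = A + B * \<alpha> \<and>
     poly (map_poly of_int p) (x - y * \<alpha>) = A - B * \<alpha>"
proof (induction p)
  case 0
  show ?case using K_intros(2) by (intro bexI[of _ 0]) auto
next
  case (pCons c p)
  then obtain A B where AB: "A \<in> K" "B \<in> K" "poly (map_poly of_int p) (x + y * \<alpha>) = A + B * \<alpha>"
    "poly (map_poly of_int p) (x - y * \<alpha>) = A - B * \<alpha>" by blast
  have *: "poly (map_poly of_int (pCons c p)) t = of_int c + t * poly (map_poly of_int p) t" for t :: complex
    by (simp add: map_poly_pCons)
  have "poly (map_poly of_int (pCons c p)) (x + y * \<alpha>) = (of_int c + x * A + y * B * s) + (x * B + y * A) * \<alpha>"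
    "poly (map_poly of_int (pCons c p)) (x - y * \<alpha>) = (of_int c + x * A + y * B * s) - (x * B + y * A) * \<alpha>"
    unfolding * AB(3,4) by (simp_all add: algebra_simps alpha_mult_alpha)
  moreover have "of_int c + x * A + y * B * s \<in> K" "x * B + y * A \<in> K"
    by (intro K_intros assms AB s_in_K)+
  ultimately show ?case by blast
qed

lemma algebraic_int_conj:
  assumes "x \<in> K" "y \<in> K" "algebraic_int (x + y * \<alpha>)"
  shows "algebraic_int (x - y * \<alpha>)"
proof -
  obtain p where p: "poly (map_poly of_int p) (x + y * \<alpha>) = 0" "lead_coeff p = 1"
    using assms(3) by (auto simp: algebraic_int_altdef_ipoly)
  obtain A B where AB: "A \<in> K" "B \<in> K" "poly (map_poly of_int p) (x + y * \<alpha>) = A + B * \<alpha>"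
    "poly (map_poly of_int p) (x - y * \<alpha>) = A - B * \<alpha>" using poly_conj[OF assms(1,2)] by blast
  have "A = 0" "B = 0" using zero_unique[OF AB(1,2)] AB(3) p(1) by auto
  then have "poly (map_poly of_int p) (x - y * \<alpha>) = 0" using AB(4) by simp
  then show ?thesis using p(2) by (auto simp: algebraic_int_altdef_ipoly)
qed

lemma algebraic_int_OK: "z \<in> OK \<Longrightarrow> algebraic_int z"
proof -
  assume "z \<in> OK"
  then obtain U n where "z\<^sup>2 = of_int U * z - of_int n" by (rule OK_E)
  then have "poly (map_poly of_int [:n, -U, 1:]) z = 0"
    by (simp add: power2_eq_square algebra_simps map_poly_pCons)
  moreover have "lead_coeff [:n, -U, 1:] = 1" by simp
  ultimately show ?thesis unfolding algebraic_int_altdef_ipoly by blast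
qed

lemma algebraic_int_sqrt: "algebraic_int (z\<^sup>2) \<Longrightarrow> algebraic_int z" for z :: complex
  by (rule algebraic_int_root[of "z\<^sup>2" "monom 1 2"]) (auto simp: poly_monom degree_monom_eq)

lemma OK_subset_int: "z \<in> OK \<Longrightarrow> z \<in> integers_of F"
  using algebraic_int_OK OK_subset K_subset_F by (auto simp: integers_of_def)

lemma alpha_int: "\<alpha> \<in> integers_of F"
proof -
  have "algebraic_int \<alpha>" using algebraic_int_sqrt[of \<alpha>] algebraic_int_OK[OF OK_s] by (simp add: alpha_square)
  then show ?thesis by (simp add: integers_of_def alpha_in_F)
qed

end

section \<open>Integrality of relative traces and norms\<close>

locale quartic_ring = quartic +
  assumes ring_int: "ring (ring_of_integers F)"
begin

sublocale integers_ring F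
  by (rule integers_ring.intro[OF ring_int F_intros(5)])

lemma OK_iff:
  assumes "z \<in> K"
  shows "z \<in> OK \<longleftrightarrow> algebraic_int z"
proof
  show "z \<in> OK \<Longrightarrow> algebraic_int z" by (rule algebraic_int_OK)
  assume z: "algebraic_int z"
  obtain u v where uv: "z = u + v * s" "u \<in> \<rat>" "v \<in> \<rat>" using assms by (auto simp: K_eq)
  have c: "cnj z = u - v * s" using uv cnj_Rats by simp
  have zi: "z \<in> OF" "cnj z \<in> OF"
    using z assms cnj_in_K K_subset_F by (auto simp: integers_of_def)
  have "z + cnj z = 2 * u" unfolding c unfolding uv(1) by simp
  then have "z + cnj z \<in> \<rat>" using uv by (simp only:) auto
  then have "z + cnj z \<in> \<int>"
    by (rule rational_algebraic_int_is_int[OF algebraic_int_integers_of[OF int_add[OF zi]]])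
  moreover have "z * cnj z = u\<^sup>2 + of_nat q * v\<^sup>2" unfolding c unfolding uv(1) by (simp add: algebra_simps power2_eq_square s_mult_s)
  then have "z * cnj z \<in> \<rat>" using uv by (simp only:) auto
  then have "z * cnj z \<in> \<int>"
    by (rule rational_algebraic_int_is_int[OF algebraic_int_integers_of[OF int_mult[OF zi]]])
  ultimately show "z \<in> OK" using OK_trace_norm[OF assms] by (auto elim!: Ints_cases)
qed

lemma int_K: "z \<in> K \<Longrightarrow> z \<in> OF \<Longrightarrow> z \<in> OK"
  using OK_iff by (auto simp: integers_of_def)

lemma OK_sqrt: "z \<in> K \<Longrightarrow> z\<^sup>2 \<in> OK \<Longrightarrow> z \<in> OK"
  using OK_iff algebraic_int_sqrt algebraic_int_OK by blast

lemma trace_norm_OK: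
  assumes "x \<in> K" "y \<in> K" "x + y * \<alpha> \<in> OF"
  shows "2 * x \<in> OK" "x\<^sup>2 - s * y\<^sup>2 \<in> OK"
proof -
  have "x - y * \<alpha> \<in> F" by (intro F_intros K_subset_F assms alpha_in_F)
  then have c: "x - y * \<alpha> \<in> OF" using algebraic_int_conj[OF assms(1,2)] assms(3)
    by (simp add: integers_of_def)
  have "2 * x = (x + y * \<alpha>) + (x - y * \<alpha>)" by simp
  then have "2 * x \<in> OF" using int_add[OF assms(3) c] by simp
  then show "2 * x \<in> OK" by (rule int_K[rotated]) (intro K_intros assms)
  have "x\<^sup>2 - s * y\<^sup>2 = (x + y * \<alpha>) * (x - y * \<alpha>)" by (simp add: algebra_simps power2_eq_square alpha_mult_alpha)
  then have "x\<^sup>2 - s * y\<^sup>2 \<in> OF" using int_mult[OF assms(3) c] by simp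
  then show "x\<^sup>2 - s * y\<^sup>2 \<in> OK" by (rule int_K[rotated]) (intro K_intros assms s_in_K)
qed

text \<open>Multiplication by \<open>s\<close> maps the coordinates \<open>(U, V)\<close> to
  \<open>(- q * V, U)\<close>, so divisibility by \<open>s\<close> is a condition on the trace
  alone; the parities fit because \<open>q\<close> is odd.\<close>

lemma OK_divide_s:
  assumes "z \<in> OK" "2 * z = of_int U + of_int V * s" "int q dvd U"
  shows "z / s \<in> OK"
proof -
  obtain U' where U': "U = int q * U'" using assms(3) by auto
  obtain A B where AB: "even (A - B)" "2 * z = of_int A + of_int B * s" using assms(1) by (rule OK_E)
  have "U = A" "V = B" using linear_unique[of U V A B] assms(2) AB(2) by auto
  then have "even (V - (- U'))" using AB(1) odd_q unfolding U' by auto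
  moreover have "2 * z = (of_int V + of_int (- U') * s) * s"
    unfolding assms(2) U' by (simp add: algebra_simps s_mult_s)
  then have "2 * (z / s) = of_int V + of_int (- U') * s"
    using s_nonzero by (simp add: times_divide_eq_right)
  ultimately show ?thesis by (rule OK_I)
qed

text \<open>\<open>s\<close> generates a prime, and a denominator \<open>s\<close> in
  \<open>y\<close> would survive in \<open>s * y\<^sup>2\<close>. At first only \<open>s * y\<close>
  is integral; its trace \<open>A\<close> turns out to be divisible by \<open>q\<close>.\<close>

lemma OK_half_y:
  assumes "y \<in> K" "s * y\<^sup>2 \<in> OK"
  shows "y \<in> OK"
proof -
  have "(s * y)\<^sup>2 = s * (s * y\<^sup>2)" by (simp add: power2_eq_square)
  also have "\<dots> \<in> OK" by (intro OK_intros assms)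
  finally have w: "s * y \<in> OK" by (rule OK_sqrt[rotated]) (intro K_intros assms s_in_K)
  obtain A B where AB: "2 * (s * y) = of_int A + of_int B * s" using w by (rule OK_E)
  obtain C D where CD: "2 * (s * y\<^sup>2) = of_int C + of_int D * s" using assms(2) by (rule OK_E)
  have "of_int (A\<^sup>2 - int q * B\<^sup>2) + of_int (2 * A * B) * s = (2 * (s * y))\<^sup>2"
    unfolding AB by (simp add: power2_eq_square algebra_simps s_mult_s)
  also have "\<dots> = 2 * s * (2 * (s * y\<^sup>2))" by (simp add: power2_eq_square)
  also have "\<dots> = of_int (- (2 * int q * D)) + of_int (2 * C) * s"
    unfolding CD by (simp add: algebra_simps s_mult_s)
  finally have "A\<^sup>2 - int q * B\<^sup>2 = - (2 * int q * D)" by (rule linear_unique)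
  then have "A\<^sup>2 = int q * (B\<^sup>2 - 2 * D)" by (simp add: algebra_simps)
  then have "int q dvd A\<^sup>2" by simp
  then have "int q dvd A" using prime_dvd_power[of "int q" A 2] prime_q by simp
  from OK_divide_s[OF w AB this] show ?thesis using s_nonzero by simp
qed

text \<open>As \<open>(q - 1) / 2\<close> is odd, raising \<open>U\<^sup>2 \<equiv> - 16\<close> to
  this power contradicts Fermat: -1 is not a square modulo \<open>q\<close>. The 16 is 1 after
  clearing the denominator 4.\<close>

lemma no_square_plus_16: "\<not> int q dvd U\<^sup>2 + 16"
proof
  assume d: "int q dvd U\<^sup>2 + 16"
  have p: "Factorial_Ring.prime (int q)" using prime_q by simp
  have "q \<noteq> 2" using q_mod_4 by auto
  have nd2: "\<not> int q dvd 2"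
    using primes_dvd_imp_eq[of "int q" 2] p \<open>q \<noteq> 2\<close> by auto
  have nU: "\<not> int q dvd U"
  proof
    assume "int q dvd U"
    then have "int q dvd U\<^sup>2" by (simp add: power2_eq_square)
    with d have "int q dvd 2 ^ 4" by (simp add: dvd_add_right_iff)
    then show False using prime_dvd_power[OF p] nd2 by blast
  qed
  have n4: "\<not> int q dvd 4" using prime_dvd_power[OF p, of 2 2] nd2 by auto
  define k where "k = (q - 1) div 2"
  have k: "q - 1 = 2 * k" "odd k" using q_mod_4 unfolding k_def by presburger+
  have f: "[a ^ (q - 1) = 1] (mod int q)" if "\<not> int q dvd a" for a :: int
  proof -
    have "\<not> q dvd nat \<bar>a\<bar>" using that by (simp add: nat_abs_dvd_iff flip: int_dvd_int_iff)
    then have "[nat \<bar>a\<bar> ^ (q - 1) = 1] (mod q)" by (rule fermat_theorem[OF prime_q])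
    then have "[int (nat \<bar>a\<bar> ^ (q - 1)) = int 1] (mod int q)" by (simp only: cong_int_iff)
    then show ?thesis using k by (simp add: power_mult)
  qed
  have "[U\<^sup>2 = - 16] (mod int q)" using d by (simp add: cong_iff_dvd_diff)
  then have "[(U\<^sup>2) ^ k = (- 16) ^ k] (mod int q)" by (rule cong_pow)
  also have "(- 16 :: int) ^ k = - (4 ^ (q - 1))" using k by (simp add: power_mult power_minus_odd)
  finally have "[U ^ (q - 1) = - (4 ^ (q - 1))] (mod int q)" using k by (simp add: power_mult)
  moreover have "[- (4 ^ (q - 1)) = - (1::int)] (mod int q)" using f[OF n4] by (simp add: cong_minus_minus_iff)
  ultimately have "[1 = (-1 :: int)] (mod int q)" using f[OF nU] by (meson cong_sym cong_trans)
  then show False using nd2 by (simp add: cong_iff_dvd_diff)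
qed

text \<open>Modulo \<open>s\<close> the equation says that -1 is a square. The coordinates of
  \<open>2 * x\<close> may be half-integers, so it is multiplied by 16 to become one between
  integers.\<close>

lemma norm_not_minus_one:
  assumes "x \<in> K" "y \<in> K" "2 * x \<in> OK"
  shows "x\<^sup>2 - s * y\<^sup>2 \<noteq> -1"
proof
  assume eq: "x\<^sup>2 - s * y\<^sup>2 = -1"
  have "s * (2 * y)\<^sup>2 = (2 * x)\<^sup>2 + 4" using eq by Groebner_Basis.algebra
  also have "\<dots> \<in> OK" by (intro OK_intros assms)
  finally have "2 * y \<in> OK" by (rule OK_half_y[rotated]) (intro K_intros assms)
  then obtain C D where CD: "2 * (2 * y) = of_int C + of_int D * s" by (rule OK_E)
  obtain U V where UV: "2 * (2 * x) = of_int U + of_int V * s" using assms(3) by (rule OK_E)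
  have "of_int (U\<^sup>2 - int q * V\<^sup>2 + 16) + of_int (2 * U * V) * s = (2 * (2 * x))\<^sup>2 + 16"
    unfolding UV by (simp add: power2_eq_square algebra_simps s_mult_s)
  also have "\<dots> = s * (2 * (2 * y))\<^sup>2" using eq by Groebner_Basis.algebra
  also have "\<dots> = of_int (- (2 * int q * C * D)) + of_int (C\<^sup>2 - int q * D\<^sup>2) * s"
    unfolding CD by (simp add: power2_eq_square algebra_simps s_mult_s)
  finally have "U\<^sup>2 - int q * V\<^sup>2 + 16 = - (2 * int q * C * D)" by (rule linear_unique)
  then have "U\<^sup>2 + 16 = int q * (V\<^sup>2 - 2 * C * D)" by (simp add: algebra_simps)
  then show False using no_square_plus_16 by (metis dvd_triv_left)
qed

text \<open>The relative norms of the unit and of its inverse are integers of \<open>K\<close> with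
  product 1; their absolute norms are nonnegative integers with product 1.\<close>

lemma unit_norm:
  assumes "x \<in> K" "y \<in> K" "x + y * \<alpha> \<in> OF" "inverse (x + y * \<alpha>) \<in> OF" "x + y * \<alpha> \<noteq> 0"
  shows "(x\<^sup>2 - s * y\<^sup>2) * cnj (x\<^sup>2 - s * y\<^sup>2) = 1"
proof -
  have "inverse (x + y * \<alpha>) \<in> F" using assms(4) by (simp add: integers_of_def)
  then obtain x' y' where xy: "inverse (x + y * \<alpha>) = x' + y' * \<alpha>" "x' \<in> K" "y' \<in> K" by (auto simp: F_eq)
  have "(x + y * \<alpha>) * (x' + y' * \<alpha>) = 1" using assms(5) by (simp flip: xy(1))
  then have "(x * x' + s * y * y') + (x * y' + x' * y) * \<alpha> = 1 + 0 * \<alpha>"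
    by (simp add: algebra_simps alpha_mult_alpha)
  moreover have cl: "x * x' + s * y * y' \<in> K" "x * y' + x' * y \<in> K"
    by (intro K_intros assms xy s_in_K)+
  ultimately have 1: "x * x' + s * y * y' = 1" "x * y' + x' * y = 0"
    using eq_unique[of "x * x' + s * y * y'" "x * y' + x' * y" 1 0] cl K_intros(1,2) by blast+
  define N N' where "N = x\<^sup>2 - s * y\<^sup>2" and "N' = x'\<^sup>2 - s * y'\<^sup>2"
  have "N * N' = (x * x' + s * y * y')\<^sup>2 - s * (x * y' + x' * y)\<^sup>2"
    by (simp add: N_def N'_def algebra_simps power2_eq_square)
  then have NN: "N * N' = 1" unfolding 1 by simp
  have "N \<in> OK" unfolding N_def by (rule trace_norm_OK(2)[OF assms(1,2,3)])
  then obtain n where n: "N * cnj N = of_int n" "n \<ge> 0" by (rule OK_E)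
  have "N' \<in> OK" unfolding N'_def by (rule trace_norm_OK(2)[OF xy(2,3)]) (use assms(4) xy in simp)
  then obtain n' where n': "N' * cnj N' = of_int n'" "n' \<ge> 0" by (rule OK_E)
  have "(N * cnj N) * (N' * cnj N') = (N * N') * cnj (N * N')" by simp
  then have "complex_of_int (n * n') = of_int 1" unfolding NN n n' by simp
  then have "n * n' = 1" unfolding of_int_eq_iff .
  then have "n = 1" using n n' by (metis pos_zmult_eq_1_iff less_le mult_zero_left zero_neq_one)
  then show ?thesis using n(1) unfolding N_def by simp
qed

text \<open>The equation \<open>U\<^sup>2 + q * V\<^sup>2 = 4\<close> forces \<open>V = 0\<close>
  once \<open>q\<close> is at least 7; for \<open>q = 3\<close> it also has the solutions given by
  the primitive third and sixth roots of unity.\<close>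

lemma norm_one_cases:
  assumes "N \<in> OK" "N * cnj N = 1" "q \<noteq> 3"
  shows "N = 1 \<or> N = -1"
proof -
  obtain U V n where UV: "2 * N = of_int U + of_int V * s" "N * cnj N = of_int n" "U\<^sup>2 + int q * V\<^sup>2 = 4 * n"
    using assms(1) by (rule OK_E)
  have "n = 1" using UV(2) assms(2) by (metis of_int_eq_1_iff)
  then have eq: "U\<^sup>2 + int q * V\<^sup>2 = 4" using UV(3) by simp
  have "q \<ge> 7" using q_mod_4 assms(3) by presburger
  have "V = 0"
  proof (rule ccontr)
    assume "V \<noteq> 0"
    then have "V\<^sup>2 \<ge> 1" by (simp add: int_one_le_iff_zero_less)
    then have "int q * V\<^sup>2 \<ge> 7 * 1" using \<open>q \<ge> 7\<close> by (intro mult_mono) auto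
    then show False using eq by (smt (verit) zero_le_power2)
  qed
  then have "U\<^sup>2 = 2\<^sup>2" using eq by simp
  then have "U = 2 \<or> U = -2" using power2_eq_iff[of U 2] by simp
  then show ?thesis using UV(1) \<open>V = 0\<close> by auto
qed

lemma unit_quadratic:
  assumes "x\<^sup>2 - s * y\<^sup>2 = 1"
  shows "(x + y * \<alpha>)\<^sup>2 = 2 * x * (x + y * \<alpha>) - 1"
  using assms alpha_square by Groebner_Basis.algebra

theorem unit_square:
  assumes x: "x \<in> OK" "(x - 1) / 2 \<in> OK" and y: "y \<in> K" and norm: "x\<^sup>2 - s * y\<^sup>2 = 1"
  shows "\<exists>g\<in>F. x + y * \<alpha> = g\<^sup>2 \<or> x + y * \<alpha> = - g\<^sup>2"
proof -
  define \<epsilon> where "\<epsilon> = x + y * \<alpha>"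
  have \<epsilon>F: "\<epsilon> \<in> F" unfolding \<epsilon>_def by (intro F_intros K_subset_F OK_subset x y alpha_in_F)
  define b where "b = (x - 1) / 2"
  define a where "a = b + 1"
  define c where "c = y / 2"
  have bO: "b \<in> OK" unfolding b_def by (rule x)
  have aO: "a \<in> OK" unfolding a_def by (intro OK_intros bO)
  have xa: "x = 2 * a - 1" "x = 2 * b + 1" by (simp_all add: a_def b_def)
  have ab: "a * b = s * c\<^sup>2"
  proof -
    have "4 * (a * b) = x\<^sup>2 - 1" by (simp add: a_def b_def power2_eq_square field_simps)
    also have "\<dots> = s * y\<^sup>2" using norm by Groebner_Basis.algebra
    also have "\<dots> = 4 * (s * c\<^sup>2)" by (simp add: c_def power2_eq_square)
    finally show ?thesis by simp
  qed
  have cK: "c \<in> K" unfolding c_def by (intro K_intros y)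
  have "s * c\<^sup>2 \<in> OK" unfolding ab[symmetric] by (intro OK_intros aO bO)
  then have cO: "c \<in> OK" by (rule OK_half_y[OF cK])
  show ?thesis
  proof (cases "a = 0")
    case True
    then have "c = 0" using ab s_nonzero by simp
    then have "x + y * \<alpha> = - 1\<^sup>2" using True by (simp add: xa(1) c_def)
    then show ?thesis using F_intros(1) by blast
  next
    case False
    obtain na where na: "a * cnj a = of_int na" using aO by (rule OK_E)
    obtain nb where nb: "b * cnj b = of_int nb" using bO by (rule OK_E)
    obtain nc where nc: "c * cnj c = of_int nc" using cO by (rule OK_E)
    have "(a * cnj a) * (b * cnj b) = (a * b) * cnj (a * b)" by simp
    also have "\<dots> = of_nat q * (c * cnj c)\<^sup>2" unfolding ab by (simp add: power2_eq_square algebra_simps s_mult_s)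
    finally have "complex_of_int (na * nb) = of_int (int q * nc\<^sup>2)" unfolding na nb nc by simp
    then have "na * nb = int q * nc\<^sup>2" unfolding of_int_eq_iff .
    then have "int q dvd na * nb" by simp
    \<comment> \<open>The factor \<open>s\<close> of \<open>a * b = s * c\<^sup>2\<close> has to be
      moved into one of the two coprime factors; the norms tell which.\<close>
    then have disj: "int q dvd na \<or> int q dvd nb" using prime_q prime_dvd_mult_iff[of "int q"] by auto
    have div_s: "z / s \<in> OK" if z: "z \<in> OK" "z * cnj z = of_int n" "int q dvd n" for z n
    proof -
      obtain U V m where UV: "2 * z = of_int U + of_int V * s" "z * cnj z = of_int m" "U\<^sup>2 + int q * V\<^sup>2 = 4 * m"
        using z(1) by (rule OK_E)
      have "m = n" using UV(2) z(2) by simp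
      then have "U\<^sup>2 = 4 * n - int q * V\<^sup>2" using UV(3) by simp
      then have "int q dvd U\<^sup>2" using z(3) by simp
      then have "int q dvd U" using prime_dvd_power[of "int q" U 2] prime_q by simp
      then show ?thesis by (rule OK_divide_s[OF z(1) UV(1)])
    qed
    have "\<exists>g\<in>F. a = g\<^sup>2 \<or> a = - g\<^sup>2"
      using disj
    proof
      assume "int q dvd nb"
      then have bs: "b / s \<in> OK" by (rule div_s[OF bO nb])
      have "\<exists>g\<in>K. a = g\<^sup>2 \<or> a = - g\<^sup>2"
      proof (rule square_if_coprime_product_square[OF aO bs cO])
        show "1 * a + (- s) * (b / s) = 1" using s_nonzero by (simp add: a_def)
        show "a * (b / s) = c\<^sup>2" using ab s_nonzero by (simp add: field_simps)
      qed (use False OK_intros in auto)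
      then show ?thesis using K_subset_F by blast
    next
      assume "int q dvd na"
      then have as: "a / s \<in> OK" by (rule div_s[OF aO na])
      have "\<exists>g\<in>K. a / s = g\<^sup>2 \<or> a / s = - g\<^sup>2"
      proof (rule square_if_coprime_product_square[OF as bO cO])
        show "s * (a / s) + (- 1) * b = 1" using s_nonzero by (simp add: a_def)
        show "a / s * b = c\<^sup>2" using ab s_nonzero by (simp add: field_simps)
      qed (use False OK_intros s_nonzero in auto)
      then obtain g where g: "g \<in> K" "a / s = g\<^sup>2 \<or> a / s = - g\<^sup>2" by blast
      then have "a = (\<alpha> * g)\<^sup>2 \<or> a = - (\<alpha> * g)\<^sup>2" using s_nonzero
        by (auto simp: power_mult_distrib alpha_square field_simps)
      moreover have "\<alpha> * g \<in> F" by (intro F_intros alpha_in_F K_subset_F g)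
      ultimately show ?thesis by blast
    qed
    then obtain g where g: "g \<in> F" "a = g\<^sup>2 \<or> a = - g\<^sup>2" by blast
    have g0: "g \<noteq> 0" using g False by auto
    have "(1 + \<epsilon>)\<^sup>2 = 1 + 2 * \<epsilon> + \<epsilon>\<^sup>2" by (simp add: power2_eq_square algebra_simps)
    also have "\<dots> = 4 * a * \<epsilon>" unfolding \<epsilon>_def unit_quadratic[OF norm] by (simp add: xa(1) algebra_simps)
    finally have \<epsilon>a: "(1 + \<epsilon>)\<^sup>2 = 4 * a * \<epsilon>" .
    have "\<epsilon> = ((1 + \<epsilon>) / (2 * g))\<^sup>2 \<or> \<epsilon> = - ((1 + \<epsilon>) / (2 * g))\<^sup>2"
      using g(2) g0 unfolding power_divide \<epsilon>a by (auto simp: power_mult_distrib)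
    moreover have "(1 + \<epsilon>) / (2 * g) \<in> F" by (intro F_intros \<epsilon>F g)
    ultimately show ?thesis unfolding \<epsilon>_def by blast
  qed
qed

end

section \<open>A unit of infinite order\<close>

context quartic
begin

text \<open>An element of the order \<open>\<int>[s]\<close>, whose coordinates are the real part
  and a multiple of the imaginary part. One unit of infinite order is enough, so the full
  \<open>OK\<close> is avoided.\<close>

definition lat :: "int \<Rightarrow> int \<Rightarrow> complex" where "lat a b = of_int a + of_int b * s"

lemma lat_OK: "lat a b \<in> OK"
  unfolding lat_def by (intro OK_intros)

lemma Re_lat [simp]: "Re (lat a b) = of_int a" and Im_lat [simp]: "Im (lat a b) = of_int b * Im s"
  by (simp_all add: lat_def Re_s)

lemma lat_diff: "lat a b - lat c d = lat (a - c) (b - d)"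
  and lat_scale: "of_int m * lat a b = lat (m * a) (m * b)"
  by (simp_all add: lat_def algebra_simps)

lemma lat_norm_form: "(lat a b)\<^sup>2 - s * (lat c d)\<^sup>2 =
    lat (a\<^sup>2 - int q * b\<^sup>2 + 2 * int q * c * d) (2 * a * b - c\<^sup>2 + int q * d\<^sup>2)"
  by (simp add: lat_def power2_eq_square algebra_simps s_mult_s)

text \<open>Dirichlet's pigeonhole argument, with the unit square replaced by a fundamental parallelogram of \<open>\<int>[s]\<close>.\<close>

lemma approximation:
  assumes N: "N > 0"
  shows "\<exists>a b c d. (c, d) \<noteq> (0, 0) \<and> \<bar>c\<bar> \<le> int N \<and> \<bar>d\<bar> \<le> int N \<and>
    norm (lat a b - lat c d * \<alpha>) \<le> (1 + norm s) / real N"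
proof -
  define p where "p = (\<lambda>(c, d). Re (lat c d * \<alpha>))"
  define r where "r = (\<lambda>(c, d). Im (lat c d * \<alpha>) / Im s)"
  \<comment> \<open>\<open>p\<close> and \<open>r\<close> are the coordinates of
    \<open>lat c d * \<alpha>\<close> in the real basis 1, \<open>s\<close>. There are
    \<open>(N + 1)\<^sup>2\<close> pairs for \<open>N\<^sup>2\<close> cells.\<close>
  define cell where "cell z = (\<lfloor>real N * frac (p z)\<rfloor>, \<lfloor>real N * frac (r z)\<rfloor>)" for z
  define A where "A = {0..int N} \<times> {0..int N}"
  have cell_range: "\<lfloor>real N * frac t\<rfloor> \<in> {0..<int N}" for t :: real
  proof -
    have "real N * frac t < real N * 1" using N by (intro mult_strict_left_mono frac_lt_1) auto
    then show ?thesis by (simp add: floor_less_iff frac_ge_0)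
  qed
  have sub: "cell ` A \<subseteq> {0..<int N} \<times> {0..<int N}"
    unfolding cell_def using cell_range by auto
  have "card (cell ` A) \<le> card ({0..<int N} \<times> {0..<int N})" by (rule card_mono[OF _ sub]) simp
  also have "\<dots> = N * N" by (simp add: card_cartesian_product)
  also have "\<dots> < card A" by (simp add: A_def card_cartesian_product nat_add_distrib)
  finally have "\<not> inj_on cell A" by (rule pigeonhole)
  then obtain z z' where z: "z \<in> A" "z' \<in> A" "cell z = cell z'" "z \<noteq> z'" unfolding inj_on_def by blast
  obtain c d c' d' where cd: "z = (c, d)" "z' = (c', d')" by (cases z, cases z') auto
  have close: "\<bar>frac t - frac t'\<bar> \<le> 1 / real N" if "\<lfloor>real N * frac t\<rfloor> = \<lfloor>real N * frac t'\<rfloor>" for t t' :: real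
  proof -
    have "\<bar>real N * frac t - real N * frac t'\<bar> \<le> 1" using that by linarith
    then have "real N * \<bar>frac t - frac t'\<bar> \<le> 1" using N by (simp add: abs_mult flip: right_diff_distrib)
    then show ?thesis using N by (simp add: field_simps)
  qed
  define P R where "P = frac (p z) - frac (p z')" and "R = frac (r z) - frac (r z')"
  have PR: "\<bar>P\<bar> \<le> 1 / real N" "\<bar>R\<bar> \<le> 1 / real N"
    unfolding P_def R_def using z(3) by (auto simp: cell_def intro: close)
  define a b where "a = \<lfloor>p z\<rfloor> - \<lfloor>p z'\<rfloor>" and "b = \<lfloor>r z\<rfloor> - \<lfloor>r z'\<rfloor>"
  have "lat (c - c') (d - d') * \<alpha> - lat a b = of_real P + of_real R * s"
  proof (rule complex_eqI)
    have Rs: "Re (of_real R * s) = 0" "Im (of_real R * s) = R * Im s" by (simp_all add: Re_s)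
    have "Re (lat (c - c') (d - d') * \<alpha>) = p z - p z'"
      unfolding p_def cd lat_diff[symmetric] by (simp add: algebra_simps)
    then show "Re (lat (c - c') (d - d') * \<alpha> - lat a b) = Re (of_real P + of_real R * s)"
      by (simp add: P_def a_def frac_def Rs del: times_complex.sel)
    have "Im (lat (c - c') (d - d') * \<alpha>) = (r z - r z') * Im s"
      unfolding r_def cd lat_diff[symmetric] using Im_s by (simp add: algebra_simps)
    then have "Im (lat (c - c') (d - d') * \<alpha> - lat a b) = R * Im s"
      by (simp add: R_def b_def frac_def algebra_simps del: times_complex.sel)
    then show "Im (lat (c - c') (d - d') * \<alpha> - lat a b) = Im (of_real P + of_real R * s)"
      by (simp add: Rs del: times_complex.sel)
  qed
  then have "norm (lat a b - lat (c - c') (d - d') * \<alpha>) = norm (of_real P + of_real R * s)"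
    by (metis norm_minus_commute)
  also have "\<dots> \<le> \<bar>P\<bar> + \<bar>R\<bar> * norm s" by (rule norm_triangle_le) (simp add: norm_mult)
  also have "\<dots> \<le> 1 / real N + 1 / real N * norm s" using PR by (intro add_mono mult_right_mono) auto
  also have "\<dots> = (1 + norm s) / real N" by (simp add: add_divide_distrib)
  finally have "norm (lat a b - lat (c - c') (d - d') * \<alpha>) \<le> (1 + norm s) / real N" .
  moreover have "(c - c', d - d') \<noteq> (0, 0)" using z(4) cd by auto
  moreover have "\<bar>c - c'\<bar> \<le> int N" "\<bar>d - d'\<bar> \<le> int N" using z(1,2) cd by (auto simp: A_def)
  ultimately show ?thesis by blast
qed

definition lin :: "int \<times> int \<times> int \<times> int \<Rightarrow> complex" where
  "lin = (\<lambda>(a, b, c, d). lat a b - lat c d * \<alpha>)"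

definition form :: "int \<times> int \<times> int \<times> int \<Rightarrow> complex" where
  "form = (\<lambda>(a, b, c, d). (lat a b)\<^sup>2 - s * (lat c d)\<^sup>2)"

lemma form_eq_lin: "form (a, b, c, d) = lin (a, b, c, d) * (lat a b + lat c d * \<alpha>)"
  by (simp add: form_def lin_def algebra_simps power2_eq_square alpha_mult_alpha)

lemma lat_K: "lat a b \<in> K" by (rule OK_subset[OF lat_OK])

lemma lat_eq_0: "lat a b = 0 \<Longrightarrow> a = 0 \<and> b = 0"
  using linear_unique[of a b 0 0] by (simp add: lat_def)

text \<open>The value of \<open>lin\<close> is at most a constant over \<open>N\<close>, while its
  conjugate factor grows at most like \<open>N\<close>; hence the product \<open>form\<close> is
  bounded independently of \<open>N\<close>. The values are nonzero because \<open>\<alpha>\<close>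
  is outside \<open>K\<close>.\<close>

lemma small_values:
  "\<exists>D. \<forall>\<epsilon>>0. \<exists>t. lin t \<noteq> 0 \<and> norm (lin t) < \<epsilon> \<and> norm (form t) \<le> D"
proof -
  define C where "C = 1 + norm s"
  have C: "C > 0" unfolding C_def by (smt (verit) norm_ge_zero)
  show ?thesis
  proof (intro exI[of _ "C * (C + 2 * C * norm \<alpha>)"] allI impI)
    fix \<epsilon> :: real assume "\<epsilon> > 0"
    obtain N where N: "N > 0" "C / real N < \<epsilon>"
    proof -
      obtain n where n: "C / \<epsilon> < real n" using reals_Archimedean2 by blast
      moreover have "C / \<epsilon> > 0" using C \<open>\<epsilon> > 0\<close> by simp
      ultimately have "n > 0" by (metis of_nat_0_less_iff less_trans)
      moreover have "C / real n < \<epsilon>" using n \<open>n > 0\<close> \<open>\<epsilon> > 0\<close> by (simp add: field_simps)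
      ultimately show ?thesis using that by blast
    qed
    obtain a b c d where ab: "(c, d) \<noteq> (0, 0)" "\<bar>c\<bar> \<le> int N" "\<bar>d\<bar> \<le> int N"
      "norm (lat a b - lat c d * \<alpha>) \<le> C / real N" using approximation[OF N(1)] unfolding C_def by blast
    define z where "z = lat a b - lat c d * \<alpha>"
    have z: "norm z \<le> C / real N" using ab unfolding z_def by simp
    have "lat a b + (- lat c d) * \<alpha> \<noteq> 0"
      using zero_unique(2)[OF lat_K, of "- lat c d" a b] K_intros(5)[OF lat_K] lat_eq_0[of c d] ab(1) by auto
    then have "z \<noteq> 0" unfolding z_def by simp
    have cC: "norm (lat c d) \<le> real N * C"
    proof -
      have "norm (lat c d) \<le> \<bar>of_int c\<bar> + \<bar>of_int d\<bar> * norm s"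
        unfolding lat_def by (rule norm_triangle_le) (simp add: norm_mult)
      also have "\<dots> \<le> real N + real N * norm s" 
      proof (intro add_mono mult_right_mono)
        show "\<bar>of_int c\<bar> \<le> real N" "\<bar>of_int d\<bar> \<le> real N" using ab(2,3) by linarith+
      qed auto
      finally show ?thesis by (simp add: C_def algebra_simps)
    qed
    have "lat a b + lat c d * \<alpha> = z + 2 * (lat c d * \<alpha>)" by (simp add: z_def)
    then have "norm (lat a b + lat c d * \<alpha>) \<le> norm z + 2 * (norm (lat c d) * norm \<alpha>)"
      by (metis norm_mult norm_numeral norm_triangle_ineq)
    also have "\<dots> \<le> C + 2 * (real N * C * norm \<alpha>)"
    proof (intro add_mono mult_left_mono mult_right_mono)
      have "C / real N \<le> C" using N C by (simp add: field_simps)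
      then show "norm z \<le> C" using z by simp
    qed (use cC in auto)
    also have "\<dots> \<le> real N * (C + 2 * C * norm \<alpha>)" using N C by (simp add: algebra_simps)
    finally have w: "norm (lat a b + lat c d * \<alpha>) \<le> real N * (C + 2 * C * norm \<alpha>)" .
    have "norm (form (a, b, c, d)) = norm z * norm (lat a b + lat c d * \<alpha>)"
      unfolding form_eq_lin norm_mult by (simp add: lin_def z_def)
    also have "\<dots> \<le> (C / real N) * (real N * (C + 2 * C * norm \<alpha>))"
      using z w C by (intro mult_mono) auto
    also have "\<dots> = C * (C + 2 * C * norm \<alpha>)" using N by simp
    finally show "\<exists>t. lin t \<noteq> 0 \<and> norm (lin t) < \<epsilon> \<and> norm (form t) \<le> C * (C + 2 * C * norm \<alpha>)"
      using z N \<open>z \<noteq> 0\<close> by (intro exI[of _ "(a, b, c, d)"]) (auto simp: lin_def z_def)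
  qed
qed

text \<open>The quotient is \<open>(x - y * \<alpha>) * (x' + y' * \<alpha>) / n\<close>. By the
  congruence its numerator agrees modulo \<open>n\<close> with
  \<open>(x - y * \<alpha>) * (x + y * \<alpha>) = n\<close>.\<close>

lemma quotient_integral:
  assumes n: "x\<^sup>2 - s * y\<^sup>2 = n" "x'\<^sup>2 - s * y'\<^sup>2 = n" "n \<noteq> 0"
    and O: "x \<in> OK" "y \<in> OK" "u \<in> OK" "v \<in> OK"
    and cong: "x' = x + n * cnj n * u" "y' = y + n * cnj n * v"
  shows "\<exists>A\<in>OK. \<exists>B\<in>OK. (x - y * \<alpha>) / (x' - y' * \<alpha>) = A + B * \<alpha>"
proof -
  have nO: "n \<in> OK" unfolding n(1)[symmetric] by (intro OK_intros O)
  define A B where "A = 1 + cnj n * (x * u - s * y * v)" and "B = cnj n * (x * v - u * y)"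
  have AB: "A \<in> OK" "B \<in> OK" unfolding A_def B_def by (intro OK_intros nO O)+
  have nn: "n = (x' - y' * \<alpha>) * (x' + y' * \<alpha>)" 
    unfolding n(2)[symmetric] by (simp add: algebra_simps power2_eq_square alpha_mult_alpha)
  then have nz: "x' - y' * \<alpha> \<noteq> 0" using n(3) by auto
  have "n * (A + B * \<alpha>) = (x - y * \<alpha>) * (x' + y' * \<alpha>)"
  proof -
    have "(x - y * \<alpha>) * (x + y * \<alpha>) = n"
      unfolding n(1)[symmetric] by (simp add: algebra_simps power2_eq_square alpha_mult_alpha)
    then have "n * (A + B * \<alpha>) = (x - y * \<alpha>) * (x + y * \<alpha>) + n * cnj n * ((x - y * \<alpha>) * (u + v * \<alpha>))"
      unfolding A_def B_def by (simp add: algebra_simps alpha_mult_alpha)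
    then show ?thesis unfolding cong by (simp add: algebra_simps)
  qed
  then have "(x' + y' * \<alpha>) * ((x' - y' * \<alpha>) * (A + B * \<alpha>)) = (x' + y' * \<alpha>) * (x - y * \<alpha>)"
    unfolding nn by (simp add: mult_ac)
  moreover have "x' + y' * \<alpha> \<noteq> 0" using nn n(3) by auto
  ultimately have "(x' - y' * \<alpha>) * (A + B * \<alpha>) = x - y * \<alpha>" by simp
  then have "(x - y * \<alpha>) / (x' - y' * \<alpha>) = A + B * \<alpha>" using nz by (simp add: field_simps)
  with AB show ?thesis by blast
qed

lemma exists_unit_coordinates:
  "\<exists>\<epsilon> A B A' B'. A \<in> OK \<and> B \<in> OK \<and> A' \<in> OK \<and> B' \<in> OK \<and> \<epsilon> = A + B * \<alpha> \<and> inverse \<epsilon> = A' + B' * \<alpha> \<and>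
     \<epsilon> \<noteq> 0 \<and> norm \<epsilon> \<noteq> 1"
proof -
  obtain D where D: "\<And>\<epsilon>. \<epsilon> > 0 \<Longrightarrow> \<exists>t. lin t \<noteq> 0 \<and> norm (lin t) < \<epsilon> \<and> norm (form t) \<le> D"
    using small_values by blast
  define T where "T = {t. lin t \<noteq> 0 \<and> norm (form t) \<le> D}"
  \<comment> \<open>The pigeonhole is applied to absolute values and not to tuples: two different
    ones give a quotient whose absolute value is not 1.\<close>
  define S where "S = (\<lambda>t. norm (lin t)) ` T"
  have "infinite S"
  proof
    assume fin: "finite S"
    obtain t where "lin t \<noteq> 0" "norm (form t) \<le> D" using D[of 1] by auto
    then have "S \<noteq> {}" unfolding S_def T_def by blast
    then have "Min S \<in> S" using fin by simp
    then have "Min S > 0" by (auto simp: S_def T_def)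
    then obtain t where t: "lin t \<noteq> 0" "norm (lin t) < Min S" "norm (form t) \<le> D" using D by blast
    then have "norm (lin t) \<in> S" by (auto simp: S_def T_def)
    then show False using Min_le[OF fin] t by fastforce
  qed
  define t where "t r = (SOME t. t \<in> T \<and> norm (lin t) = r)" for r
  have t: "t r \<in> T \<and> norm (lin (t r)) = r" if "r \<in> S" for r
  proof -
    from that obtain u where u: "u \<in> T" "norm (lin u) = r" unfolding S_def by blast
    show ?thesis unfolding t_def by (rule someI[of _ u]) (use u in blast)
  qed
  define n1 where "n1 = (\<lambda>(a, b, c, d). a\<^sup>2 - int q * b\<^sup>2 + 2 * int q * c * d)"
  define n2 where "n2 = (\<lambda>(a, b, c, d). 2 * a * b - c\<^sup>2 + int q * d\<^sup>2)"
  have form_n: "form t = lat (n1 t) (n2 t)" for t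
    by (cases t) (simp add: form_def n1_def n2_def lat_norm_form)
  define M where "M t = (n1 t)\<^sup>2 + int q * (n2 t)\<^sup>2" for t
  have form_M: "form t * cnj (form t) = of_int (M t)" for t
    unfolding form_n M_def lat_def by (simp add: algebra_simps power2_eq_square s_mult_s)
  have M0: "M t > 0" if "t \<in> T" for t
  proof -
    obtain a b c d where abcd: "t = (a, b, c, d)" by (cases t)
    have "lat a b + (- lat c d) * \<alpha> \<noteq> 0" using that by (simp add: abcd T_def lin_def)
    then have "lat a b + lat c d * \<alpha> \<noteq> 0"
      using zero_unique[OF lat_K lat_K, of a b c d] by auto
    then have "form t \<noteq> 0" using that unfolding abcd form_eq_lin by (simp add: T_def)
    then have "M t \<noteq> 0" using form_M[of t] by auto
    moreover have "M t \<ge> 0" unfolding M_def by simp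
    ultimately show ?thesis by simp
  qed
  define E where "E = \<lceil>D + D / \<bar>Im s\<bar> + D\<^sup>2\<rceil>"
  have D0: "D \<ge> 0" using D[of 1] norm_ge_zero order_trans by (metis zero_less_one)
  have bounds: "\<bar>n1 t\<bar> \<le> E" "\<bar>n2 t\<bar> \<le> E" "M t \<le> E" if "t \<in> T" for t
  proof -
    have f: "norm (form t) \<le> D" using that by (simp add: T_def)
    have E: "D + D / \<bar>Im s\<bar> + D\<^sup>2 \<le> of_int E" unfolding E_def by simp
    have nn: "D / \<bar>Im s\<bar> \<ge> 0" "D\<^sup>2 \<ge> 0" using D0 by auto
    have "\<bar>of_int (n1 t)\<bar> \<le> D" using abs_Re_le_cmod[of "form t"] f by (simp add: form_n)
    then show "\<bar>n1 t\<bar> \<le> E" using E nn by linarith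
    have "\<bar>of_int (n2 t)\<bar> * \<bar>Im s\<bar> \<le> D" using abs_Im_le_cmod[of "form t"] f by (simp add: form_n abs_mult)
    then have "\<bar>of_int (n2 t)\<bar> \<le> D / \<bar>Im s\<bar>" using Im_s by (simp add: field_simps)
    then show "\<bar>n2 t\<bar> \<le> E" using E nn D0 by linarith
    have "complex_of_real ((norm (form t))\<^sup>2) = of_real (of_int (M t))"
      using complex_norm_square[of "form t"] unfolding form_M by simp
    then have "(norm (form t))\<^sup>2 = of_int (M t)" unfolding of_real_eq_iff .
    moreover have "(norm (form t))\<^sup>2 \<le> D\<^sup>2" using f by (intro power_mono) auto
    ultimately show "M t \<le> E" using E nn D0 by linarith
  qed
  \<comment> \<open>Equal keys mean equal relative norm \<open>n\<close> and congruent coordinates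
    modulo \<open>n * cnj n = M t\<close>, which is what \<open>quotient_integral\<close> asks
    for.\<close>
  define key where "key t = (case t of (a, b, c, d) \<Rightarrow>
      (n1 t, n2 t, a mod M t, b mod M t, c mod M t, d mod M t))" for t
  define B where "B = {- E..E} \<times> {- E..E} \<times> {0..E} \<times> {0..E} \<times> {0..E} \<times> {0..E}"
  have keyB: "key t \<in> B" if "t \<in> T" for t
  proof -
    have "x mod M t \<in> {0..E}" for x
    proof -
      have "0 \<le> x mod M t" "x mod M t < M t" using M0[OF that] by simp_all
      then show ?thesis using bounds(3)[OF that] by simp
    qed
    then show ?thesis using bounds[OF that] by (cases t) (auto simp: key_def B_def)
  qed
  have "finite ((\<lambda>r. key (t r)) ` S)"
  proof (rule finite_subset)
    show "(\<lambda>r. key (t r)) ` S \<subseteq> B" using keyB t by blast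
    show "finite B" by (simp add: B_def)
  qed
  from pigeonhole_infinite[OF \<open>infinite S\<close> this] obtain r0 where
    r0: "r0 \<in> S" "infinite {r \<in> S. key (t r) = key (t r0)}" by blast
  then have "infinite ({r \<in> S. key (t r) = key (t r0)} - {r0})" by simp
  then have "{r \<in> S. key (t r) = key (t r0)} - {r0} \<noteq> {}" by (metis finite.emptyI)
  then obtain r1 where r1: "r1 \<in> S" "key (t r1) = key (t r0)" "r1 \<noteq> r0" by blast
  obtain a b c d where t0: "t r0 = (a, b, c, d)" by (cases "t r0")
  obtain a' b' c' d' where t1: "t r1 = (a', b', c', d')" by (cases "t r1")
  define x y x' y' where "x = lat a b" and "y = lat c d" and "x' = lat a' b'" and "y' = lat c' d'"
  note xy = x_def y_def x'_def y'_def
  define n where "n = form (t r0)"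
  have same: "n1 (t r1) = n1 (t r0)" "n2 (t r1) = n2 (t r0)" using r1(2) by (auto simp: key_def t0 t1)
  have M_eq: "M (t r1) = M (t r0)" by (simp add: M_def same)
  define m where "m = M (t r0)"
  have "form (t r1) = n" by (simp add: form_n same n_def)
  then have nf: "x\<^sup>2 - s * y\<^sup>2 = n" "x'\<^sup>2 - s * y'\<^sup>2 = n"
    by (simp_all add: n_def t0 t1 form_def xy)
  have nm: "n * cnj n = of_int m" unfolding n_def m_def by (rule form_M)
  have "m > 0" unfolding m_def using M0 t r0 by blast
  then have n0: "n \<noteq> 0" using nm by auto
  have "a' mod m = a mod m" "b' mod m = b mod m" "c' mod m = c mod m" "d' mod m = d mod m"
    using r1(2) M_eq by (auto simp: key_def t0 t1 m_def)
  then have "m dvd a' - a" "m dvd b' - b" "m dvd c' - c" "m dvd d' - d" by (simp_all add: mod_eq_dvd_iff)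
  then obtain ka kb kc kd where k: "a' - a = m * ka" "b' - b = m * kb" "c' - c = m * kc" "d' - d = m * kd"
    by (auto elim!: dvdE)
  define u v where "u = lat ka kb" and "v = lat kc kd"
  have "x' - x = of_int m * u" "y' - y = of_int m * v"
    by (simp_all add: xy u_def v_def lat_diff lat_scale k)
  then have cong: "x' = x + n * cnj n * u" "y' = y + n * cnj n * v"
    "x = x' + n * cnj n * (- u)" "y = y' + n * cnj n * (- v)"
    unfolding nm by (simp_all add: algebra_simps)
  have O: "x \<in> OK" "y \<in> OK" "x' \<in> OK" "y' \<in> OK" "u \<in> OK" "v \<in> OK"
    unfolding xy u_def v_def by (rule lat_OK)+
  define \<epsilon> where "\<epsilon> = (x - y * \<alpha>) / (x' - y' * \<alpha>)"
  obtain A B where AB: "A \<in> OK" "B \<in> OK" "\<epsilon> = A + B * \<alpha>"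
    using quotient_integral[OF nf n0 O(1,2,5,6) cong(1,2)] unfolding \<epsilon>_def by blast
  \<comment> \<open>Exchanging the two elements and negating \<open>u\<close> and \<open>v\<close>
    shows that the inverse quotient is integral too, so \<open>\<epsilon>\<close> is a unit.\<close>
  obtain A' B' where AB': "A' \<in> OK" "B' \<in> OK" "inverse \<epsilon> = A' + B' * \<alpha>"
    using quotient_integral[OF nf(2,1) n0 O(3,4) OK_minus[OF O(5)] OK_minus[OF O(6)] cong(3,4)]
    unfolding \<epsilon>_def by auto
  have "norm (x - y * \<alpha>) = r0" using t[OF r0(1)] by (simp add: t0 lin_def xy)
  moreover have "norm (x' - y' * \<alpha>) = r1" using t[OF r1(1)] by (simp add: t1 lin_def xy)
  moreover have "r0 \<noteq> 0" "r1 \<noteq> 0" using t[OF r0(1)] t[OF r1(1)] by (auto simp: T_def)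
  ultimately have "\<epsilon> \<noteq> 0" "norm \<epsilon> \<noteq> 1" using r1(3) by (auto simp: \<epsilon>_def norm_divide)
  then show ?thesis using AB AB' by blast
qed

end

context quartic_ring
begin

theorem exists_unit: "\<exists>\<epsilon>. \<epsilon> \<in> OF \<and> inverse \<epsilon> \<in> OF \<and> \<epsilon> \<noteq> 0 \<and> norm \<epsilon> \<noteq> 1"
proof -
  obtain \<epsilon> A B A' B' where *: "A \<in> OK" "B \<in> OK" "A' \<in> OK" "B' \<in> OK" "\<epsilon> = A + B * \<alpha>"
    "inverse \<epsilon> = A' + B' * \<alpha>" "\<epsilon> \<noteq> 0" "norm \<epsilon> \<noteq> 1" using exists_unit_coordinates by blast
  have "A + B * \<alpha> \<in> OF" "A' + B' * \<alpha> \<in> OF"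
    by (intro int_add int_mult OK_subset_int[OF *(1)] OK_subset_int[OF *(2)] OK_subset_int[OF *(3)]
        OK_subset_int[OF *(4)] alpha_int)+
  then have "\<epsilon> \<in> OF" "inverse \<epsilon> \<in> OF" by (simp_all only: *(5)) (simp only: *(6)[unfolded *(5)])
  then show ?thesis using *(7,8) by blast
qed

end

section \<open>Fundamental units\<close>

lemma two_cancel: "2 * u = 2 * v \<Longrightarrow> u = (v :: complex)"
  by simp

context integers_ring
begin

interpretation ring "ring_of_integers F" by (rule ring_integers)

interpretation U: comm_group "unit_group F"
proof -
  interpret U: group "unit_group F" unfolding unit_group_def by (rule units_group)
  show "comm_group (unit_group F)"
    by (rule U.group_comm_groupI) (simp add: unit_group_def units_of_mult mult.commute)
qed

lemma unit_mult: "x \<otimes>\<^bsub>unit_group F\<^esub> y = x * y" and unit_one: "\<one>\<^bsub>unit_group F\<^esub> = 1"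
  by (simp_all add: unit_group_def units_of_mult units_of_one)

lemma unit_iff: "x \<in> carrier (unit_group F) \<longleftrightarrow> x \<in> OF \<and> inverse x \<in> OF \<and> x \<noteq> 0"
proof -
  have "y = inverse x" if "x * y = 1" for y :: complex using that by (simp add: inverse_unique)
  then show ?thesis
    unfolding unit_group_def units_of_carrier Units_def
    by (auto simp: mult.commute intro!: bexI[of _ "inverse x"])
qed

lemma unit_inv: "x \<in> carrier (unit_group F) \<Longrightarrow> inv\<^bsub>unit_group F\<^esub> x = inverse x"
  by (rule U.inv_equality) (auto simp: unit_mult unit_one unit_iff)

lemma unit_pow: "x [^]\<^bsub>unit_group F\<^esub> (n :: nat) = x ^ n"
  by (induction n) (simp_all add: U.nat_pow_Suc unit_mult unit_one mult.commute)

abbreviation "UT \<equiv> torsion (unit_group F)"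

lemma norm_torsion: "u \<in> UT \<Longrightarrow> norm u = 1"
proof -
  assume "u \<in> UT"
  then obtain n :: nat where n: "n > 0" "u ^ n = 1" by (auto simp: torsion_def unit_pow unit_one)
  then have "norm u ^ n = 1" by (metis norm_one norm_power)
  then show ?thesis using n(1) power_eq_imp_eq_base[of "norm u" n 1] by simp
qed

lemma torsion_normal: "UT \<lhd> unit_group F"
proof (rule U.subgroup_imp_normal, rule U.subgroupI)
  show "UT \<subseteq> carrier (unit_group F)" by (auto simp: torsion_def)
  have "1 \<in> UT" using U.one_closed by (auto simp: torsion_def unit_pow unit_one)
  then show "UT \<noteq> {}" by blast
  fix a assume a: "a \<in> UT"
  then obtain n :: nat where n: "n > 0" "a ^ n = 1" "a \<in> carrier (unit_group F)"
    by (auto simp: torsion_def unit_pow unit_one)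
  have "(inverse a) ^ n = 1" using n(2) by (simp add: power_inverse)
  then show "inv\<^bsub>unit_group F\<^esub> a \<in> UT"
    using n(1,3) U.inv_closed[OF n(3)] unfolding torsion_def unit_pow unit_one unit_inv[OF n(3)] by blast
  fix b assume b: "b \<in> UT"
  from a b obtain n m :: nat where *: "n > 0" "a ^ n = 1" "m > 0" "b ^ m = 1" by (auto simp: torsion_def unit_pow unit_one)
  have "(a * b) ^ (n * m) = (a ^ n) ^ m * (b ^ m) ^ n"
    by (simp add: power_mult_distrib mult.commute flip: power_mult)
  then have "(a * b) ^ (n * m) = 1" using * by simp
  then show "a \<otimes>\<^bsub>unit_group F\<^esub> b \<in> UT" using a b *
    by (auto simp: torsion_def unit_pow unit_one unit_mult intro!: exI[of _ "n * m"] U.m_closed[unfolded unit_mult])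
qed

text \<open>Torsion has absolute value 1, so the absolute value is constant on cosets and
  multiplicative on the quotient; on the group generated by the coset of \<open>\<eta>\<close> it
  takes only powers of \<open>norm \<eta>\<close>.\<close>

lemma norm_unit:
  assumes \<eta>: "fundamental_unit F \<eta>" and u: "u \<in> carrier (unit_group F)"
  shows "\<exists>k::int. norm u = norm \<eta> powi k"
proof -
  interpret T: normal UT "unit_group F" by (rule torsion_normal)
  have \<eta>U: "\<eta> \<in> carrier (unit_group F)" 
    and gen: "generate (unit_group F Mod UT) {UT #>\<^bsub>unit_group F\<^esub> \<eta>} = carrier (unit_group F Mod UT)"
    using \<eta> by (auto simp: fundamental_unit_def Let_def)
  have \<eta>0: "norm \<eta> \<noteq> 0" using \<eta>U by (simp add: unit_iff)
  have coset: "norm v = norm z" if "v \<in> UT #>\<^bsub>unit_group F\<^esub> z" for v z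
    using that norm_torsion by (auto simp: r_coset_def unit_mult norm_mult)
  have "\<exists>k::int. \<forall>u\<in>C. norm u = norm \<eta> powi k"
    if "C \<in> generate (unit_group F Mod UT) {UT #>\<^bsub>unit_group F\<^esub> \<eta>}" for C
    using that
  proof (induction rule: generate.induct)
    case one
    show ?case using norm_torsion by (intro exI[of _ 0]) (simp add: FactGroup_def)
  next
    case (incl h)
    then show ?case using coset by (intro exI[of _ 1]) auto
  next
    case (inv h)
    then have h: "h = UT #>\<^bsub>unit_group F\<^esub> \<eta>" by simp
    have "h \<in> carrier (unit_group F Mod UT)" unfolding h FactGroup_def by (auto intro: U.rcosetsI[OF T.subset \<eta>U])
    then have "inv\<^bsub>unit_group F Mod UT\<^esub> h = UT #>\<^bsub>unit_group F\<^esub> inverse \<eta>"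
      using T.inv_FactGroup T.rcos_inv[OF \<eta>U] unfolding h unit_inv[OF \<eta>U] by simp
    then show ?case using coset by (intro exI[of _ "-1"]) (auto simp: norm_inverse power_int_minus)
  next
    case (eng h1 h2)
    then obtain k1 k2 where "\<forall>u\<in>h1. norm u = norm \<eta> powi k1" "\<forall>u\<in>h2. norm u = norm \<eta> powi k2" by blast
    then show ?case using \<eta>0
      by (intro exI[of _ "k1 + k2"]) (auto simp: FactGroup_def set_mult_def unit_mult norm_mult power_int_add)
  qed
  moreover have "UT #>\<^bsub>unit_group F\<^esub> u \<in> carrier (unit_group F Mod UT)"
    unfolding FactGroup_def by (auto intro: U.rcosetsI[OF T.subset u])
  moreover have "u \<in> UT #>\<^bsub>unit_group F\<^esub> u" by (rule U.rcos_self[OF u T.subgroup_axioms])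
  ultimately show ?thesis unfolding gen by blast
qed

end

context quartic_ring
begin

text \<open>Such a \<open>g\<close> is itself a unit, of absolute value
  \<open>norm \<eta> powi k\<close>, so \<open>norm \<eta>\<close> equals its own power with
  exponent \<open>2 * k\<close>. This forces \<open>norm \<eta> = 1\<close>, and then every unit has
  absolute value 1, against \<open>exists_unit\<close>.\<close>

theorem fundamental_unit_not_square:
  assumes \<eta>: "fundamental_unit F \<eta>" and g: "g \<in> F"
  shows "\<eta> \<noteq> g\<^sup>2" "\<eta> \<noteq> - g\<^sup>2"
proof -
  have False if eq: "\<eta> = g\<^sup>2 \<or> \<eta> = - g\<^sup>2"
  proof -
    have "\<eta> \<in> carrier (unit_group F)" using \<eta> by (auto simp: fundamental_unit_def Let_def)
    then have \<eta>U: "\<eta> \<in> OF" "inverse \<eta> \<in> OF" "\<eta> \<noteq> 0" by (auto simp: unit_iff)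
    have alg: "algebraic_int z" if "z\<^sup>2 = w \<or> z\<^sup>2 = - w" "algebraic_int w" for z w :: complex
      using that algebraic_int_sqrt[of z] by auto
    have "g\<^sup>2 = \<eta> \<or> g\<^sup>2 = - \<eta>" using eq by auto
    moreover from this have "(inverse g)\<^sup>2 = inverse \<eta> \<or> (inverse g)\<^sup>2 = - inverse \<eta>"
      by (auto simp: power_inverse)
    ultimately have "algebraic_int g" "algebraic_int (inverse g)"
      using alg[OF _ algebraic_int_integers_of[OF \<eta>U(1)]] alg[OF _ algebraic_int_integers_of[OF \<eta>U(2)]]
      by blast+
    moreover have "g \<noteq> 0" using eq \<eta>U by auto
    ultimately have "g \<in> carrier (unit_group F)" using g F_intros(6) by (simp add: unit_iff integers_of_def)
    then obtain k where k: "norm g = norm \<eta> powi k" using norm_unit[OF \<eta>] by blast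
    have "norm \<eta> = (norm g)\<^sup>2" using eq by (auto simp: norm_power)
    then have "norm \<eta> = norm \<eta> powi (k + k)" unfolding k using \<eta>U(3)
      by (subst power_int_add) (simp_all add: power2_eq_square)
    then have "norm \<eta> = norm \<eta> powr (2 * of_int k)"
      using powr_real_of_int'[of "norm \<eta>" "k + k"] \<eta>U(3) by simp
    then have "ln (norm \<eta>) = 2 * of_int k * ln (norm \<eta>)" by (metis ln_powr)
    then have "(1 - 2 * real_of_int k) * ln (norm \<eta>) = 0" by (simp add: algebra_simps)
    moreover have "1 - 2 * real_of_int k \<noteq> 0"
    proof
      assume "1 - 2 * real_of_int k = 0"
      then have "real_of_int (2 * k) = real_of_int 1" by simp
      then have "2 * k = 1" unfolding of_int_eq_iff .
      then show False by presburger
    qed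
    ultimately have n1: "norm \<eta> = 1" using \<eta>U(3) by simp
    obtain \<epsilon> where "\<epsilon> \<in> OF" "inverse \<epsilon> \<in> OF" "\<epsilon> \<noteq> 0" "norm \<epsilon> \<noteq> 1" using exists_unit by blast
    then show False using norm_unit[OF \<eta>, of \<epsilon>] n1 by (simp add: unit_iff)
  qed
  then show "\<eta> \<noteq> g\<^sup>2" "\<eta> \<noteq> - g\<^sup>2" by blast+
qed

end

section \<open>The primes above 2\<close>

locale quartic_prime = quartic +
  fixes P :: "complex set"
  assumes prime_above_2: "prime_above F 2 P"
begin

lemma primeideal_P: "primeideal P (ring_of_integers F)" and two_in_P: "2 \<in> P"
  using prime_above_2 by (auto simp: prime_above_def)

sublocale quartic_ring
  by (rule quartic_ring.intro[OF quartic_axioms quartic_ring_axioms.intro])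
    (rule ideal.axioms(2)[OF primeideal.axioms(1)[OF primeideal_P]])

sublocale integers_prime F P
  by (rule integers_prime.intro[OF integers_ring_axioms integers_prime_axioms.intro[OF primeideal_P two_in_P]])

definition \<omega> :: complex where "\<omega> = (1 + s) / 2"

lemma s_omega: "s = 2 * \<omega> - 1"
  by (simp add: \<omega>_def)

lemma omega_OK: "\<omega> \<in> OK"
  by (rule OK_I[of 1 1]) (simp_all add: \<omega>_def)

text \<open>The three cases of the theorem are conditions on this product: \<open>Q\<close> odd for
  \<open>q\<close> congruent to 3 modulo 8, \<open>Q\<close> congruent to 2 modulo 4 for 7 modulo
  16, and \<open>Q\<close> divisible by 4 for 15 modulo 16.\<close>

lemma omega_square: "\<omega> * (1 - \<omega>) = of_int Q"
proof -
  have "4 * (\<omega> * (1 - \<omega>)) = 1 - s\<^sup>2"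
    using s_omega by Groebner_Basis.algebra
  also have "\<dots> = of_int (int q + 1)" by (simp add: s_square)
  also have "\<dots> = 4 * of_int Q" unfolding q_eq by simp
  finally show ?thesis by simp
qed

lemma OK_omega:
  assumes "z \<in> OK"
  obtains a b :: int where "z = of_int a + of_int b * \<omega>"
proof -
  obtain U V :: int where UV: "even (U - V)" "2 * z = of_int U + of_int V * s" using assms by (auto simp: OK_def)
  obtain a where a: "U - V = 2 * a" using UV(1) by blast
  then have "U = V + 2 * a" by simp
  then have U: "complex_of_int U = of_int V + 2 * of_int a" by simp
  have "2 * \<omega> = 1 + s" by (simp add: \<omega>_def)
  then have "2 * z = 2 * (of_int a + of_int V * \<omega>)" using UV(2) U by Groebner_Basis.algebra
  then have "z = of_int a + of_int V * \<omega>" by (rule two_cancel)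
  then show ?thesis by (rule that)
qed

lemma cnj_omega: "cnj \<omega> = 1 - \<omega>"
  by (simp add: \<omega>_def field_simps)

lemmas inO = OK_subset_int

text \<open>The origin of the uniformizer \<open>\<alpha> - 1\<close>: modulo \<open>P\<close> the
  cofactor \<open>\<omega> - \<alpha>\<close> is \<open>\<omega> - 1\<close>, so the square is 2 up
  to a local unit unless \<open>1 - \<omega>\<close> lies in \<open>P\<close>.\<close>

lemma pi_square: "(\<alpha> - 1)\<^sup>2 = 2 * (\<omega> - \<alpha>)"
  using s_omega alpha_square by Groebner_Basis.algebra

lemma pi_in_P: "\<alpha> - 1 \<in> P"
proof -
  have "\<omega> - \<alpha> \<in> OF" by (intro int_diff inO omega_OK alpha_int)
  then have "(\<alpha> - 1)\<^sup>2 \<in> P" unfolding pi_square by (rule P_multr[OF two_in])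
  then show ?thesis using P_power_iff[of "\<alpha> - 1" 2] int_diff[OF alpha_int int_1] by simp
qed

lemma fraction_K: "z \<in> K \<Longrightarrow> \<exists>N::int. N \<noteq> 0 \<and> of_int N * z \<in> OK"
proof -
  assume "z \<in> K"
  then obtain u v where uv: "z = u + v * s" "u \<in> \<rat>" "v \<in> \<rat>" by (auto simp: K_eq)
  obtain a b where ab: "b > 0" "u = of_int a / of_int b" using uv(2) by (auto elim: Rats_cases')
  obtain c d where cd: "d > 0" "v = of_int c / of_int d" using uv(3) by (auto elim: Rats_cases')
  have "of_int (b * d) * z = of_int (a * d) + of_int (c * b) * s"
    using ab cd by (simp add: uv(1) field_simps)
  then have "of_int (b * d) * z \<in> OK" by (simp only:) (intro OK_intros)
  moreover have "b * d \<noteq> 0" using ab cd by simp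
  ultimately show ?thesis by blast
qed

lemma fraction_F: "z \<in> F \<Longrightarrow> \<exists>N::int. N \<noteq> 0 \<and> of_int N * z \<in> OF"
proof -
  assume "z \<in> F"
  then obtain x y where xy: "z = x + y * \<alpha>" "x \<in> K" "y \<in> K" by (auto simp: F_eq)
  obtain N where N: "N \<noteq> 0" "of_int N * x \<in> OK" using fraction_K[OF xy(2)] by blast
  obtain M where M: "M \<noteq> 0" "of_int M * y \<in> OK" using fraction_K[OF xy(3)] by blast
  have "of_int (N * M) * z = of_int M * (of_int N * x) + of_int N * (of_int M * y) * \<alpha>"
    by (simp add: xy(1) algebra_simps)
  also have "\<dots> \<in> OF" by (intro int_add int_mult inO[OF N(2)] inO[OF M(2)] int_of_int alpha_int)
  finally show ?thesis using N M by (intro exI[of _ "N * M"]) auto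
qed

lemma double_coordinates:
  assumes "z \<in> OF"
  obtains A B n where "2 * z = A + B * \<alpha>" "A \<in> OK" "B \<in> OK" "n \<in> OK" "A\<^sup>2 - s * B\<^sup>2 = 4 * n"
proof -
  obtain x y where xy: "z = x + y * \<alpha>" "x \<in> K" "y \<in> K" using assms by (auto simp: F_eq integers_of_def)
  have 1: "2 * x \<in> OK" "x\<^sup>2 - s * y\<^sup>2 \<in> OK" using trace_norm_OK[OF xy(2,3)] assms xy by auto
  have "s * (2 * y)\<^sup>2 = (2 * x)\<^sup>2 - 4 * (x\<^sup>2 - s * y\<^sup>2)" by (simp add: algebra_simps power2_eq_square)
  also have "\<dots> \<in> OK" by (intro OK_intros 1)
  finally have "2 * y \<in> OK" by (rule OK_half_y[rotated]) (intro K_intros xy)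
  then show ?thesis using that[of "2 * x" "2 * y" "x\<^sup>2 - s * y\<^sup>2"] 1 xy(1)
    by (simp add: algebra_simps power2_eq_square)
qed

text \<open>As \<open>s + 1 = 2 * \<omega>\<close>, the form
  \<open>A\<^sup>2 - s * B\<^sup>2\<close> is \<open>(A - B)\<^sup>2\<close> modulo 2.\<close>

lemma coordinates_congruent:
  assumes AB: "A \<in> OK" "B \<in> OK" "n \<in> OK" "A\<^sup>2 - s * B\<^sup>2 = 4 * n"
  shows "A - B \<in> P"
proof -
  have "(A - B)\<^sup>2 = 2 * (\<omega> * B\<^sup>2 - A * B + 2 * n)"
    using AB(4) s_omega by Groebner_Basis.algebra
  moreover have "\<omega> * B\<^sup>2 - A * B + 2 * n \<in> OF" by (intro inO) (intro OK_intros omega_OK AB)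
  ultimately have "(A - B)\<^sup>2 \<in> P" using P_multr[OF two_in] by (simp only:)
  then show ?thesis using P_power_iff[of "A - B" 2] int_diff[OF inO[OF AB(1)] inO[OF AB(2)]] by simp
qed

text \<open>If \<open>\<omega>\<close> is in \<open>P\<close>, the residue of
  \<open>a + b * \<omega>\<close> is that of the integer \<open>a\<close>, so \<open>OK\<close> has
  only two residues.\<close>

lemma OK_P_cases: "z \<in> OK \<Longrightarrow> \<omega> \<in> P \<Longrightarrow> z \<in> P \<or> z - 1 \<in> P"
proof -
  assume "z \<in> OK" "\<omega> \<in> P"
  then obtain a b where ab: "z = of_int a + of_int b * \<omega>" by (auto elim: OK_omega)
  have b: "of_int b * \<omega> \<in> P" by (rule P_multl[OF int_of_int \<open>\<omega> \<in> P\<close>])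
  have "of_int a \<in> P \<or> of_int (a - 1) \<in> P" unfolding P_even by simp
  then show ?thesis
  proof
    assume "of_int a \<in> P"
    then show ?thesis using P_add[OF _ b] unfolding ab by blast
  next
    assume "of_int (a - 1) \<in> P"
    from P_add[OF this b] show ?thesis unfolding ab by (simp add: algebra_simps)
  qed
qed

text \<open>If \<open>\<omega> \<equiv> 1\<close> modulo \<open>P\<close>, then \<open>s \<equiv> 1\<close> modulo 4 locally and \<open>P\<close> is unramified.\<close>

lemma unramified_case:
  assumes Q: "even Q" and om: "1 - \<omega> \<in> P"
  shows "ramification_index F P 2 = 1"
proof -
  obtain m where m: "Q = 2 * m" using Q by blast
  have omO: "\<omega> \<in> OF" by (rule inO[OF omega_OK])
  have omP: "\<omega> \<notin> P" using P_add[OF om, of \<omega>] one_notin_P by auto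
  \<comment> \<open>\<open>\<omega>\<close> lies in the other prime of \<open>K\<close> above 2, so
    it turns membership in \<open>P\<close> into divisibility by 2.\<close>
  have half: "\<exists>t\<in>OK. \<omega> * z = 2 * t" if z: "z \<in> OK" "z \<in> P" for z
  proof -
    obtain a b where ab: "z = of_int a + of_int b * \<omega>" using z(1) by (rule OK_omega)
    have z2: "z = of_int (a + b) - of_int b * (1 - \<omega>)" by (simp add: ab algebra_simps)
    have "z + of_int b * (1 - \<omega>) \<in> P" by (intro P_add z P_multl int_of_int om)
    then have "of_int (a + b) \<in> P" unfolding z2 by simp
    then have "even (a + b)" using P_even by blast
    then obtain k where k: "a + b = 2 * k" by blast
    have "\<omega> * z = \<omega> * of_int (a + b) - of_int b * (\<omega> * (1 - \<omega>))"
      unfolding z2 by (simp add: algebra_simps)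
    also have "\<dots> = 2 * (\<omega> * of_int k - of_int (b * m))"
      unfolding omega_square k m by (simp add: algebra_simps)
    finally have "\<omega> * z = 2 * (\<omega> * of_int k - of_int (b * m))" .
    moreover have "\<omega> * of_int k - of_int (b * m) \<in> OK" by (intro OK_intros omega_OK)
    ultimately show ?thesis by blast
  qed
  \<comment> \<open>\<open>(1 + \<alpha>) / 2\<close> is integral at \<open>P\<close> but not at the
    other prime of \<open>K\<close> above 2; the factor \<open>\<omega>\<close> repairs
    this.\<close>
  define \<beta> where "\<beta> = \<omega> * (1 + \<alpha>) / 2"
  have b2: "\<beta> * (\<beta> - \<omega>) = - (\<omega> * of_int m)"
  proof -
    have "4 * (\<beta> * (\<beta> - \<omega>)) = \<omega>\<^sup>2 * (\<alpha>\<^sup>2 - 1)" by (simp add: \<beta>_def field_simps power2_eq_square)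
    also have "\<dots> = - (2 * \<omega> * (\<omega> * (1 - \<omega>)))"
    proof -
      have "\<alpha>\<^sup>2 - 1 = 2 * (\<omega> - 1)" unfolding alpha_square \<omega>_def by (simp add: algebra_simps)
      then show ?thesis by Groebner_Basis.algebra
    qed
    also have "\<dots> = 4 * (- (\<omega> * of_int m))" unfolding omega_square m by simp
    finally show ?thesis by simp
  qed
  have bF: "\<beta> \<in> F" unfolding \<beta>_def by (intro F_intros K_subset_F[OF OK_subset[OF omega_OK]] alpha_in_F)
  have bO: "\<beta> \<in> OF"
  proof -
    define M where "M = complex_of_int m"
    have 1: "\<beta>\<^sup>2 = \<omega> * \<beta> - \<omega> * M" using b2 by (simp add: M_def algebra_simps power2_eq_square)
    have 2: "\<omega> * (1 - \<omega>) = 2 * M" using omega_square by (simp add: M_def m)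
    \<comment> \<open>The norm from \<open>K\<close> to the rationals of the quadratic polynomial
      \<open>X\<^sup>2 - \<omega> * X + \<omega> * M\<close> of \<open>\<beta>\<close>, where
      \<open>\<omega>\<close> and \<open>1 - \<omega>\<close> are conjugate with product
      \<open>2 * M\<close>.\<close>
    have "\<beta> ^ 4 - \<beta> ^ 3 + 3 * M * \<beta>\<^sup>2 - 4 * M\<^sup>2 * \<beta> + 2 * M ^ 3 = 0"
      using 1 2 by Groebner_Basis.algebra
    then have "poly (map_poly of_int [:2 * m ^ 3, - 4 * m\<^sup>2, 3 * m, -1, 1:]) \<beta> = 0"
      by (simp add: map_poly_pCons M_def algebra_simps power2_eq_square power3_eq_cube power4_eq_xxxx)
    moreover have "lead_coeff [:2 * m ^ 3, - 4 * m\<^sup>2, 3 * m, -1, 1:] = 1" by simp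
    ultimately have "algebraic_int \<beta>" unfolding algebraic_int_altdef_ipoly by blast
    then show ?thesis using bF by (simp add: integers_of_def)
  qed
  have UOM: "\<omega> \<in> U" "\<omega>\<^sup>2 \<in> U" using omP omO U_power[of \<omega> 2] by auto
  have red: "\<exists>t\<in>OF. \<exists>a b. \<omega>\<^sup>2 * z = \<omega> * (of_int a + of_int b * \<beta>) + 2 * t \<and> a \<in> {0, 1} \<and> b \<in> {0, 1::int}"
    if z: "z \<in> OF" for z
  proof -
    have red0: "\<exists>t\<in>OK. \<exists>a\<in>{0,1::int}. \<omega> * z = \<omega> * of_int a + 2 * t" if z: "z \<in> OK" for z
    proof -
      obtain a b where ab: "z = of_int a + of_int b * \<omega>" using z by (rule OK_omega)
      have "z - of_int ((a + b) mod 2) = of_int (a + b - (a + b) mod 2) - of_int b * (1 - \<omega>)"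
        by (simp add: ab algebra_simps)
      moreover have "of_int (a + b - (a + b) mod 2) - of_int b * (1 - \<omega>) \<in> P"
        by (intro P_diff P_multl int_of_int om) (simp only: P_even, presburger)
      ultimately have "z - of_int ((a + b) mod 2) \<in> P" by (simp only:)
      moreover have "z - of_int ((a + b) mod 2) \<in> OK" by (intro OK_intros z)
      ultimately obtain t where "t \<in> OK" "\<omega> * (z - of_int ((a + b) mod 2)) = 2 * t" using half by blast
      then show ?thesis by (intro bexI[of _ t] bexI[of _ "(a + b) mod 2"]) (auto simp: algebra_simps)
    qed
    obtain A B n where AB: "2 * z = A + B * \<alpha>" "A \<in> OK" "B \<in> OK" "n \<in> OK" "A\<^sup>2 - s * B\<^sup>2 = 4 * n"
      using z by (rule double_coordinates)
    have "A - B \<in> P" by (rule coordinates_congruent[OF AB(2-5)])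
    then obtain t where t: "t \<in> OK" "\<omega> * (A - B) = 2 * t" using half[of "A - B"] OK_diff[OF AB(2,3)] by blast
    have "2 * (\<omega> * z) = 2 * (t + B * \<beta>)"
    proof -
      have "2 * (\<omega> * z) = \<omega> * (2 * z)" by simp
      also have "\<dots> = \<omega> * (A - B) + \<omega> * B * (1 + \<alpha>)" unfolding AB(1) by (simp add: algebra_simps)
      finally have "2 * (\<omega> * z) = \<omega> * (A - B) + \<omega> * B * (1 + \<alpha>)" .
      then show ?thesis unfolding t(2) \<beta>_def by (simp add: algebra_simps)
    qed
    then have oz: "\<omega> * z = t + B * \<beta>" by (rule two_cancel)
    obtain t1 a where a: "t1 \<in> OK" "a \<in> {0,1::int}" "\<omega> * t = \<omega> * of_int a + 2 * t1" using red0[OF t(1)] by blast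
    obtain t2 b where b: "t2 \<in> OK" "b \<in> {0,1::int}" "\<omega> * B = \<omega> * of_int b + 2 * t2" using red0[OF AB(3)] by blast
    have "\<omega>\<^sup>2 * z = \<omega> * (\<omega> * z)" by (simp add: power2_eq_square)
    also have "\<dots> = \<omega> * t + \<omega> * B * \<beta>" unfolding oz by (simp add: algebra_simps)
    also have "\<dots> = \<omega> * (of_int a + of_int b * \<beta>) + 2 * (t1 + t2 * \<beta>)"
      unfolding a(3) b(3) by (simp add: algebra_simps)
    finally have "\<omega>\<^sup>2 * z = \<omega> * (of_int a + of_int b * \<beta>) + 2 * (t1 + t2 * \<beta>)" .
    moreover have "t1 + t2 * \<beta> \<in> OF" by (intro int_add int_mult inO a(1) b(1) bO)
    ultimately show ?thesis using a(2) b(2) by blast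
  qed
  interpret V: principal_prime F P 2 1
  proof
    show "2 \<in> P" by (rule two_in)
    show "\<exists>u\<in>U. \<exists>w\<in>U. u * 2 = 2 ^ 1 * w" using U_1 by (auto intro!: bexI[of _ 1])
    fix z assume zP: "z \<in> P"
    have zO: "z \<in> OF" by (rule P_subset[OF zP])
    obtain t a b where tab: "t \<in> OF" "\<omega>\<^sup>2 * z = \<omega> * (of_int a + of_int b * \<beta>) + 2 * t" "a \<in> {0,1}" "b \<in> {0,1::int}"
      using red[OF zO] by blast
    have "\<omega>\<^sup>2 * z - 2 * t \<in> P" using UOM by (intro P_diff P_multl zP P_multr two_in tab) auto
    then have "\<omega> * (of_int a + of_int b * \<beta>) \<in> P" unfolding tab(2) by simp
    moreover have abO: "of_int a + of_int b * \<beta> \<in> OF" by (intro int_add int_mult int_of_int bO)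
    ultimately have abP: "of_int a + of_int b * \<beta> \<in> P" using P_prime[OF omO] omP by blast
    have ommP: "even m" if "\<omega> * of_int m \<in> P"
    proof -
      have "of_int m \<in> P" using P_prime[OF omO int_of_int that] omP by blast
      then show ?thesis using P_even by blast
    qed
    have bmO: "\<beta> - \<omega> \<in> OF" by (intro int_diff bO omO)
    have key: "\<exists>d\<in>U. \<exists>r\<in>OF. d * z = 2 * r" if "d \<in> U" "r \<in> OF" "d * (\<omega> * (of_int a + of_int b * \<beta>)) = 2 * r" for d r
    proof (intro bexI)
      show "(d * \<omega>\<^sup>2) * z = 2 * (r + d * t)" 
        using that(3) unfolding mult.assoc tab(2) by (simp add: algebra_simps)
      show "d * \<omega>\<^sup>2 \<in> U" by (rule U_mult[OF that(1) UOM(2)])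
      show "r + d * t \<in> OF" using that by (intro int_add int_mult tab) auto
    qed
    consider "a = 0" "b = 0" | "a = 1" "b = 0" | "a = 0" "b = 1" | "a = 1" "b = 1" using tab by auto
    \<comment> \<open>Up to multipliers, \<open>z\<close> is one of four residues modulo 2. The
      residue 0 is immediate and 1 is not in \<open>P\<close>. In the last two cases a factor of
      \<open>\<beta> * (\<beta> - \<omega>)\<close> is in \<open>P\<close>, so \<open>m\<close> is
      even; the other factor is outside \<open>P\<close> and serves as multiplier.\<close>
    then show "\<exists>d\<in>U. \<exists>r\<in>OF. d * z = 2 * r"
    proof cases
      case 1
      show ?thesis by (rule key[OF U_1 int_0]) (simp add: 1)
    next
      case 2
      then show ?thesis using abP one_notin_P by simp
    next
      case 3
      then have bP: "\<beta> \<in> P" using abP by simp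
      have "\<beta> * (\<beta> - \<omega>) \<in> P" by (rule P_multr[OF bP bmO])
      then have "\<omega> * of_int m \<in> P" unfolding b2 using P_minus by fastforce
      then obtain k where k: "m = 2 * k" using ommP by blast
      have "\<beta> - \<omega> \<notin> P" using P_diff[OF bP, of "\<beta> - \<omega>"] omP by auto
      moreover have "(\<beta> - \<omega>) * (\<omega> * (of_int a + of_int b * \<beta>)) = 2 * (- (\<omega> * \<omega> * of_int k))"
      proof -
        have "(\<beta> - \<omega>) * (\<omega> * (of_int a + of_int b * \<beta>)) = \<omega> * (\<beta> * (\<beta> - \<omega>))" by (simp add: 3)
        then show ?thesis unfolding b2 k by simp
      qed
      moreover have "- (\<omega> * \<omega> * of_int k) \<in> OF" by (intro int_minus int_mult omO int_of_int)
      ultimately show ?thesis using bmO key[of "\<beta> - \<omega>"] by blast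
    next
      case 4
      then have bP: "1 + \<beta> \<in> P" using abP by simp
      have "\<beta> - \<omega> = (1 + \<beta>) + (1 - \<omega>) - 2" by simp
      then have "\<beta> - \<omega> \<in> P" using P_diff[OF P_add[OF bP om] two_in] by simp
      then have "\<beta> * (\<beta> - \<omega>) \<in> P" by (rule P_multl[OF bO])
      then have "\<omega> * of_int m \<in> P" unfolding b2 using P_minus by fastforce
      then obtain k where k: "m = 2 * k" using ommP by blast
      have "\<beta> \<notin> P" using P_diff[OF bP, of \<beta>] one_notin_P by auto
      moreover have "\<beta> * (\<omega> * (of_int a + of_int b * \<beta>)) = 2 * (\<omega> * \<beta> - of_int m * \<beta> - \<omega> * \<omega> * of_int k)"
      proof -
        have bb: "\<beta> * \<beta> = \<omega> * \<beta> - \<omega> * of_int m" using b2 by (simp add: algebra_simps)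
        have oo: "\<omega> * \<omega> = \<omega> - 2 * of_int m" using omega_square by (simp add: m algebra_simps)
        have "\<beta> * (\<omega> * (of_int a + of_int b * \<beta>)) = \<omega> * \<beta> + \<omega> * (\<beta> * \<beta>)" by (simp add: 4 algebra_simps)
        also have "\<dots> = \<omega> * \<beta> + \<omega> * \<omega> * \<beta> - \<omega> * \<omega> * of_int m" unfolding bb by (simp add: algebra_simps)
        also have "\<dots> = 2 * (\<omega> * \<beta> - of_int m * \<beta>) - \<omega> * \<omega> * of_int m" unfolding oo by (simp add: algebra_simps)
        finally show ?thesis by (simp add: k algebra_simps)
      qed
      moreover have "\<omega> * \<beta> - of_int m * \<beta> - \<omega> * \<omega> * of_int k \<in> OF"
        by (intro int_diff int_mult omO int_of_int bO)
      ultimately show ?thesis using bO key[of \<beta>] by blast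
    qed
  qed (use fraction_F F_intros in auto)
  have "ord_at F P 2 = ereal (of_int 1)"
    using V.ord_at_hasval[OF _ V.hasval_two] F_intros(12) by simp
  then show ?thesis by (simp add: ramification_index_def one_ereal_def)
qed

end

text \<open>
  \<open>\<theta>\<close> is a local unit that kills \<open>P \<inter> OK\<close> modulo 2: it is 1 when 2 is inert in \<open>K\<close>, and \<open>1 - \<omega>\<close> when
  2 splits.
\<close>

locale quartic_ramified = quartic_prime +
  fixes \<theta> :: complex
  assumes theta: "\<theta> \<in> OK" "\<theta> \<notin> P" and theta_half: "z \<in> OK \<Longrightarrow> z \<in> P \<Longrightarrow> \<exists>t\<in>OK. \<theta> * z = 2 * t"
    and omega': "1 - \<omega> \<notin> P"
begin

text \<open>Here ramification enters. Since \<open>A\<close> and \<open>B\<close> agree locally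
  modulo 2 and \<open>1 - s = 2 * (1 - \<omega>)\<close>, the equation gives
  \<open>(1 - \<omega>) * B\<^sup>2\<close> in \<open>P\<close> up to a local unit, and
  \<open>1 - \<omega>\<close> is outside \<open>P\<close>. Hence \<open>\<alpha>\<close> and 1 span
  the integers locally.\<close>

lemma coordinates_in_P:
  assumes AB: "A \<in> OK" "B \<in> OK" "n \<in> OK" "A\<^sup>2 - s * B\<^sup>2 = 4 * n"
  shows "A \<in> P" "B \<in> P"
proof -
  have d: "A - B \<in> P" by (rule coordinates_congruent[OF AB])
  then obtain t where t: "t \<in> OK" "\<theta> * (A - B) = 2 * t" using theta_half OK_diff[OF AB(1,2)] by blast
  have "2 * (\<theta>\<^sup>2 * B\<^sup>2 * (1 - \<omega>)) = 2 * (2 * (\<theta>\<^sup>2 * n - \<theta> * B * t - t\<^sup>2))"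
    using AB(4) t(2) s_omega by Groebner_Basis.algebra
  then have "\<theta>\<^sup>2 * B\<^sup>2 * (1 - \<omega>) = 2 * (\<theta>\<^sup>2 * n - \<theta> * B * t - t\<^sup>2)" by (rule two_cancel)
  moreover have "\<theta>\<^sup>2 * n - \<theta> * B * t - t\<^sup>2 \<in> OK" by (intro OK_intros theta AB t)
  ultimately have "\<theta>\<^sup>2 * B\<^sup>2 * (1 - \<omega>) \<in> P" using P_multr[OF two_in inO] by (simp only:)
  moreover have "\<theta>\<^sup>2 * B\<^sup>2 \<in> OK" "1 - \<omega> \<in> OK" by (intro OK_intros theta AB omega_OK)+
  ultimately have "\<theta>\<^sup>2 * B\<^sup>2 \<in> P" using P_prime inO omega' by blast
  then have "(\<theta> * B)\<^sup>2 \<in> P" by (simp add: power_mult_distrib)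
  moreover have "\<theta> * B \<in> OK" by (intro OK_intros theta AB)
  ultimately have "\<theta> * B \<in> P" using P_power_iff[of "\<theta> * B" 2] inO by simp
  then show B: "B \<in> P" using P_prime[OF inO[OF theta(1)] inO[OF AB(2)]] theta(2) by blast
  show "A \<in> P" using P_add[OF d B] by simp
qed

sublocale principal_prime F P "\<alpha> - 1" 2
proof
  show "\<alpha> - 1 \<in> P" by (rule pi_in_P)
  have dO: "\<omega> - \<alpha> \<in> OF" by (intro int_diff inO omega_OK alpha_int)
  have dU: "\<omega> - \<alpha> \<in> U"
  proof -
    have "\<omega> - \<alpha> \<notin> P"
    proof
      assume "\<omega> - \<alpha> \<in> P"
      from P_minus[OF P_add[OF this pi_in_P]] have "1 - \<omega> \<in> P" by simp
      then show False using omega' by simp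
    qed
    with dO show ?thesis by blast
  qed
  show "\<exists>u\<in>U. \<exists>w\<in>U. u * 2 = (\<alpha> - 1) ^ 2 * w"
    by (rule bexI[OF _ dU], rule bexI[OF _ U_1]) (simp add: pi_square mult.commute)
  have tU: "\<theta> \<in> U" using theta inO by blast
  fix z assume zP: "z \<in> P"
  obtain A B n where AB: "2 * z = A + B * \<alpha>" "A \<in> OK" "B \<in> OK" "n \<in> OK" "A\<^sup>2 - s * B\<^sup>2 = 4 * n"
    using P_subset[OF zP] by (rule double_coordinates)
  obtain x where x: "x \<in> OK" "\<theta> * A = 2 * x" using theta_half AB coordinates_in_P[OF AB(2-5)] by blast
  obtain y where y: "y \<in> OK" "\<theta> * B = 2 * y" using theta_half AB coordinates_in_P[OF AB(2-5)] by blast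
  have "2 * (\<theta> * z) = \<theta> * A + \<theta> * B * \<alpha>" using AB(1) by (simp add: algebra_simps)
  then have "2 * (\<theta> * z) = 2 * (x + y * \<alpha>)" unfolding x y by (simp add: algebra_simps)
  then have tz: "\<theta> * z = x + y * \<alpha>" by (rule two_cancel)
  \<comment> \<open>Write \<open>x + y * \<alpha>\<close> as
    \<open>(x + y) + y * (\<alpha> - 1)\<close>: the first summand is in \<open>OK\<close> and in
    \<open>P\<close>, so it is locally a multiple of 2 and hence of
    \<open>(\<alpha> - 1)\<^sup>2\<close>.\<close>
  have "\<theta> * z - y * (\<alpha> - 1) \<in> P" 
    by (rule P_diff[OF P_multl[OF inO[OF theta(1)] zP] P_multl[OF inO[OF y(1)] pi_in_P]])
  then have "x + y \<in> P" unfolding tz by (simp add: algebra_simps)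
  then obtain t where t: "t \<in> OK" "\<theta> * (x + y) = 2 * t" using theta_half OK_add[OF x(1) y(1)] by blast
  show "\<exists>d\<in>U. \<exists>r\<in>OF. d * z = (\<alpha> - 1) * r"
  proof (intro bexI)
    have "\<theta> * (\<theta> * z) = 2 * t + \<theta> * y * (\<alpha> - 1)" unfolding tz t(2)[symmetric] by (simp add: algebra_simps)
    then have "(\<omega> - \<alpha>) * (\<theta> * (\<theta> * z)) = (\<omega> - \<alpha>) * (2 * t + \<theta> * y * (\<alpha> - 1))"
      by (simp only:)
    also have "\<dots> = 2 * (\<omega> - \<alpha>) * t + (\<omega> - \<alpha>) * (\<theta> * y * (\<alpha> - 1))"
      by (simp add: algebra_simps)
    finally have "(\<omega> - \<alpha>) * (\<theta> * (\<theta> * z)) = 2 * (\<omega> - \<alpha>) * t + (\<omega> - \<alpha>) * (\<theta> * y * (\<alpha> - 1))" .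
    then show "((\<omega> - \<alpha>) * (\<theta> * \<theta>)) * z = (\<alpha> - 1) * ((\<alpha> - 1) * t + (\<omega> - \<alpha>) * (\<theta> * y))"
      unfolding pi_square[symmetric] by (simp add: power2_eq_square mult_ac distrib_left)
    show "(\<omega> - \<alpha>) * (\<theta> * \<theta>) \<in> U" by (intro U_mult dU tU)
    show "(\<alpha> - 1) * t + (\<omega> - \<alpha>) * (\<theta> * y) \<in> OF"
      by (rule int_add[OF int_mult[OF P_subset[OF pi_in_P] inO[OF t(1)]]
            int_mult[OF dO int_mult[OF inO[OF theta(1)] inO[OF y(1)]]]])
  qed
qed (use fraction_F F_intros in auto)

end

section \<open>The valuation of the logarithm\<close>

context quartic_ramified
begin

lemma vge_two: "vge 2 2"
  using hasval_imp_vge[OF hasval_two] by simp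

lemma vge_OK: "z \<in> OK \<Longrightarrow> vge 0 z"
  by (rule vge_int[OF inO])

lemma hasval_theta: "hasval 0 \<theta>"
  using theta inO by (intro hasval_unit) blast

lemma P_OK_iff: "z \<in> OK \<Longrightarrow> z \<in> P \<longleftrightarrow> vge 1 z"
  using P_iff_vge[OF inO] by blast

lemma alpha_vge: "vge 0 \<alpha>"
  by (rule vge_int[OF alpha_int])

text \<open>\<open>K\<close> is unramified at \<open>P \<inter> K\<close>, so \<open>P\<close>-adic valuations of elements of \<open>K\<close> are even.\<close>

lemma vge_even_OK:
  assumes "z \<in> OK" "vge (2 * int j + 1) z"
  shows "\<exists>t\<in>OK. \<theta> ^ Suc j * z = 2 ^ Suc j * t"
  using assms
proof (induction j arbitrary: z)
  case 0
  then have "z \<in> P" using P_OK_iff by simp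
  then show ?case using theta_half 0 by simp
next
  case (Suc j)
  have "vge 1 z" using Suc.prems(2) by (rule vge_mono) simp
  then obtain t where t: "t \<in> OK" "\<theta> * z = 2 * t" using theta_half P_OK_iff Suc.prems(1) by blast
  have "vge (0 + (2 * int (Suc j) + 1)) (\<theta> * z)"
    by (rule vge_mult[OF hasval_imp_vge[OF hasval_theta] Suc.prems(2)])
  then have "vge (2 + (2 * int j + 1)) (2 * t)" unfolding t(2) by (rule vge_mono) simp
  then have "vge (2 * int j + 1) t" using vge_cancel[OF hasval_two, of "2 * int j + 1" t] by simp
  from Suc.IH[OF t(1) this] obtain t' where t': "t' \<in> OK" "\<theta> ^ Suc j * t = 2 ^ Suc j * t'" by blast
  have "\<theta> ^ Suc (Suc j) * z = \<theta> ^ Suc j * (\<theta> * z)" by simp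
  also have "\<dots> = 2 * (\<theta> ^ Suc j * t)" unfolding t(2) by simp
  also have "\<dots> = 2 ^ Suc (Suc j) * t'" unfolding t'(2) by simp
  finally show ?case using t'(1) by blast
qed

lemma hasval_power: "hasval k z \<Longrightarrow> hasval (int n * k) (z ^ n)"
proof (induction n)
  case 0
  show ?case using hasval_unit[OF U_1] by simp
next
  case (Suc n)
  then show ?case using hasval_mult[OF Suc.prems Suc.IH] by (simp add: algebra_simps)
qed

lemma vge_even_OK':
  assumes "z \<in> OK" "vge (2 * j - 1) z"
  shows "vge (2 * j) z"
proof (cases "j \<le> 0")
  case True
  then show ?thesis using vge_OK[OF assms(1)] by (auto elim: vge_mono)
next
  case False
  define i where "i = nat (j - 1)"
  have i: "j = int i + 1" using False by (simp add: i_def)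
  then obtain t where t: "t \<in> OK" "\<theta> ^ Suc i * z = 2 ^ Suc i * t"
    using vge_even_OK[OF assms(1), of i] assms(2) by (auto simp: algebra_simps)
  have h: "hasval (int (Suc i) * 0) (\<theta> ^ Suc i)" "hasval (int (Suc i) * int 2) (2 ^ Suc i)"
    by (rule hasval_power[OF hasval_theta], rule hasval_power[OF hasval_two])
  have "vge (int (Suc i) * int 2 + 0) (2 ^ Suc i * t)"
    by (rule vge_mult[OF hasval_imp_vge[OF h(2)] vge_OK[OF t(1)]])
  then have "vge (int (Suc i) * 0 + 2 * j) (\<theta> ^ Suc i * z)" unfolding t(2) i by (simp add: algebra_simps)
  then show ?thesis by (rule vge_cancel[OF h(1)])
qed

lemma hasval_int_even: "N \<noteq> 0 \<Longrightarrow> \<exists>i. hasval (2 * int i) (of_int N)"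
proof -
  assume N: "N \<noteq> 0"
  have "hasval (2 * int (multiplicity 2 (nat \<bar>N\<bar>))) (of_nat (nat \<bar>N\<bar>))"
    using hasval_of_nat[of "nat \<bar>N\<bar>"] N by simp
  moreover have "hasval 0 (-1)" using hasval_neg_one_power[of 1] by simp
  ultimately have "hasval (2 * int (multiplicity 2 (nat \<bar>N\<bar>))) (of_nat (nat \<bar>N\<bar>))"
     "hasval (2 * int (multiplicity 2 (nat \<bar>N\<bar>))) (- of_nat (nat \<bar>N\<bar>))"
    using hasval_mult[of 0 "-1"] by fastforce+
  then show ?thesis by (cases "N \<ge> 0") auto
qed

lemma vge_even:
  assumes "z \<in> K" "vge (2 * j - 1) z"
  shows "vge (2 * j) z"
proof -
  obtain N where N: "N \<noteq> 0" "of_int N * z \<in> OK" using fraction_K[OF assms(1)] by blast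
  obtain i where i: "hasval (2 * int i) (of_int N)" using hasval_int_even[OF N(1)] by blast
  have "vge (2 * int i + (2 * j - 1)) (of_int N * z)" by (rule vge_mult[OF hasval_imp_vge[OF i] assms(2)])
  then have "vge (2 * (int i + j) - 1) (of_int N * z)" by (simp add: algebra_simps)
  then have "vge (2 * (int i + j)) (of_int N * z)" by (rule vge_even_OK'[OF N(2)])
  then have "vge (2 * int i + 2 * j) (of_int N * z)" by (simp add: algebra_simps)
  then show ?thesis by (rule vge_cancel[OF i])
qed

text \<open>At \<open>P\<close> the residue field of \<open>K\<close> has two elements and 2 is a
  uniformizer. The denominator of \<open>z\<close> is cleared by a multiplier \<open>w\<close>
  outside \<open>P\<close>, which is 1 modulo \<open>P\<close> and so does not change the residue;
  evenness of valuations on \<open>K\<close> doubles the precision.\<close>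

lemma K_residue:
  assumes om: "\<omega> \<in> P" and z: "z \<in> K" "vge 0 z"
  shows "vge 2 z \<or> vge 2 (z - 1)"
proof -
  obtain N where N: "N \<noteq> 0" "of_int N * z \<in> OK" using fraction_K[OF z(1)] by blast
  define j where "j = multiplicity 2 N"
  obtain M where M: "N = 2 ^ j * M" "odd M"
    using multiplicity_decompose'[of N 2] N unfolding j_def by auto
  have h2: "hasval (int j * 2) (2 ^ j)" using hasval_power[OF hasval_two, of j] by simp
  have MO: "of_int M * \<theta> ^ j \<in> OK" by (intro OK_intros theta)
  have MU: "of_int M * \<theta> ^ j \<in> U"
    using M P_even theta inO by (intro U_mult U_power) (auto intro: int_of_int)
  have "\<exists>t\<in>OK. \<theta> ^ j * (of_int N * z) = 2 ^ j * t"
  proof (cases j)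
    case 0
    then show ?thesis using N by simp
  next
    case (Suc i)
    have "vge (int j * 2 + 0) (2 ^ j * (of_int M * z))"
      by (intro vge_mult hasval_imp_vge[OF h2] vge_mult[of 0 _ 0, simplified] vge_int int_of_int z)
    then have "vge (2 * int i + 1) (2 ^ j * (of_int M * z))" by (rule vge_mono) (simp add: Suc)
    then have "vge (2 * int i + 1) (of_int N * z)" unfolding M(1) by (simp add: mult.assoc)
    then show ?thesis using vge_even_OK[OF N(2), of i] Suc by simp
  qed
  then obtain t where t: "t \<in> OK" "\<theta> ^ j * (of_int N * z) = 2 ^ j * t" by blast
  have "2 ^ j * ((of_int M * \<theta> ^ j) * z) = \<theta> ^ j * (of_int N * z)" by (simp add: M(1))
  then have w: "(of_int M * \<theta> ^ j) * z = t" unfolding t(2) by simp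
  define w where "w = of_int M * \<theta> ^ j"
  have wz: "w * z = t" and wO: "w \<in> OK" and wU: "hasval 0 w"
    using w MO hasval_unit[OF MU] by (simp_all add: w_def)
  have "w \<notin> P" using MU by (simp add: w_def)
  then have w1: "vge 1 (w - 1)" using OK_P_cases[OF wO om] P_OK_iff[of "w - 1"] wO by (auto intro: OK_intros)
  have "vge 1 t \<or> vge 1 (t - 1)" using OK_P_cases[OF t(1) om] P_OK_iff[OF t(1)] P_OK_iff[of "t - 1"] t(1)
    by (auto intro: OK_intros)
  then have "vge 1 z \<or> vge 1 (z - 1)"
  proof
    assume "vge 1 t"
    then have "vge (0 + 1) (w * z)" unfolding wz by simp
    then show ?thesis using vge_cancel[OF wU] by blast
  next
    assume "vge 1 (t - 1)"
    then have "vge 1 ((t - 1) - (w - 1))" by (rule vge_diff[OF _ w1])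
    then have "vge (0 + 1) (w * (z - 1))" by (simp add: algebra_simps flip: wz)
    then show ?thesis using vge_cancel[OF wU] by blast
  qed
  then show ?thesis using vge_even[of z 1] vge_even[of "z - 1" 1] z K_intros(1,7) by auto
qed

text \<open>
  The terms of the logarithm series that can have valuation less than 4.
\<close>

definition log_head :: "complex \<Rightarrow> complex" where
  "log_head z = z - z\<^sup>2 / 2 + z ^ 3 / 3 - z ^ 4 / 4 - z ^ 8 / 8"

text \<open>With \<open>e = 2\<close> the \<open>n\<close>-th term has valuation at least
  \<open>n - 2 * multiplicity 2 n\<close>. The five exceptional indices give 1, 0, 3, 0 and
  2.\<close>

lemma log_index_bound:
  assumes "n > 0" "n \<notin> {1, 2, 3, 4, 8::nat}"
  shows "int n - 2 * int (multiplicity 2 n) \<ge> 4"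
proof -
  define m where "m = multiplicity 2 n"
  have d: "2 ^ m dvd n" unfolding m_def by (rule multiplicity_dvd)
  consider "m = 0" | "m = 1" | "m = 2" | "m = 3" | "m \<ge> 4" by linarith
  then show ?thesis
  proof cases
    case 5
    have "2 * k + 4 \<le> (2::nat) ^ k" if "k \<ge> 4" for k
      using that by (induction k rule: dec_induct) auto
    then have "2 * m + 4 \<le> 2 ^ m" using 5 by blast
    also have "\<dots> \<le> n" using d assms(1) by (rule dvd_imp_le)
    finally show ?thesis unfolding m_def[symmetric] by linarith
  next
    case 1
    then show ?thesis using assms unfolding m_def[symmetric] by auto
  next
    case 2
    then have "2 dvd n" using d by simp
    then obtain k where "n = 2 * k" by blast
    then show ?thesis using assms 2 unfolding m_def[symmetric] by auto
  next
    case 3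
    then have "4 dvd n" using d by simp
    then obtain k where "n = 4 * k" by blast
    then show ?thesis using assms 3 unfolding m_def[symmetric] by auto
  next
    case 4
    then have "8 dvd n" using d by simp
    then obtain k where "n = 8 * k" by blast
    then show ?thesis using assms 4 unfolding m_def[symmetric] by auto
  qed
qed

lemma log_partial_head:
  assumes "vge 1 z" "N \<ge> 8"
  shows "vge 4 (log_partial z N - log_head z)"
proof -
  define f where "f n = (-1) ^ (n + 1) / of_nat n * z ^ n" for n
  have "{1..N} = {1, 2, 3, 4, 8} \<union> ({1..N} - {1, 2, 3, 4, 8})" using assms(2) by auto
  then have "log_partial z N = sum f {1, 2, 3, 4, 8} + sum f ({1..N} - {1, 2, 3, 4, 8})"
    unfolding log_partial_def f_def[symmetric] by (subst sum.union_disjoint[symmetric]) auto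
  moreover have "sum f {1, 2, 3, 4, 8} = log_head z"
    by (simp add: f_def log_head_def)
  ultimately have "log_partial z N - log_head z = sum f ({1..N} - {1, 2, 3, 4, 8})" by simp
  also have "vge 4 \<dots>"
  proof (rule vge_sum)
    fix n assume n: "n \<in> {1..N} - {1, 2, 3, 4, 8}"
    then have "int n - int 2 * int (multiplicity 2 n) \<ge> 4" using log_index_bound[of n] by auto
    then show "vge 4 (f n)" unfolding f_def using n by (intro vge_mono[OF vge_log_term[OF assms(1)]]) auto
  qed
  finally show ?thesis .
qed

lemma log_head_in_F: "z \<in> F \<Longrightarrow> log_head z \<in> F"
  unfolding log_head_def by (intro F_intros)

lemma ord_log_eq:
  assumes "\<eta> \<in> F" "vge 1 (\<eta> - 1)" "hasval k (log_head (\<eta> - 1))" "k < 4"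
  shows "ord_completion F P (log_completion F P (to_completion F P \<eta>)) = ereal (of_int k)"
proof -
  have zF: "\<eta> - 1 \<in> F" using assms F_intros by simp
  have car: "log_partial (\<eta> - 1) \<in> carrier CR" by (rule log_partial_cauchy[OF zF assms(2)])
  have "hasval k (log_partial (\<eta> - 1) N)" if "N \<ge> 8" for N
  proof -
    have "vge (k + 1) (log_partial (\<eta> - 1) N - log_head (\<eta> - 1))"
      by (rule vge_mono[OF log_partial_head[OF assms(2) that]]) (use assms(4) in simp)
    then have "hasval k (log_head (\<eta> - 1) + (log_partial (\<eta> - 1) N - log_head (\<eta> - 1)))"
      by (rule hasval_add[OF assms(3) _ log_head_in_F[OF zF] F_intros(7)[OF cauchyD(1)[OF car] log_head_in_F[OF zF]]])
    then show ?thesis by simp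
  qed
  then show ?thesis unfolding log_completion_eq[OF assms(1,2)]
    by (intro ord_completion_hasval[OF car, of 8]) blast
qed

lemma ord_log_ge:
  assumes "\<eta> \<in> F" "vge 1 (\<eta> - 1)" "vge 4 (log_head (\<eta> - 1))"
  shows "ord_completion F P (log_completion F P (to_completion F P \<eta>)) \<ge> 4"
proof -
  have zF: "\<eta> - 1 \<in> F" using assms F_intros by simp
  have car: "log_partial (\<eta> - 1) \<in> carrier CR" by (rule log_partial_cauchy[OF zF assms(2)])
  have "vge 4 (log_partial (\<eta> - 1) N)" if "N \<ge> 8" for N
    using vge_add[OF log_partial_head[OF assms(2) that] assms(3)] by simp
  then have "ereal (of_int 4) \<le> ord_completion F P (cls (log_partial (\<eta> - 1)))"
    unfolding ord_completion_ge_iff[OF car] by blast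
  then show ?thesis unfolding log_completion_eq[OF assms(1,2)] by simp
qed

end

section \<open>The logarithm of a unit of relative norm 1\<close>

locale quartic_unit = quartic_ramified +
  fixes x y :: complex
  assumes xy: "x \<in> K" "y \<in> K" and norm_one: "x\<^sup>2 - s * y\<^sup>2 = 1" and unit_int: "x + y * \<alpha> \<in> OF"
begin

abbreviation "\<eta> \<equiv> x + y * \<alpha>"
abbreviation "\<delta> \<equiv> \<eta> - 1"

lemma eta_F: "\<eta> \<in> F" using unit_int by (simp add: integers_of_def)

lemma delta_F: "\<delta> \<in> F" using eta_F F_intros by simp

lemma eta_square: "\<eta>\<^sup>2 = 2 * x * \<eta> - 1"
  by (rule unit_quadratic[OF norm_one])

lemma delta_square: "\<delta>\<^sup>2 = 2 * (x - 1) * \<eta>"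
  using eta_square by Groebner_Basis.algebra

text \<open>\<open>2 * x\<close> and \<open>2 * y\<close> lie in \<open>P\<close> by
  \<open>coordinates_in_P\<close>; as elements of \<open>K\<close> they have even valuation, hence
  at least 2, which cancels the factor 2.\<close>

lemma vge_xy: "vge 0 x" "vge 0 y" and double_OK: "2 * x \<in> OK" "2 * y \<in> OK"
proof -
  show xO: "2 * x \<in> OK" by (rule trace_norm_OK(1)[OF xy unit_int])
  have "s * (2 * y)\<^sup>2 = (2 * x)\<^sup>2 - 4" using norm_one by Groebner_Basis.algebra
  also have "\<dots> \<in> OK" by (intro OK_intros xO)
  finally show yO: "2 * y \<in> OK" by (rule OK_half_y[rotated]) (intro K_intros xy)
  have "(2 * x)\<^sup>2 - s * (2 * y)\<^sup>2 = 4 * 1" using norm_one by Groebner_Basis.algebra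
  from coordinates_in_P[OF xO yO OK_simple(2) this]
  have "vge 1 (2 * x)" "vge 1 (2 * y)" using P_OK_iff xO yO by auto
  then have "vge (int 2 + 0) (2 * x)" "vge (int 2 + 0) (2 * y)"
    using vge_even[of "2 * x" 1] vge_even[of "2 * y" 1] K_intros(4)[OF K_intros(12)] xy by auto
  then show "vge 0 x" "vge 0 y" using vge_cancel[OF hasval_two] by blast+
qed

lemma vge_eta: "vge 0 \<eta>" by (rule vge_int[OF unit_int])

lemma vge_delta: "vge 1 \<delta>"
proof -
  have "vge (2 + 0 + 0) (2 * (x - 1) * \<eta>)"
    using vge_two vge_diff[OF vge_xy(1) vge_int[OF int_1]] vge_eta by (intro vge_mult)
  then have "vge (2 * 1 - 1) (\<delta>\<^sup>2)" unfolding delta_square by (rule vge_mono) simp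
  then show ?thesis by (rule vge_square[OF _ delta_F])
qed

lemma hasval_eta: "hasval 0 \<eta>"
  using hasval_add[OF hasval_unit[OF U_1], of \<delta>] vge_delta F_intros(1) delta_F by simp

lemma vge_third: "vge 0 (1 / 3)"
proof -
  have "3 \<notin> P" using P_even_nat[of 3] by simp
  then have "hasval 0 3" using hasval_unit[of 3] int_numeral by simp
  then show ?thesis using hasval_imp_vge[OF hasval_inverse, of 0 3] by (simp add: field_simps)
qed

text \<open>With \<open>E = (x - 1) * \<eta>\<close> and \<open>\<delta>\<^sup>2 = 2 * E\<close>,
  the powers 2, 4 and 8 over their indices become \<open>E\<close>, \<open>E\<^sup>2\<close> and
  \<open>2 * E ^ 4\<close>: the denominators disappear.\<close>

lemma log_head_delta:
  "log_head \<delta> = \<delta> - (x - 1) * \<eta> + 2 * (1 / 3) * (x - 1) * \<eta> * \<delta> - ((x - 1) * \<eta>)\<^sup>2 - 2 * ((x - 1) * \<eta>) ^ 4"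
proof -
  define D E where "D = \<delta>" and "E = (x - 1) * \<eta>"
  have 2: "D\<^sup>2 = 2 * E" unfolding D_def E_def delta_square by simp
  have "D ^ 3 = D\<^sup>2 * D" "D ^ 4 = (D\<^sup>2)\<^sup>2" "D ^ 8 = (D\<^sup>2) ^ 4"
    by (simp_all add: power3_eq_cube power2_eq_square power4_eq_xxxx eval_nat_numeral)
  then have "log_head D = D - E + 2 * (1 / 3) * E * D - E\<^sup>2 - 2 * E ^ 4"
    unfolding log_head_def 2 by (simp add: power_mult_distrib)
  then show ?thesis unfolding D_def E_def by (simp only: mult.assoc)
qed

lemma vge_c: "vge 0 (x - 1)" by (rule vge_diff[OF vge_xy(1) vge_int[OF int_1]])

lemma vge_power0: "vge 0 z \<Longrightarrow> vge 0 (z ^ n)"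
proof (induction n)
  case (Suc n)
  then show ?case using vge_mult[of 0 z 0 "z ^ n"] by simp
qed (simp add: vge_int int_1)

lemma vge_mult0: "vge 0 w \<Longrightarrow> vge k z \<Longrightarrow> vge k (w * z)" "vge k z \<Longrightarrow> vge 0 w \<Longrightarrow> vge k (z * w)"
  using vge_mult[of 0 w k z] vge_mult[of k z 0 w] by simp_all

text \<open>The only case for 2 inert: then \<open>\<delta>\<^sup>2 / 2\<close> is neither 0 nor 1 in the residue field with four elements.\<close>

lemma ord_log_inert:
  assumes "\<not> vge 1 x" "\<not> vge 1 (x - 1)"
  shows "ord_completion F P (log_completion F P (to_completion F P \<eta>)) = 0"
proof -
  let ?c = "x - 1"
  have F: "x \<in> F" "?c \<in> F" using xy K_subset_F F_intros by auto
  have hx: "hasval 0 x" and hc: "hasval 0 ?c"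
    using hasval_iff[OF F(1), of 0] hasval_iff[OF F(2), of 0] assms vge_xy vge_c by auto
  have cd: "vge 1 (?c * \<delta>)" by (rule vge_mult0(1)[OF vge_c vge_delta])
  have "hasval 0 (x + ?c * \<delta>)" using cd by (intro hasval_add[OF hx] F F_intros(4)[OF F(2) delta_F]) simp
  then have "hasval (0 + 0 + 0) (?c * \<eta> * (x + ?c * \<delta>))" by (intro hasval_mult hc hasval_eta)
  then have main: "hasval 0 (- (?c * \<eta> * (x + ?c * \<delta>)))"
    using hasval_mult[OF hasval_neg_one_power[of 1]] by fastforce
  have ce: "vge 0 (?c * \<eta>)" by (rule vge_mult0(1)[OF vge_c vge_eta])
  define R where "R = \<delta> + 2 * (1 / 3) * ?c * \<eta> * \<delta> - 2 * (?c * \<eta>) ^ 4"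
  have "vge 0 2" using vge_two by (rule vge_mono) simp
  then have 1: "vge 1 (2 * (1 / 3) * ?c * \<eta> * \<delta>)"
    by (intro vge_mult0(1)[OF _ vge_delta] vge_mult0(1)[OF _ vge_eta] vge_mult0(1)[OF _ vge_c]
        vge_mult0(1)[OF _ vge_third])
  have "vge 2 (2 * (?c * \<eta>) ^ 4)" by (rule vge_mult0(2)[OF vge_two vge_power0[OF ce]])
  then have 2: "vge 1 (2 * (?c * \<eta>) ^ 4)" by (rule vge_mono) simp
  have R: "vge (0 + 1) R" unfolding R_def using vge_diff[OF vge_add[OF vge_delta 1] 2] by simp
  \<comment> \<open>The terms of index 2 and 4 contribute \<open>- E - E\<^sup>2\<close> with
    \<open>E = ?c * \<eta>\<close>, and \<open>1 + E = x + ?c * \<delta>\<close>.\<close>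
  have eq: "log_head \<delta> = - (?c * \<eta> * (x + ?c * \<delta>)) + R"
    unfolding log_head_delta R_def by (simp add: algebra_simps power2_eq_square)
  have "R \<in> F" unfolding R_def by (intro F_intros delta_F F eta_F)
  moreover have "- (?c * \<eta> * (x + ?c * \<delta>)) \<in> F" by (intro F_intros delta_F F eta_F)
  ultimately have "hasval 0 (log_head \<delta>)" unfolding eq using hasval_add[OF main R] by simp
  from ord_log_eq[OF eta_F vge_delta this] show ?thesis by (simp add: zero_ereal_def)
qed

text \<open>For \<open>x \<equiv> 0\<close> the single terms have too small a valuation. This
  arrangement isolates \<open>(x - 1) * x\<close>, which has the valuation of \<open>x\<close>, and
  gives every other term valuation at least 3.\<close>

lemma log_head_split:
  "log_head \<delta> = - ((x - 1) * x) + (\<delta> * (2 - x) - 2 * (x - 1)\<^sup>2 * \<delta>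
     - 2 * (x - 1) ^ 3 * \<eta> * (x + (x - 1) * (\<delta> * (\<eta>\<^sup>2 + \<eta> + 1))) + 2 * (1 / 3) * (x - 1) * \<eta> * \<delta>)"
proof -
  have aux: "d - c * (d + 1) + 2 * t * c * (d + 1) * d - (c * (d + 1))\<^sup>2 - 2 * (c * (d + 1)) ^ 4 =
    - (c * (c + 1)) + (d * (2 - (c + 1)) - 2 * c\<^sup>2 * d -
      2 * c ^ 3 * (d + 1) * ((c + 1) + c * (d * ((d + 1)\<^sup>2 + (d + 1) + 1))) + 2 * t * c * (d + 1) * d)"
    if "d\<^sup>2 = 2 * c * (d + 1)" for c d t :: complex
    using that by Groebner_Basis.algebra
  have e: "\<delta> + 1 = \<eta>" "x - 1 + 1 = x" by simp_all
  show ?thesis unfolding log_head_delta by (rule aux[of \<delta> "x - 1" "1 / 3", unfolded e, OF delta_square])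
qed

lemma vge_cube_part: "vge 1 (\<delta> * (\<eta>\<^sup>2 + \<eta> + 1))"
  by (rule vge_mult0(2)[OF vge_delta vge_add[OF vge_add[OF vge_power0[OF vge_eta] vge_eta] vge_int[OF int_1]]])

lemma ord_log_split_7:
  assumes "hasval 2 x"
  shows "ord_completion F P (log_completion F P (to_completion F P \<eta>)) = 2"
proof -
  let ?c = "x - 1"
  have x2: "vge 2 x" by (rule hasval_imp_vge[OF assms])
  have F: "x \<in> F" "?c \<in> F" using xy K_subset_F F_intros by auto
  have "hasval 0 (- 1 + x)" using hasval_neg_one_power[of 1] F F_intros(1,5) vge_mono[OF x2, of 1]
    by (intro hasval_add) auto
  then have hc: "hasval 0 ?c" by simp
  have main: "hasval 2 (- (?c * x))"
    using hasval_mult[OF hasval_neg_one_power[of 1] hasval_mult[OF hc assms]] by simp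
  define R where "R = \<delta> * (2 - x) - 2 * ?c\<^sup>2 * \<delta>
     - 2 * ?c ^ 3 * \<eta> * (x + ?c * (\<delta> * (\<eta>\<^sup>2 + \<eta> + 1))) + 2 * (1 / 3) * ?c * \<eta> * \<delta>"
  have 1: "vge (1 + 2) (\<delta> * (2 - x))" by (rule vge_mult[OF vge_delta vge_diff[OF vge_two x2]])
  have 2: "vge (2 + 1) (2 * ?c\<^sup>2 * \<delta>)" by (rule vge_mult[OF vge_mult0(2)[OF vge_two vge_power0[OF vge_c]] vge_delta])
  have "vge 1 (x + ?c * (\<delta> * (\<eta>\<^sup>2 + \<eta> + 1)))"
    by (rule vge_add[OF vge_mono[OF x2] vge_mult0(1)[OF vge_c vge_cube_part]]) simp
  then have 3: "vge (2 + 1) (2 * ?c ^ 3 * \<eta> * (x + ?c * (\<delta> * (\<eta>\<^sup>2 + \<eta> + 1))))"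
    by (rule vge_mult[OF vge_mult0(2)[OF vge_mult0(2)[OF vge_two vge_power0[OF vge_c]] vge_eta]])
  have 4: "vge (2 + 1) (2 * (1 / 3) * ?c * \<eta> * \<delta>)"
    by (rule vge_mult[OF vge_mult0(2)[OF vge_mult0(2)[OF vge_mult0(2)[OF vge_two vge_third] vge_c] vge_eta] vge_delta])
  have R: "vge (2 + 1) R" unfolding R_def
    using 1 2 3 4 by (intro vge_add vge_diff) simp_all
  have "R \<in> F" unfolding R_def by (intro F_intros delta_F F eta_F)
  moreover have "- (?c * x) \<in> F" by (intro F_intros F)
  ultimately have "hasval 2 (log_head \<delta>)"
    unfolding log_head_split R_def[symmetric] by (intro hasval_add[OF main R])
  from ord_log_eq[OF eta_F vge_delta this] show ?thesis by simp
qed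

lemma ord_log_split_15:
  assumes x4: "vge 4 x"
  shows "ord_completion F P (log_completion F P (to_completion F P \<eta>)) \<ge> 4"
proof (rule ord_log_ge[OF eta_F vge_delta])
  let ?c = "x - 1"
  have v0: "vge 0 2" "vge 0 1" "vge 0 3" "vge 0 \<delta>"
    using vge_mono[OF vge_delta, of 0] by (auto intro: vge_int int_numeral int_1)
  have 2: "vge 4 (2 * \<delta> * (2 - x) * x)"
    by (intro vge_mult0(1)[OF _ x4] vge_mult0(1)[OF _ vge_diff[OF v0(1) vge_xy(1)]] vge_mult0(1)[OF v0(1) v0(4)])
  have 1: "vge 4 (x * \<delta>)" "vge 4 (?c * x)" by (rule vge_mult0(2)[OF x4 v0(4)], rule vge_mult0(1)[OF vge_c x4])
  have 3: "vge 4 (2 * ?c ^ 3 * \<eta> * x)"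
    by (intro vge_mult0(1)[OF _ x4] vge_mult0(1)[OF _ vge_eta] vge_mult0(1)[OF v0(1) vge_power0[OF vge_c]])
  \<comment> \<open>\<open>J\<close> is
    \<open>1 / 3 - ?c ^ 3 * (\<eta>\<^sup>2 + \<eta> + 1)\<close>, rewritten with
    \<open>?c ^ 3 + 1 = x * (1 - ?c + ?c\<^sup>2)\<close> and \<open>\<eta> = 1 + \<delta>\<close>.
    The leading part \<open>1 / 3 + 3 = 10 / 3\<close> is even, which supplies the missing power of
    \<open>P\<close>.\<close>
  define J where "J = (1 / 3) * (10 - 9 * (x * (1 - ?c + ?c\<^sup>2))) - ?c ^ 3 * (\<delta> * (3 + \<delta>))"
  have "vge (2 + 0) (2 * 5)" by (rule vge_mult[OF vge_two vge_int[OF int_numeral]])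
  then have "vge 1 (2 * 5)" by (rule vge_mono) simp
  then have "vge 1 10" by simp
  moreover have "vge 1 (9 * (x * (1 - ?c + ?c\<^sup>2)))"
    by (rule vge_mult0(1)[OF vge_int[OF int_numeral] vge_mult0(2)[OF vge_mono[OF x4]
        vge_add[OF vge_diff[OF v0(2) vge_c] vge_power0[OF vge_c]]]]) simp
  ultimately have J1: "vge 1 ((1 / 3) * (10 - 9 * (x * (1 - ?c + ?c\<^sup>2))))"
    by (intro vge_mult0(1)[OF vge_third] vge_diff)
  have J2: "vge 1 (?c ^ 3 * (\<delta> * (3 + \<delta>)))"
    by (rule vge_mult0(1)[OF vge_power0[OF vge_c] vge_mult0(2)[OF vge_delta vge_add[OF v0(3,4)]]])
  have J: "vge 1 J" unfolding J_def by (rule vge_diff[OF J1 J2])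
  have 4: "vge (2 + 0 + 0 + 1 + 1) (2 * ?c * \<eta> * \<delta> * J)"
    by (intro vge_mult vge_two vge_c vge_eta vge_delta J)
  have eq: "log_head \<delta> = 2 * \<delta> * (2 - x) * x - x * \<delta> - ?c * x - 2 * ?c ^ 3 * \<eta> * x + 2 * ?c * \<eta> * \<delta> * J"
  proof -
    define c d t where "c = x - 1" and "d = \<delta>" and "t = (1 / 3 :: complex)"
    have e: "\<eta> = d + 1" by (simp add: d_def)
    have xc: "x = c + 1" by (simp add: c_def)
    have t: "3 * t = 1" by (simp add: t_def)
    show ?thesis
      unfolding log_head_split J_def unfolding d_def[symmetric] t_def[symmetric] e xc using t by Groebner_Basis.algebra
  qed
  show "vge 4 (log_head \<delta>)" unfolding eq using 1 2 3 4 by (intro vge_add vge_diff) simp_all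
qed

lemma hasval_s: "hasval 0 s"
proof -
  have 2: "vge 2 (2 * \<omega>)" by (rule vge_mult0(2)[OF vge_two vge_OK[OF omega_OK]])
  have "hasval 0 (- 1 + 2 * \<omega>)"
    using hasval_neg_one_power[of 1] vge_mono[OF 2, of 1] K_subset_F[OF OK_subset[OF omega_OK]]
    by (intro hasval_add) (auto intro: F_intros)
  moreover have "- 1 + 2 * \<omega> = s" by (simp add: \<omega>_def)
  ultimately show ?thesis by simp
qed

text \<open>An odd square is 1 modulo 8, and 8 has valuation 6: for \<open>z = 1 + 2 * w\<close> the
  difference is \<open>4 * w * (w + 1)\<close>, and one of the two last factors is even by
  \<open>K_residue\<close>.\<close>

lemma square_minus_one:
  assumes om: "\<omega> \<in> P" and z: "z \<in> K" "vge 2 (z - 1)"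
  shows "vge 6 (z\<^sup>2 - 1)"
proof -
  define w where "w = (z - 1) / 2"
  have zw: "z - 1 = 2 * w" by (simp add: w_def)
  have wK: "w \<in> K" unfolding w_def by (intro K_intros z)
  have "vge (int 2 + 0) (2 * w)" using z(2) by (simp flip: zw)
  then have w0: "vge 0 w" by (rule vge_cancel[OF hasval_two])
  have "vge 2 (w * (w + 1))"
    using K_residue[OF om wK w0]
  proof
    assume "vge 2 w"
    then show ?thesis by (rule vge_mult0(2)[OF _ vge_add[OF w0 vge_int[OF int_1]]])
  next
    assume "vge 2 (w - 1)"
    from vge_add[OF this vge_two] have "vge 2 (w + 1)" by (simp add: add.commute)
    then show ?thesis by (rule vge_mult0(1)[OF w0])
  qed
  then have "vge (2 + (2 + 2)) (2 * (2 * (w * (w + 1))))" by (intro vge_mult vge_two)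
  moreover have "2 * (2 * (w * (w + 1))) = z\<^sup>2 - 1" using zw by Groebner_Basis.algebra
  ultimately show ?thesis by simp
qed

text \<open>With \<open>z\<close> even, \<open>u * w\<^sup>2\<close> is odd, so \<open>w\<close> is
  odd. The factor \<open>u\<close> is \<open>s\<close> for the norm equation and \<open>- s\<close>
  for its complex conjugate.\<close>

lemma y_odd:
  assumes om: "\<omega> \<in> P" and z: "w \<in> K" "vge 0 w" and u: "vge 0 u" and eq: "u * w\<^sup>2 = z\<^sup>2 - 1" and z2: "vge 2 z"
  shows "vge 6 (w\<^sup>2 - 1)"
proof -
  have "\<not> vge 2 w"
  proof
    assume "vge 2 w"
    then have "vge (2 + 2) (w\<^sup>2)" unfolding power2_eq_square by (rule vge_mult[OF _ \<open>vge 2 w\<close>])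
    then have "vge 1 (w\<^sup>2)" by (rule vge_mono) simp
    then have 1: "vge 1 (u * w\<^sup>2)" by (rule vge_mult0(1)[OF u])
    have "vge (2 + 2) (z\<^sup>2)" unfolding power2_eq_square by (rule vge_mult[OF z2 z2])
    then have "vge 1 (z\<^sup>2)" by (rule vge_mono) simp
    from vge_diff[OF this 1] have "vge 1 1" by (simp add: eq)
    then show False using hasval_vge_iff[OF hasval_unit[OF U_1]] by simp
  qed
  then have "vge 2 (w - 1)" using K_residue[OF om z] by blast
  then show ?thesis by (rule square_minus_one[OF om z(1)])
qed

text \<open>In \<open>x\<^sup>2 = 1 + s * y\<^sup>2\<close> the square of the odd \<open>y\<close>
  may be replaced by 1 modulo 8, which leaves \<open>1 + s = 2 * \<omega>\<close>.\<close>

lemma x_even_square: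
  assumes om: "\<omega> \<in> P" and x2: "vge 2 x"
  shows "vge 6 (x\<^sup>2 - 2 * \<omega>)"
proof -
  have eq: "s * y\<^sup>2 = x\<^sup>2 - 1" using norm_one by (simp add: algebra_simps)
  have "vge 6 (y\<^sup>2 - 1)" by (rule y_odd[OF om xy(2) vge_xy(2) hasval_imp_vge[OF hasval_s] eq x2])
  then have "vge 6 (s * (y\<^sup>2 - 1))" by (rule vge_mult0(1)[OF hasval_imp_vge[OF hasval_s]])
  moreover have "s * (y\<^sup>2 - 1) = x\<^sup>2 - 2 * \<omega>" using eq s_omega by Groebner_Basis.algebra
  ultimately show ?thesis by simp
qed

text \<open>\<open>s * y\<^sup>2 = c * (c + 2)\<close> is a product of two even factors of which one
  is divisible by 4, so \<open>y\<^sup>2\<close> has valuation at least 6 and \<open>y\<close> at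
  least 4. The two leading terms combine to
  \<open>\<delta> - c * \<eta> = y * \<alpha> - c * \<delta>\<close>.\<close>

lemma ord_log_split_odd:
  assumes om: "\<omega> \<in> P" and c2: "vge 2 (x - 1)"
  shows "ord_completion F P (log_completion F P (to_completion F P \<eta>)) \<ge> 4"
proof (rule ord_log_ge[OF eta_F vge_delta])
  define c where "c = x - 1"
  have cK: "c / 2 \<in> K" unfolding c_def by (intro K_intros xy)
  have c: "vge 2 c" unfolding c_def by (rule c2)
  then have "vge (int 2 + 0) (2 * (c / 2))" by simp
  then have "vge 0 (c / 2)" by (rule vge_cancel[OF hasval_two])
  from K_residue[OF om cK this] have "vge 6 (c * (c + 2))"
  proof
    assume "vge 2 (c / 2)"
    then have "vge (2 + 2) (2 * (c / 2))" by (rule vge_mult[OF vge_two])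
    then have "vge (4 + 2) (c * (c + 2))" by (intro vge_mult vge_add c vge_two) simp
    then show ?thesis by simp
  next
    assume "vge 2 (c / 2 - 1)"
    then have "vge (2 + 2) (2 * (c / 2 - 1))" by (rule vge_mult[OF vge_two])
    then have "vge 4 (c - 2)" by simp
    moreover have "vge (2 + 2) (2 * 2)" by (rule vge_mult[OF vge_two vge_two])
    ultimately have "vge 4 (c - 2 + 2 * 2)" by (intro vge_add) simp_all
    then have "vge 4 (c + 2)" by (simp add: add.commute)
    from vge_mult[OF c this] show ?thesis by simp
  qed
  moreover have "c * (c + 2) = s * y\<^sup>2" using norm_one unfolding c_def by Groebner_Basis.algebra
  ultimately have "vge (0 + 6) (s * y\<^sup>2)" by simp
  then have "vge 6 (y\<^sup>2)" by (rule vge_cancel[OF hasval_s])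
  then have "vge (2 * 3 - 1) (y\<^sup>2)" by (rule vge_mono) simp
  then have "vge (2 * 2 - 1) y" using vge_square[of 3 y] xy K_subset_F by simp
  then have y4: "vge 4 y" using vge_even[OF xy(2), of 2] by simp
  have ya: "vge 4 (y * \<alpha>)" by (rule vge_mult0(2)[OF y4 alpha_vge])
  have "vge 2 (c + y * \<alpha>)" by (rule vge_add[OF c vge_mono[OF ya]]) simp
  then have d: "vge 2 \<delta>" by (simp add: c_def algebra_simps)
  have ce: "vge 2 (c * \<eta>)" by (rule vge_mult0(2)[OF c vge_eta])
  have 1: "vge (2 + 2) (c * \<delta>)" by (rule vge_mult[OF c d])
  have 2: "vge (2 + 0 + 2 + 0 + 2) (2 * (1 / 3) * c * \<eta> * \<delta>)"
    by (intro vge_mult vge_two vge_third c vge_eta d)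
  have 3: "vge (2 + 2) ((c * \<eta>)\<^sup>2)" unfolding power2_eq_square by (rule vge_mult[OF ce ce])
  have "(c * \<eta>) ^ 4 = (c * \<eta>)\<^sup>2 * (c * \<eta>)\<^sup>2" by (simp add: power2_eq_square power4_eq_xxxx)
  then have 4: "vge (2 + (4 + 4)) (2 * (c * \<eta>) ^ 4)" using 3 by (simp only:) (intro vge_mult vge_two, simp_all)
  have eq: "log_head \<delta> = y * \<alpha> - c * \<delta> + 2 * (1 / 3) * c * \<eta> * \<delta> - (c * \<eta>)\<^sup>2 - 2 * (c * \<eta>) ^ 4"
    unfolding log_head_delta c_def by (simp add: algebra_simps)
  show "vge 4 (log_head \<delta>)" unfolding eq
    using ya 1 3 vge_mono[OF 2, of 4] vge_mono[OF 4, of 4] by (intro vge_add vge_diff) simp_all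
qed

end

section \<open>Divisibility by 2 in \<open>K\<close> and the relative norm of a unit\<close>

context quartic_ramified
begin

text \<open>For split 2 the ideal (2) is the product of \<open>P \<inter> K\<close> and its complex
  conjugate; membership in both makes both coordinates with respect to 1, \<open>\<omega>\<close>
  even.\<close>

lemma OK_half_both:
  assumes om: "\<omega> \<in> P" and z: "z \<in> OK" "z \<in> P" "cnj z \<in> P"
  shows "z / 2 \<in> OK"
proof -
  obtain a b where ab: "z = of_int a + of_int b * \<omega>" using z(1) by (rule OK_omega)
  have b: "of_int b * \<omega> \<in> P" by (rule P_multl[OF int_of_int om])
  have "even a" using P_diff[OF z(2) b] P_even[of a] by (simp add: ab)
  have "cnj z = of_int (a + b) - of_int b * \<omega>" by (simp add: ab cnj_omega algebra_simps)
  then have "even (a + b)" using P_add[OF z(3) b] P_even[of "a + b"] by simp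
  then have "even b" using \<open>even a\<close> by simp
  obtain a' where a': "a = 2 * a'" using \<open>even a\<close> by blast
  obtain b' where b': "b = 2 * b'" using \<open>even b\<close> by blast
  have "z / 2 = of_int a' + of_int b' * \<omega>" by (simp add: ab a' b' add_divide_distrib)
  then show ?thesis using omega_OK by (simp only:) (intro OK_intros)
qed

lemma norm_is_one:
  assumes xy: "x \<in> K" "y \<in> K" and unit: "x + y * \<alpha> \<in> OF" "inverse (x + y * \<alpha>) \<in> OF" "x + y * \<alpha> \<noteq> 0"
    and three: "q = 3 \<Longrightarrow> x + y * \<alpha> - 1 \<in> P"
  shows "x\<^sup>2 - s * y\<^sup>2 = 1"
proof -
  define N where "N = x\<^sup>2 - s * y\<^sup>2"
  have xO: "2 * x \<in> OK" and NO: "N \<in> OK" unfolding N_def by (rule trace_norm_OK[OF xy unit(1)])+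
  have Nn: "N * cnj N = 1" unfolding N_def by (rule unit_norm[OF xy unit])
  have "N \<noteq> -1" unfolding N_def by (rule norm_not_minus_one[OF xy xO])
  moreover have "N = 1 \<or> N = -1"
  proof (cases "q = 3")
    case False
    then show ?thesis using norm_one_cases[OF NO Nn] by blast
  next
    case True
    have "s * (2 * y)\<^sup>2 = (2 * x)\<^sup>2 - 4 * N" unfolding N_def by Groebner_Basis.algebra
    also have "\<dots> \<in> OK" by (intro OK_intros xO NO)
    finally have yO: "2 * y \<in> OK" by (rule OK_half_y[rotated]) (intro K_intros xy)
    have "(2 * x)\<^sup>2 - s * (2 * y)\<^sup>2 = 4 * N" unfolding N_def by Groebner_Basis.algebra
    then have yP: "2 * y \<in> P" by (rule coordinates_in_P[OF xO yO NO])
    have e1: "x + y * \<alpha> - 1 \<in> P" by (rule three[OF True])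
    have "x - y * \<alpha> - 1 = (x + y * \<alpha> - 1) - 2 * y * \<alpha>" by simp
    also have "\<dots> \<in> P" by (rule P_diff[OF e1 P_multr[OF yP alpha_int]])
    finally have e2: "x - y * \<alpha> - 1 \<in> P" .
    have "N - 1 = (x + y * \<alpha>) * (x - y * \<alpha> - 1) + (x + y * \<alpha> - 1)"
      unfolding N_def by (simp add: algebra_simps power2_eq_square alpha_mult_alpha)
    also have "\<dots> \<in> P" by (rule P_add[OF P_multl[OF unit(1) e2] e1])
    finally have NP: "N - 1 \<in> P" .
    obtain U V n where UV: "even (U - V)" "2 * N = of_int U + of_int V * s" "N + cnj N = of_int U" "N * cnj N = of_int n"
      "U\<^sup>2 + int q * V\<^sup>2 = 4 * n" using NO by (rule OK_E)
    have "n = 1" using UV(4) Nn by (metis of_int_eq_1_iff)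
    \<comment> \<open>For \<open>q = 3\<close>, \<open>N\<close> is a sixth root of unity. As
      \<open>N - 1\<close> is in \<open>P\<close>, its absolute norm \<open>2 - U\<close> is even,
      and only 1 and -1 have even trace \<open>U\<close>.\<close>
    have "(N - 1) * cnj (N - 1) = N * cnj N - (N + cnj N) + 1" by (simp add: algebra_simps)
    also have "\<dots> = of_int (2 - U)" unfolding Nn UV(3) by simp
    finally have "of_int (2 - U) \<in> P" using P_multr[OF NP inO[OF OK_cnj[OF OK_diff[OF NO OK_simple(2)]]]] by simp
    then have "even (2 - U)" using P_even by blast
    then have "even U" by simp
    then have "even V" using UV(1) by simp
    have eq: "U\<^sup>2 + 3 * V\<^sup>2 = 4" using UV(5) \<open>n = 1\<close> True by simp
    obtain k where k: "V = 2 * k" using \<open>even V\<close> by blast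
    have "k = 0"
    proof (rule ccontr)
      assume "k \<noteq> 0"
      then have "k\<^sup>2 \<ge> 1" by (simp add: int_one_le_iff_zero_less)
      then have "3 * V\<^sup>2 \<ge> 12" unfolding k by (simp add: power2_eq_square)
      then show False using eq by (smt (verit) zero_le_power2)
    qed
    then have "V = 0" "U\<^sup>2 = 4" using eq k by simp_all
    then have "U = 2 \<or> U = -2" using power2_eq_iff[of U 2] by simp
    then show ?thesis using UV(2) \<open>V = 0\<close> by auto
  qed
  ultimately show ?thesis unfolding N_def by blast
qed

end

context quartic_unit
begin

text \<open>
  The coordinate \<open>x\<close> of \<open>\<eta>\<close> may have denominator 2 at the conjugate of \<open>P \<inter> K\<close>, where the residue field of
  \<open>F\<close> has four elements; that of \<open>\<eta> ^ 3\<close> has not.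
\<close>

lemma square_split_odd:
  assumes om: "\<omega> \<in> P" and c2: "vge 2 (x - 1)"
  shows "\<exists>g\<in>F. \<eta> = g\<^sup>2 \<or> \<eta> = - g\<^sup>2"
proof -
  define A where "A = 2 * x"
  have AO: "A \<in> OK" unfolding A_def by (rule double_OK)
  \<comment> \<open>\<open>A\<close> is the relative trace of \<open>\<eta>\<close>, and
    \<open>Z = A ^ 3 - 3 * A - 2\<close> is the relative trace of \<open>\<eta> ^ 3\<close> minus 2.
    The aim is divisibility of \<open>Z\<close> by 4 at both primes of \<open>K\<close>; the
    conjugate prime is treated through \<open>cnj Z\<close>.\<close>
  define Z where "Z = (A + 1)\<^sup>2 * (A - 2)"
  have ZO: "Z \<in> OK" unfolding Z_def by (intro OK_intros AO)
  have "vge (2 + 2) (2 * (x - 1))" by (rule vge_mult[OF vge_two c2])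
  then have A4: "vge 4 (A - 2)" by (simp add: A_def algebra_simps)
  have "(A + 1)\<^sup>2 \<in> OK" by (intro OK_intros AO)
  then have Z4: "vge 4 Z" unfolding Z_def by (intro vge_mult0(1)[OF vge_OK A4])
  define B where "B = cnj A"
  have BO: "B \<in> OK" unfolding B_def by (rule OK_cnj[OF AO])
  define Y where "Y = cnj (2 * y)"
  have YO: "Y \<in> OK" unfolding Y_def by (rule OK_cnj[OF double_OK(2)])
  have "A\<^sup>2 - 4 = s * (2 * y)\<^sup>2" unfolding A_def using norm_one by Groebner_Basis.algebra
  from arg_cong[OF this, of cnj] have BY: "B\<^sup>2 - 4 = - s * Y\<^sup>2" by (simp add: B_def Y_def)
  have ns: "hasval 0 (- s)" using hasval_mult[OF hasval_neg_one_power[of 1] hasval_s] by simp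
  have cZ: "cnj Z = (B + 1)\<^sup>2 * (B - 2)" by (simp add: Z_def B_def)
  have "vge 4 (cnj Z)"
    using K_residue[OF om OK_subset[OF BO] vge_OK[OF BO]]
  proof
    assume "vge 2 (B - 1)"
    from vge_add[OF this vge_two] have "vge 2 (B + 1)" by (simp add: add.commute)
    from vge_mult[OF this this] have "vge 4 ((B + 1)\<^sup>2)" by (simp add: power2_eq_square)
    moreover have "B - 2 \<in> OK" by (intro OK_intros BO)
    ultimately show ?thesis unfolding cZ by (intro vge_mult0(2) vge_OK)
  next
    \<comment> \<open>\<open>v = B / 2\<close> and \<open>w = Y / 2\<close> satisfy the conjugate
      norm equation and are integral at \<open>P\<close>. An even \<open>v\<close> would make
      \<open>1 - s = 2 * (1 - \<omega>)\<close> divisible by 4, but it has valuation 2; so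
      \<open>v\<close> is odd and the factor \<open>B - 2\<close> supplies the 4.\<close>
    assume B2: "vge 2 B"
    define v where "v = B / 2"
    define w where "w = Y / 2"
    have vw: "v \<in> K" "w \<in> K" unfolding v_def w_def by (intro K_intros OK_subset[OF BO] OK_subset[OF YO])+
    have eq: "- s * w\<^sup>2 = v\<^sup>2 - 1" using BY by (simp add: v_def w_def field_simps)
    have "vge (int 2 + 0) (2 * v)" using B2 by (simp add: v_def)
    then have v0: "vge 0 v" by (rule vge_cancel[OF hasval_two])
    have "vge (2 + 2) (B\<^sup>2)" unfolding power2_eq_square by (rule vge_mult[OF B2 B2])
    moreover have "vge (2 + 2) (2 * 2)" by (rule vge_mult[OF vge_two vge_two])
    ultimately have "vge 4 (B\<^sup>2 - 4)" using vge_diff[of 4 "B\<^sup>2" 4] by simp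
    then have "vge (0 + 4) (- s * Y\<^sup>2)" unfolding BY by simp
    then have "vge 4 (Y\<^sup>2)" by (rule vge_cancel[OF ns])
    then have "vge (2 * 2 - 1) (Y\<^sup>2)" by (rule vge_mono) simp
    then have "vge 2 Y" using vge_square[of 2 Y] K_subset_F[OF OK_subset[OF YO]] by simp
    then have "vge (int 2 + 0) (2 * w)" by (simp add: w_def)
    then have w0: "vge 0 w" by (rule vge_cancel[OF hasval_two])
    have "\<not> vge 2 v"
    proof
      assume v2: "vge 2 v"
      have "vge 6 (w\<^sup>2 - 1)" by (rule y_odd[OF om vw(2) w0 hasval_imp_vge[OF ns] eq v2])
      then have 1: "vge 6 (- s * (w\<^sup>2 - 1))" by (rule vge_mult0(1)[OF hasval_imp_vge[OF ns]])
      have 2: "vge (2 + 2) (v\<^sup>2)" unfolding power2_eq_square by (rule vge_mult[OF v2 v2])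
      have "2 * (1 - \<omega>) = v\<^sup>2 - (- s * (w\<^sup>2 - 1))" using eq s_omega by Groebner_Basis.algebra
      then have "vge (2 + 2) (2 * (1 - \<omega>))" using vge_diff[OF 2 vge_mono[OF 1, of "2 + 2"]] by simp
      then have "vge 2 (1 - \<omega>)" using vge_cancel[OF hasval_two, of 2 "1 - \<omega>"] by simp
      then have "vge 1 (1 - \<omega>)" by (rule vge_mono) simp
      then have "1 - \<omega> \<in> P" using P_OK_iff[of "1 - \<omega>"] OK_diff[OF OK_simple(2) omega_OK] by blast
      then show False using omega' by blast
    qed
    then have "vge 2 (v - 1)" using K_residue[OF om vw(1) v0] by blast
    then have "vge (2 + 2) (2 * (v - 1))" by (rule vge_mult[OF vge_two])
    then have "vge 4 (B - 2)" by (simp add: v_def)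
    moreover have "(B + 1)\<^sup>2 \<in> OK" by (intro OK_intros BO)
    ultimately show ?thesis unfolding cZ by (intro vge_mult0(1) vge_OK)
  qed
  then have "cnj Z \<in> P" "Z \<in> P" using P_OK_iff ZO OK_cnj[OF ZO] vge_mono[of 4 _ 1] Z4 by auto
  then have Z2: "Z / 2 \<in> OK" using OK_half_both[OF om ZO] by blast
  have "vge 2 (Z / 2)" using vge_cancel[OF hasval_two, of 2 "Z / 2"] Z4 by simp
  then have "Z / 2 \<in> P" using P_OK_iff[OF Z2] vge_mono[of 2 _ 1] by auto
  moreover have "vge 2 (cnj (Z / 2))" using vge_cancel[OF hasval_two, of 2 "cnj Z / 2"] \<open>vge 4 (cnj Z)\<close> by simp
  then have "cnj (Z / 2) \<in> P" using P_OK_iff[OF OK_cnj[OF Z2]] vge_mono[of 2 _ 1] by auto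
  ultimately have "Z / 2 / 2 \<in> OK" by (rule OK_half_both[OF om Z2])
  \<comment> \<open>The coordinates of \<open>\<eta> ^ 3\<close>, simplified with
    \<open>s * y\<^sup>2 = x\<^sup>2 - 1\<close>.\<close>
  define x3 y3 where "x3 = 4 * x ^ 3 - 3 * x" and "y3 = y * (4 * x\<^sup>2 - 1)"
  have "x3 - 1 = Z / 2" by (simp add: x3_def Z_def A_def power2_eq_square power3_eq_cube algebra_simps)
  then have x3h: "(x3 - 1) / 2 \<in> OK" using \<open>Z / 2 / 2 \<in> OK\<close> by (simp only:)
  have "x3 = 2 * ((x3 - 1) / 2) + 1" by (simp add: field_simps)
  also have "\<dots> \<in> OK" by (intro OK_intros x3h)
  finally have x3O: "x3 \<in> OK" .
  have y3K: "y3 \<in> K" unfolding y3_def by (intro K_intros xy)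
  have n3: "x3\<^sup>2 - s * y3\<^sup>2 = 1" unfolding x3_def y3_def using norm_one by Groebner_Basis.algebra
  have e3: "x3 + y3 * \<alpha> = \<eta> ^ 3" unfolding x3_def y3_def using norm_one alpha_square by Groebner_Basis.algebra
  obtain g where g: "g \<in> F" "\<eta> ^ 3 = g\<^sup>2 \<or> \<eta> ^ 3 = - g\<^sup>2" using unit_square[OF x3O x3h y3K n3] unfolding e3 by blast
  have "\<eta> \<noteq> 0" by (rule hasval_nonzero[OF hasval_eta])
  then have "\<eta> = \<eta> ^ 3 / \<eta>\<^sup>2" by (simp add: power2_eq_square power3_eq_cube)
  then have "\<eta> = (g / \<eta>)\<^sup>2 \<or> \<eta> = - (g / \<eta>)\<^sup>2" using g(2) by (metis minus_divide_left power_divide)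
  moreover have "g / \<eta> \<in> F" by (intro F_intros g eta_F)
  ultimately show ?thesis by blast
qed

end

section \<open>The three residue classes of \<open>q\<close>\<close>

context quartic_ramified
begin

lemma fundamental_unit_coordinates:
  assumes "fundamental_unit F \<eta>" "q = 3 \<Longrightarrow> \<eta> - 1 \<in> P"
  obtains x y where "\<eta> = x + y * \<alpha>" "quartic_unit q s \<alpha> P \<theta> x y"
proof -
  have "\<eta> \<in> carrier (unit_group F)" using assms(1) by (auto simp: fundamental_unit_def Let_def)
  then have U: "\<eta> \<in> OF" "inverse \<eta> \<in> OF" "\<eta> \<noteq> 0" by (auto simp: unit_iff)
  then obtain x y where xy: "\<eta> = x + y * \<alpha>" "x \<in> K" "y \<in> K" by (auto simp: F_eq integers_of_def)
  have "x\<^sup>2 - s * y\<^sup>2 = 1" using norm_is_one[OF xy(2,3)] U assms(2) unfolding xy(1) by blast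
  then have "quartic_unit q s \<alpha> P \<theta> x y"
    using xy U(1) by (intro quartic_unit.intro quartic_ramified_axioms quartic_unit_axioms.intro) simp_all
  with xy(1) show ?thesis by (rule that)
qed

text \<open>With \<open>\<theta> = 1\<close> the only prime of \<open>K\<close> above 2 is the one
  below \<open>P\<close>, so \<open>x\<close> and \<open>y\<close> are integral outright. The
  residue 1 of \<open>x\<close> would make \<open>\<eta>\<close> a square up to sign, and the
  residue 0 contradicts the norm equation.\<close>

theorem ord_log_mod_8_3:
  assumes \<eta>: "fundamental_unit F \<eta>" "q = 3 \<Longrightarrow> \<eta> - 1 \<in> P" and om: "\<omega> \<notin> P" and \<theta>: "\<theta> = 1"
  shows "ord_completion F P (log_completion F P (to_completion F P \<eta>)) = 0"
proof -
  obtain x y where xy: "\<eta> = x + y * \<alpha>" "quartic_unit q s \<alpha> P \<theta> x y"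
    using \<eta> by (rule fundamental_unit_coordinates)
  interpret E: quartic_unit q s \<alpha> P \<theta> x y by (rule xy(2))
  have half: "z / 2 \<in> OK" if z: "z \<in> OK" "vge 1 z" for z
  proof -
    have "z \<in> P" using P_OK_iff z by blast
    then obtain t where "t \<in> OK" "z = 2 * t" using theta_half[OF z(1)] \<theta> by auto
    then show ?thesis by simp
  qed
  have int: "z \<in> OK" if z: "2 * z \<in> OK" "vge 0 z" for z
  proof -
    have "vge (2 + 0) (2 * z)" by (rule vge_mult[OF vge_two z(2)])
    then have "vge 1 (2 * z)" by (rule vge_mono) simp
    then show ?thesis using half[OF z(1)] by simp
  qed
  have xO: "x \<in> OK" by (rule int[OF E.double_OK(1) E.vge_xy(1)])
  have yO: "y \<in> OK" by (rule int[OF E.double_OK(2) E.vge_xy(2)])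
  have "\<not> vge 1 (x - 1)"
  proof
    assume "vge 1 (x - 1)"
    then have "(x - 1) / 2 \<in> OK" by (intro half OK_diff xO OK_simple)
    from unit_square[OF xO this E.xy(2) E.norm_one] obtain g where "g \<in> F" "\<eta> = g\<^sup>2 \<or> \<eta> = - g\<^sup>2"
      unfolding xy(1) by blast
    then show False using fundamental_unit_not_square[OF \<eta>(1)] by blast
  qed
  moreover have "\<not> vge 1 x"
  proof
    assume x1: "vge 1 x"
    then have x2: "vge 2 x" using vge_even[OF E.xy(1), of 1] by simp
    have xx: "vge (2 + 2) (x\<^sup>2)" unfolding power2_eq_square by (rule vge_mult[OF x2 x2])
    have eq: "s * y\<^sup>2 = x\<^sup>2 - 1" using E.norm_one by (simp add: algebra_simps)
    have sO: "vge 0 s" by (rule vge_OK[OF OK_s])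
    \<comment> \<open>For even \<open>x\<close> the norm equation makes \<open>y - 1\<close> even.
      Putting \<open>y = 2 * w + 1\<close> back into it gives \<open>2 * \<omega>\<close> divisible
      by 4, although \<open>\<omega>\<close> is outside \<open>P\<close>.\<close>
    have "2 * (\<omega> * y\<^sup>2 - y + 1) - x\<^sup>2 = (y - 1)\<^sup>2" using eq s_omega by Groebner_Basis.algebra
    moreover have "\<omega> * y\<^sup>2 - y + 1 \<in> OK" by (intro OK_intros omega_OK yO)
    then have "vge (2 + 0) (2 * (\<omega> * y\<^sup>2 - y + 1))" by (intro vge_mult vge_two vge_OK)
    ultimately have "vge 2 ((y - 1)\<^sup>2)" using vge_diff[of 2 _ "x\<^sup>2"] vge_mono[OF xx, of 2] by fastforce
    then have "vge (2 * 1 - 1) ((y - 1)\<^sup>2)" by (rule vge_mono) simp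
    moreover have "y - 1 \<in> OK" by (intro OK_intros yO)
    ultimately have "vge 1 (y - 1)" using vge_square[of 1 "y - 1"] K_subset_F OK_subset by blast
    define w where "w = (y - 1) / 2"
    have wO: "w \<in> OK" unfolding w_def by (rule half[OF \<open>y - 1 \<in> OK\<close> \<open>vge 1 (y - 1)\<close>])
    have yw: "y = 2 * w + 1" by (simp add: w_def)
    have "s * (w * (w + 1)) \<in> OK" by (intro OK_intros wO)
    then have "vge (2 + (2 + 0)) (2 * (2 * (s * (w * (w + 1)))))" by (intro vge_mult vge_two vge_OK)
    moreover have "2 * \<omega> = x\<^sup>2 - 2 * (2 * (s * (w * (w + 1))))"
      using eq s_omega unfolding yw by Groebner_Basis.algebra
    ultimately have "vge (2 + 2) (2 * \<omega>)" using vge_diff[OF xx, of "2 * (2 * (s * (w * (w + 1))))"] by simp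
    then have "vge 2 \<omega>" using vge_cancel[OF hasval_two, of 2 \<omega>] by simp
    then have "vge 1 \<omega>" by (rule vge_mono) simp
    then show False using om P_OK_iff[OF omega_OK] by blast
  qed
  ultimately show ?thesis unfolding xy(1) by (intro E.ord_log_inert)
qed

lemma omega_valuation:
  assumes "hasval k (of_int Q)"
  shows "hasval k \<omega>"
proof -
  have oO: "1 - \<omega> \<in> OK" by (rule OK_diff[OF OK_simple(2) omega_OK])
  then have h: "hasval 0 (1 - \<omega>)" using omega' inO by (intro hasval_unit) blast
  from hasval_divide[OF assms h] have "hasval k (of_int Q / (1 - \<omega>))" by simp
  moreover have "of_int Q / (1 - \<omega>) = \<omega>"
    unfolding omega_square[symmetric] using hasval_nonzero[OF h] by simp
  ultimately show ?thesis by simp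
qed

lemma hasval_two_odd: "odd m \<Longrightarrow> hasval 2 (of_int (2 * m))"
  using hasval_mult[OF hasval_two hasval_unit[of "of_int m"]] int_of_int P_even by simp

text \<open>\<open>2 * \<omega>\<close> has valuation 4, below the precision 6 to which it
  approximates \<open>x\<^sup>2\<close>; so \<open>x\<close> has valuation exactly 2, once the
  residue 1 is excluded.\<close>

theorem ord_log_mod_16_7:
  assumes \<eta>: "fundamental_unit F \<eta>" "q = 3 \<Longrightarrow> \<eta> - 1 \<in> P" and om: "\<omega> \<in> P" and Q: "Q = 2 * m" "odd m"
  shows "ord_completion F P (log_completion F P (to_completion F P \<eta>)) = 2"
proof -
  obtain x y where xy: "\<eta> = x + y * \<alpha>" "quartic_unit q s \<alpha> P \<theta> x y"
    using \<eta> by (rule fundamental_unit_coordinates)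
  interpret E: quartic_unit q s \<alpha> P \<theta> x y by (rule xy(2))
  have "\<not> vge 2 (x - 1)"
  proof
    assume "vge 2 (x - 1)"
    from E.square_split_odd[OF om this] show False
      using fundamental_unit_not_square[OF \<eta>(1)] unfolding xy(1) by blast
  qed
  then have x2: "vge 2 x" using K_residue[OF om E.xy(1) E.vge_xy(1)] by blast
  have "hasval 2 \<omega>" by (rule omega_valuation) (use hasval_two_odd[OF Q(2)] Q(1) in simp)
  from hasval_mult[OF hasval_two this] have h: "hasval 4 (2 * \<omega>)" by simp
  have F: "\<omega> \<in> F" "x \<in> F" using K_subset_F OK_subset[OF omega_OK] E.xy by blast+
  have "vge (4 + 1) (x\<^sup>2 - 2 * \<omega>)" by (rule vge_mono[OF E.x_even_square[OF om x2]]) simp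
  then have "hasval 4 (2 * \<omega> + (x\<^sup>2 - 2 * \<omega>))" by (rule hasval_add[OF h]) (intro F_intros F)+
  then have "hasval (2 * 2) (x\<^sup>2)" by simp
  then have "hasval 2 x" by (rule hasval_square[OF _ F(2)])
  then show ?thesis unfolding xy(1) by (rule E.ord_log_split_7)
qed

text \<open>Both residues of \<open>x\<close> lead to the bound. For \<open>x \<equiv> 0\<close>
  both \<open>2 * \<omega>\<close> and \<open>x\<^sup>2\<close> have valuation at least 6, so
  \<open>x\<close> has at least 3 and, being in \<open>K\<close>, at least 4.\<close>

theorem ord_log_mod_16_15:
  assumes \<eta>: "fundamental_unit F \<eta>" "q = 3 \<Longrightarrow> \<eta> - 1 \<in> P" and om: "\<omega> \<in> P" and Q: "Q = 4 * m"
  shows "ord_completion F P (log_completion F P (to_completion F P \<eta>)) \<ge> 4"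
proof -
  obtain x y where xy: "\<eta> = x + y * \<alpha>" "quartic_unit q s \<alpha> P \<theta> x y"
    using \<eta> by (rule fundamental_unit_coordinates)
  interpret E: quartic_unit q s \<alpha> P \<theta> x y by (rule xy(2))
  show ?thesis
    using K_residue[OF om E.xy(1) E.vge_xy(1)]
  proof
    assume "vge 2 (x - 1)"
    then show ?thesis unfolding xy(1) by (rule E.ord_log_split_odd[OF om])
  next
    assume x2: "vge 2 x"
    have "Q \<noteq> 0" using q_eq by auto
    then obtain k where k: "hasval k (of_int Q)" using hasval_ex[of "of_int Q"] F_intros(10) by auto
    have "vge (2 + (2 + 0)) (2 * (2 * of_int m))" by (intro vge_mult vge_two vge_int int_of_int)
    then have "vge 4 (of_int Q)" by (simp add: Q)
    then have "4 \<le> k" using hasval_vge_iff[OF k] by simp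
    then have "vge 4 \<omega>" using hasval_vge_iff[OF omega_valuation[OF k]] by simp
    from vge_mult[OF vge_two this] have 1: "vge 6 (2 * \<omega>)" by simp
    from vge_add[OF E.x_even_square[OF om x2] this] have "vge 6 (x\<^sup>2)" by simp
    then have "vge (2 * 3 - 1) (x\<^sup>2)" by (rule vge_mono) simp
    then have "vge (2 * 2 - 1) x" using vge_square[of 3 x] K_subset_F[OF E.xy(1)] by simp
    then have "vge 4 x" using vge_even[OF E.xy(1), of 2] by simp
    then show ?thesis unfolding xy(1) by (rule E.ord_log_split_15)
  qed
qed

end

section \<open>Selection of the ramified prime above 2\<close>

context quartic_prime
begin

lemma omega_cases: "even Q \<Longrightarrow> \<omega> \<in> P \<or> 1 - \<omega> \<in> P"
proof -
  assume "even Q"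
  then have "\<omega> * (1 - \<omega>) \<in> P" unfolding omega_square P_even .
  then show ?thesis by (rule P_prime[rotated 2]) (intro inO OK_intros omega_OK)+
qed

text \<open>For odd \<open>Q\<close> none of 1, \<open>\<omega>\<close> and
  \<open>1 + \<omega>\<close> lies in \<open>P\<close>, so the elements of \<open>OK\<close> in
  \<open>P\<close> are exactly the multiples of 2.\<close>

lemma ramified_inert: "odd Q \<Longrightarrow> \<omega> \<notin> P \<and> quartic_ramified q s \<alpha> P 1"
proof -
  assume Q: "odd Q"
  have oO: "\<omega> \<in> OF" "1 - \<omega> \<in> OF" by (intro inO OK_intros omega_OK)+
  have "\<omega> * (1 - \<omega>) \<notin> P" unfolding omega_square P_even using Q by simp
  then have om: "\<omega> \<notin> P" "1 - \<omega> \<notin> P" using P_multl[OF oO(1)] P_multr[OF _ oO(2)] by blast+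
  have "\<exists>t\<in>OK. 1 * z = 2 * t" if z: "z \<in> OK" "z \<in> P" for z
  proof -
    obtain a b where ab: "z = of_int a + of_int b * \<omega>" using z(1) by (rule OK_omega)
    have "even b"
    proof (rule ccontr)
      assume "odd b"
      then have b: "of_int (b - 1) * \<omega> \<in> P" by (intro P_multr oO) (simp only: P_even, simp)
      from P_diff[OF z(2) b] have 1: "of_int a + \<omega> \<in> P" by (simp add: ab algebra_simps)
      show False
      proof (cases "even a")
        case True
        then have "of_int a \<in> P" using P_even by blast
        from P_diff[OF 1 this] show False using om by simp
      next
        case False
        then have "even (a + 1)" by simp
        then have "of_int (a + 1) \<in> P" unfolding P_even .
        from P_diff[OF this 1] show False using om by simp
      qed
    qed
    then obtain b' where b': "b = 2 * b'" by blast
    have "of_int b * \<omega> \<in> P" using \<open>even b\<close> by (intro P_multr oO) (simp only: P_even)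
    from P_diff[OF z(2) this] have "even a" using P_even[of a] by (simp add: ab)
    then obtain a' where a': "a = 2 * a'" by blast
    have "1 * z = 2 * (of_int a' + of_int b' * \<omega>)" by (simp add: ab a' b' algebra_simps)
    moreover have "of_int a' + of_int b' * \<omega> \<in> OK" by (intro OK_intros omega_OK)
    ultimately show ?thesis by blast
  qed
  then have "quartic_ramified q s \<alpha> P 1"
    using one_notin_P om OK_simple
    by (intro quartic_ramified.intro quartic_prime_axioms quartic_ramified_axioms.intro) auto
  with om show ?thesis by blast
qed

text \<open>\<open>a + b * \<omega>\<close> lies in \<open>P\<close> only for even \<open>a\<close>,
  and multiplication by \<open>1 - \<omega>\<close> turns the second term into \<open>b * Q\<close>,
  which is even.\<close>

lemma ramified_split:
  assumes Q: "even Q" and om: "\<omega> \<in> P"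
  shows "quartic_ramified q s \<alpha> P (1 - \<omega>)"
proof -
  obtain m where m: "Q = 2 * m" using Q by blast
  have "\<exists>t\<in>OK. (1 - \<omega>) * z = 2 * t" if z: "z \<in> OK" "z \<in> P" for z
  proof -
    obtain a b where ab: "z = of_int a + of_int b * \<omega>" using z(1) by (rule OK_omega)
    have "of_int b * \<omega> \<in> P" by (rule P_multl[OF int_of_int om])
    from P_diff[OF z(2) this] have "even a" using P_even[of a] by (simp add: ab)
    then obtain a' where a': "a = 2 * a'" by blast
    have "(1 - \<omega>) * z = of_int a * (1 - \<omega>) + of_int b * (\<omega> * (1 - \<omega>))" by (simp add: ab algebra_simps)
    also have "\<dots> = 2 * (of_int a' * (1 - \<omega>) + of_int (b * m))"
      unfolding omega_square a' m by (simp add: algebra_simps)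
    finally have "(1 - \<omega>) * z = 2 * (of_int a' * (1 - \<omega>) + of_int (b * m))" .
    moreover have "of_int a' * (1 - \<omega>) + of_int (b * m) \<in> OK" by (intro OK_intros omega_OK)
    ultimately show ?thesis by blast
  qed
  moreover have "1 - \<omega> \<notin> P" using P_add[OF _ om, of "1 - \<omega>"] one_notin_P by auto
  moreover have "1 - \<omega> \<in> OK" by (intro OK_intros omega_OK)
  ultimately show ?thesis
    by (intro quartic_ramified.intro quartic_prime_axioms quartic_ramified_axioms.intro) auto
qed

text \<open>For even \<open>Q\<close>, \<open>P\<close> contains \<open>\<omega>\<close> or
  \<open>1 - \<omega>\<close>; the second would give ramification index 1, so the assumption
  \<open>ramified\<close> selects the first.\<close>

theorem ord_log_fundamental_unit:
  assumes ram: "ramified F P 2" and \<eta>: "fundamental_unit F \<eta>" "q = 3 \<Longrightarrow> \<eta> - 1 \<in> P"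
  shows "q mod 8 = 3 \<Longrightarrow> ord_completion F P (log_completion F P (to_completion F P \<eta>)) = 0"
    and "q mod 16 = 7 \<Longrightarrow> ord_completion F P (log_completion F P (to_completion F P \<eta>)) = 2"
    and "q mod 16 = 15 \<Longrightarrow> ord_completion F P (log_completion F P (to_completion F P \<eta>)) \<ge> 4"
proof -
  have om: "\<omega> \<in> P" if "even Q"
    using omega_cases[OF that] unramified_case[OF that] ram by (auto simp: ramified_def)
  {
    assume "q mod 8 = 3"
    then have "odd Q" using q_eq by presburger
    then have "\<omega> \<notin> P" "quartic_ramified q s \<alpha> P 1" using ramified_inert by blast+
    then show "ord_completion F P (log_completion F P (to_completion F P \<eta>)) = 0"
      using quartic_ramified.ord_log_mod_8_3[OF _ \<eta>] by blast
  next
    assume "q mod 16 = 7"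
    then have "Q mod 4 = 2" using q_eq by presburger
    then have m: "Q = 2 * (Q div 2)" "odd (Q div 2)" by presburger+
    have "even Q" by (subst m(1)) simp
    then have "\<omega> \<in> P" "quartic_ramified q s \<alpha> P (1 - \<omega>)" using om ramified_split by auto
    then show "ord_completion F P (log_completion F P (to_completion F P \<eta>)) = 2"
      using quartic_ramified.ord_log_mod_16_7[OF _ \<eta> _ m] by blast
  next
    assume "q mod 16 = 15"
    then have "4 dvd Q" using q_eq by presburger
    then obtain m where m: "Q = 4 * m" by blast
    have "\<omega> \<in> P" "quartic_ramified q s \<alpha> P (1 - \<omega>)" using om ramified_split m by auto
    then show "ord_completion F P (log_completion F P (to_completion F P \<eta>)) \<ge> 4"
      using quartic_ramified.ord_log_mod_16_15[OF _ \<eta> _ m] by blast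
  }
qed

end

theorem theorem1:
  fixes q :: nat and s \<alpha> \<eta> :: complex and K F P :: "complex set"
  assumes "Factorial_Ring.prime q" and "[q = 3] (mod 4)"
    and "s\<^sup>2 = - of_nat q" and "K = adjoin \<rat> s"
    and "\<alpha>\<^sup>2 = s" and "F = adjoin K \<alpha>"
    and "prime_above F 2 P" and "ramified F P 2"
    and "fundamental_unit F \<eta>"
    and "q = 3 \<Longrightarrow> \<eta> - 1 \<in> P"
  shows "([q = 3] (mod 8) \<longrightarrow>
            ord_completion F P (log_completion F P (to_completion F P \<eta>)) = 0) \<and>
         ([q = 7] (mod 16) \<longrightarrow>
            ord_completion F P (log_completion F P (to_completion F P \<eta>)) = 2) \<and>
         ([q = 15] (mod 16) \<longrightarrow>
            ord_completion F P (log_completion F P (to_completion F P \<eta>)) \<ge> 4)"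
proof -
  have quad: "quadratic q s" using assms(1-3) by (intro quadratic.intro) (simp_all add: Cong.cong_def)
  then have quart: "quartic q s \<alpha>" using assms(5) by (intro quartic.intro quartic_axioms.intro)
  have F: "F = quartic.F s \<alpha>"
    unfolding assms(6,4) quartic.F_def[OF quart] quadratic.K_def[OF quad] ..
  have "quartic_prime q s \<alpha> P"
    using quart assms(7) unfolding F by (intro quartic_prime.intro quartic_prime_axioms.intro)
  note main = quartic_prime.ord_log_fundamental_unit[OF this assms(8-10)[unfolded F]]
  show ?thesis
    unfolding F Cong.cong_def using main by simp
qed

end
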